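(* Let $\Omega\subset\mathbb{R}^3$ be open, bounded and convex with $\mathcal{L}^3(\Omega)=1$. For any $T\in(0,\infty)$ and any $\overline{\alpha}\in\mathcal{P}_c(\mathbb{R}^3)$, there exists an energy-conserving geostrophic solution $\alpha\in C([0,T];\mathcal{P}_c(\mathbb{R}^3))$ with initial measure $\overline{\alpha}$ and a sequence $(\alpha^N)_{N\in\mathbb{N}}$ of continuously differentiable discrete geostrophic solutions on $[0,T]$ such that $\lim_{N\to\infty}\sup_{t\in[0,T]}W_2(\alpha^N_t,\alpha_t)=0$.
   Context: $\mathcal{L}^3$ is Lebesgue measure, $\mathcal{L}^3\llcorner\Omega$ its restriction to $\Omega$. $\mathcal{P}_c(\mathbb{R}^3)$ is the set of compactly supported Borel probability measures on $\mathbb{R}^3$, equipped with the Wasserstein 2-distance $W_2$; $C([0,T];\mathcal{P}_c(\mathbb{R}^3))$ denotes continuous maps w.r.t. $W_2$. For a probability measure $\nu$ with finite second moment, $\mathcal{B}[\nu]$ denotes the unique mean-zero convex function in $H^1(\Omega)$ whose gradient is the optimal transport map from $\mathcal{L}^3\llcorner\Omega$ to $\nu$ for the cost $|x-y|^2$. $J$ is the $3\times 3$ matrix with rows $(0,-1,0),(1,0,0),(0,0,0)$. $\mathcal{Q}^N(\mathbb{R}^3)$ is the set of measures $\sum_{i=1}^N m_i\delta_{z_i}$ with $m_i>0$, $\sum_i m_i=1$, and $z_i\neq z_j$ for $i\neq j$. A map $\alpha\in C([0,T];\mathcal{P}_c(\mathbb{R}^3))$ is a geostrophic solution on $[0,T]$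 with initial measure $\overline{\alpha}$ if for all $\varphi\in C_c^\infty(\mathbb{R}^3\times\mathbb{R})$, $$\int_0^T\!\!\int_{\mathbb{R}^3}\big(\partial_t\varphi(z,t)+Jz\cdot\nabla\varphi(z,t)\big)\,d\alpha_t(z)\,dt-\int_0^T\!\!\int_\Omega Jx\cdot\nabla\varphi\big(\nabla\mathcal{B}[\alpha_t](x),t\big)\,dx\,dt=\int_{\mathbb{R}^3}\varphi(z,T)\,d\alpha_T(z)-\int_{\mathbb{R}^3}\varphi(z,0)\,d\overline{\alpha}(z),$$ where $\nabla\varphi$ is the spatial gradient. It is a continuously differentiable discrete geostrophic solution if moreover there exist $N$, masses $m_i>0$ with $\sum m_i=1$ and a continuously differentiable map $(z_1,\dots,z_N):[0,T]\to\mathbb{R}^{3N}$ with $\alpha_t=\sum_i m_i\delta_{z_i(t)}\in\mathcal{Q}^N(\mathbb{R}^3)$ for all $t$. The geostrophic energy of $\nu\in\mathcal{P}_c(\mathbb{R}^3)$ is $E[\nu]=\int_\Omega\big(\tfrac12((\partial_1\mathcal{B}[\nu](x)-x_1)^2+(\partial_2\mathcal{B}[\nu](x)-x_2)^2)-x_3\partial_3\mathcal{B}[\nu](x)\big)\,dx$; a solution is energy-conserving if $t\mapsto E[\alpha_t]$ is constant. *)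

theory Defs
  imports "HOL-Probability.Probability"
begin

fun Ck :: "nat \<Rightarrow> ('a::real_normed_vector \<Rightarrow> real) \<Rightarrow> bool" where
  "Ck 0 f = continuous_on UNIV f"
| "Ck (Suc k) f = ((\<forall>x. f differentiable (at x)) \<and>
      (\<forall>v. Ck k (\<lambda>x. frechet_derivative f (at x) v)))"

definition smooth_compact :: "('a::real_normed_vector \<Rightarrow> real) \<Rightarrow> bool" where
  "smooth_compact f \<longleftrightarrow> (\<forall>k. Ck k f) \<and> compact (closure {x. f x \<noteq> 0})"

definition grad :: "(real^3 \<Rightarrow> real) \<Rightarrow> real^3 \<Rightarrow> real^3" where
  "grad f x = (if f differentiable (at x)
               then (\<chi> i. frechet_derivative f (at x) (axis i 1)) else 0)"

definition sgrad :: "((real^3) \<times> real \<Rightarrow> real) \<Rightarrow> real^3 \<Rightarrow> real \<Rightarrow> real^3" where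
  "sgrad \<phi> z t = (\<chi> i. frechet_derivative \<phi> (at (z, t)) (axis i 1, 0))"

definition tderiv :: "((real^3) \<times> real \<Rightarrow> real) \<Rightarrow> real^3 \<Rightarrow> real \<Rightarrow> real" where
  "tderiv \<phi> z t = frechet_derivative \<phi> (at (z, t)) (0, 1)"

definition Pc :: "(real^3) measure set" where
  "Pc = {\<mu>. sets \<mu> = sets borel \<and> prob_space \<mu> \<and>
             (\<exists>K. compact K \<and> emeasure \<mu> K = 1)}"

definition couplings :: "(real^3) measure \<Rightarrow> (real^3) measure \<Rightarrow> ((real^3) \<times> (real^3)) measure set" where
  "couplings \<mu> \<nu> = {\<pi>. sets \<pi> = sets borel \<and>
       distr \<pi> borel fst = \<mu> \<and> distr \<pi> borel snd = \<nu>}"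

definition W2 :: "(real^3) measure \<Rightarrow> (real^3) measure \<Rightarrow> real" where
  "W2 \<mu> \<nu> = sqrt (enn2real (INF \<pi>\<in>couplings \<mu> \<nu>.
                 \<integral>\<^sup>+ p. ennreal ((norm (fst p - snd p))\<^sup>2) \<partial>\<pi>))"

definition LebOmega :: "(real^3) set \<Rightarrow> (real^3) measure" where
  "LebOmega \<Omega> = density lborel (indicator \<Omega>)"

definition is_ot_map :: "(real^3) set \<Rightarrow> (real^3) measure \<Rightarrow> (real^3 \<Rightarrow> real^3) \<Rightarrow> bool" where
  "is_ot_map \<Omega> \<nu> T \<longleftrightarrow>
     (\<forall>A\<in>sets borel. T -` A \<inter> \<Omega> \<in> sets lebesgue \<and>
                     emeasure lebesgue (T -` A \<inter> \<Omega>) = emeasure \<nu> A) \<and>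
     (\<forall>\<pi>\<in>couplings (LebOmega \<Omega>) \<nu>.
        (\<integral>\<^sup>+ x. indicator \<Omega> x * ennreal ((norm (x - T x))\<^sup>2) \<partial>lebesgue)
          \<le> (\<integral>\<^sup>+ p. ennreal ((norm (fst p - snd p))\<^sup>2) \<partial>\<pi>))"

text \<open>Brenier potential: mean-zero convex function in H^1(Omega) whose gradient is the optimal
  transport map. Functions are normalised to be 0 outside Omega (they only matter on Omega).
  For convex (hence locally Lipschitz) functions the weak gradient is the a.e. classical one.\<close>
definition is_brenier :: "(real^3) set \<Rightarrow> (real^3) measure \<Rightarrow> (real^3 \<Rightarrow> real) \<Rightarrow> bool" where
  "is_brenier \<Omega> \<nu> \<psi> \<longleftrightarrow>
     convex_on \<Omega> \<psi> \<and> (\<forall>x. x \<notin> \<Omega> \<longrightarrow> \<psi> x = 0) \<and>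
     integrable (lebesgue_on \<Omega>) (\<lambda>x. (\<psi> x)\<^sup>2) \<and>
     integrable (lebesgue_on \<Omega>) (\<lambda>x. (norm (grad \<psi> x))\<^sup>2) \<and>
     integral\<^sup>L (lebesgue_on \<Omega>) \<psi> = 0 \<and>
     is_ot_map \<Omega> \<nu> (grad \<psi>)"

definition brenier :: "(real^3) set \<Rightarrow> (real^3) measure \<Rightarrow> real^3 \<Rightarrow> real" where
  "brenier \<Omega> \<nu> = (THE \<psi>. is_brenier \<Omega> \<nu> \<psi>)"

definition Jmat :: "real^3^3" where
  "Jmat = vector [vector [0, -1, 0], vector [1, 0, 0], vector [0, 0, 0]]"

definition W2_continuous :: "real \<Rightarrow> (real \<Rightarrow> (real^3) measure) \<Rightarrow> bool" where
  "W2_continuous T \<alpha> \<longleftrightarrow> (\<forall>t\<in>{0..T}. \<alpha> t \<in> Pc) \<and>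
     (\<forall>t\<in>{0..T}. \<forall>e>0. \<exists>d>0. \<forall>s\<in>{0..T}. \<bar>s - t\<bar> < d \<longrightarrow> W2 (\<alpha> s) (\<alpha> t) < e)"

definition geostrophic_solution ::
  "(real^3) set \<Rightarrow> real \<Rightarrow> (real^3) measure \<Rightarrow> (real \<Rightarrow> (real^3) measure) \<Rightarrow> bool" where
  "geostrophic_solution \<Omega> T \<alpha>0 \<alpha> \<longleftrightarrow> W2_continuous T \<alpha> \<and>
     (\<forall>\<phi>. smooth_compact \<phi> \<longrightarrow>
        integral {0..T} (\<lambda>t. integral\<^sup>L (\<alpha> t)
            (\<lambda>z. tderiv \<phi> z t + (Jmat *v z) \<bullet> sgrad \<phi> z t))
      - integral {0..T} (\<lambda>t. integral\<^sup>L (lebesgue_on \<Omega>)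
            (\<lambda>x. (Jmat *v x) \<bullet> sgrad \<phi> (grad (brenier \<Omega> (\<alpha> t)) x) t))
      = integral\<^sup>L (\<alpha> T) (\<lambda>z. \<phi> (z, T)) - integral\<^sup>L \<alpha>0 (\<lambda>z. \<phi> (z, 0)))"

definition discrete_C1 :: "real \<Rightarrow> (real \<Rightarrow> (real^3) measure) \<Rightarrow> bool" where
  "discrete_C1 T \<alpha> \<longleftrightarrow> (\<exists>(N::nat) (m::nat \<Rightarrow> real) (z::nat \<Rightarrow> real \<Rightarrow> real^3)
        (z'::nat \<Rightarrow> real \<Rightarrow> real^3).
     (\<forall>i<N. m i > 0) \<and> (\<Sum>i<N. m i) = 1 \<and>
     (\<forall>i<N. continuous_on {0..T} (z' i) \<and>
        (\<forall>t\<in>{0..T}. (z i has_vector_derivative z' i t) (at t within {0..T}))) \<and>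
     (\<forall>t\<in>{0..T}. \<forall>i<N. \<forall>j<N. i \<noteq> j \<longrightarrow> z i t \<noteq> z j t) \<and>
     (\<forall>t\<in>{0..T}. sets (\<alpha> t) = sets borel \<and>
        (\<forall>A\<in>sets borel. emeasure (\<alpha> t) A = (\<Sum>i<N. ennreal (m i) * indicator A (z i t)))))"

definition discrete_geostrophic_solution ::
  "(real^3) set \<Rightarrow> real \<Rightarrow> (real^3) measure \<Rightarrow> (real \<Rightarrow> (real^3) measure) \<Rightarrow> bool" where
  "discrete_geostrophic_solution \<Omega> T \<alpha>0 \<alpha> \<longleftrightarrow>
     geostrophic_solution \<Omega> T \<alpha>0 \<alpha> \<and> discrete_C1 T \<alpha>"

definition energy :: "(real^3) set \<Rightarrow> (real^3) measure \<Rightarrow> real" where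
  "energy \<Omega> \<nu> = integral\<^sup>L (lebesgue_on \<Omega>) (\<lambda>x.
      (1/2) * ((grad (brenier \<Omega> \<nu>) x $ 1 - x $ 1)\<^sup>2 + (grad (brenier \<Omega> \<nu>) x $ 2 - x $ 2)\<^sup>2)
      - x $ 3 * grad (brenier \<Omega> \<nu>) x $ 3)"

definition energy_conserving :: "(real^3) set \<Rightarrow> real \<Rightarrow> (real \<Rightarrow> (real^3) measure) \<Rightarrow> bool" where
  "energy_conserving \<Omega> T \<alpha> \<longleftrightarrow> (\<forall>t\<in>{0..T}. energy \<Omega> (\<alpha> t) = energy \<Omega> (\<alpha> 0))"

end

theory Submission
  imports Defs "HOL-Complex_Analysis.Great_Picard"
begin

text \<open>The obstacle is the nonlinear term \<open>grad (brenier \<Omega> (\<alpha> t))\<close>: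
  weak convergence of the measures does not by itself pass to the limit in it. For potentials the
  difficulty disappears, since pointwise convergence improves by convexity to convergence of
  gradients almost everywhere, and the common bound \<open>R\<close> then permits dominated
  convergence in every integral that occurs. Measures are compared through integrals of 1-Lipschitz
  functions of the gradient, because displacing particles changes these by at most the mean
  displacement. The return from such moments to potentials rests on compactness and gives no rate.
  The constant \<open>R = (B + 1 + r) * exp T\<close> has three sources: the initial measure lives
  in a ball of radius \<open>B\<close>, its particle approximations stay within distance 1 of that
  ball, and barycentres have norm at most \<open>r\<close>, so that speeds are at most
  \<open>norm z + r\<close> and Gronwall's bound contributes the exponential. The same
  \<open>R\<close> bounds positions and speeds, is the Lipschitz constant of the potentials in
  space, and controls the moments in time.\<close>

text \<open>
A convex function is differentiable almost everywhere, and if convex functions converge pointwise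
then so do their gradients, almost everywhere. Hence all objects can be carried by mean-zero convex
potentials on \<open>\<Omega>\<close> with a common Lipschitz bound: the measure attached to a potential is the image of
Lebesgue measure on \<open>\<Omega>\<close> under its gradient, and duality with the Legendre transform shows that this
gradient is the unique optimal map. The potentials form a compact set on which the image measure
determines the potential, so closeness of measures controls, uniformly, closeness of potentials.

Discrete solutions solve an ODE for particles that move with velocity \<open>J (z - b)\<close>, \<open>b\<close> the
barycentre of the Laguerre cell of \<open>z\<close>. The cells come from minimising the semi-discrete dual
functional and depend continuously on the particles, so Peano's theorem applies; \<open>J\<close> does not move
the third coordinate, so particles that start at distinct heights never collide. The energy is
the transport cost up to conserved terms and has derivative zero because \<open>w \<bullet> J w = 0\<close>.

For particle approximations of the initial measure, the potentials are equicontinuous in space and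
time, so a subsequence converges uniformly (Arzela-Ascoli). Convergence of the gradients passes to
the limit in the weak formulation and in the energy, and bounds the Wasserstein distances.
\<close>

section \<open>Convex functions are differentiable almost everywhere\<close>

text \<open>Fubini for the integral of \<open>indicator A (x + t *\<^sub>R e)\<close> over all \<open>x\<close> and over \<open>t \<in> {0..1}\<close>; by
  translation invariance it equals the measure of \<open>A\<close>.\<close>

lemma null_set_countable_lines:
  fixes A :: "'a::euclidean_space set" and e :: 'a
  assumes A[measurable]: "A \<in> sets borel"
    and c: "\<And>x. countable {t::real. x + t *\<^sub>R e \<in> A}"
  shows "A \<in> null_sets lborel"
proof -
  have shift: "(\<integral>\<^sup>+x. indicator A (x + v) \<partial>lborel) = emeasure lborel A" for v :: 'a
  proof -
    have "emeasure lborel A = (\<integral>\<^sup>+x. indicator A x \<partial>distr lborel borel ((+) v))"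
      by (simp add: lborel_distr_plus)
    also have "\<dots> = (\<integral>\<^sup>+x. indicator A (v + x) \<partial>lborel)"
      by (subst nn_integral_distr) auto
    finally show ?thesis by (simp add: add.commute)
  qed
  have "emeasure lborel A = (\<integral>\<^sup>+t. indicator {0..1} t * emeasure lborel A \<partial>(lborel :: real measure))"
    by (simp add: nn_integral_multc)
  also have "\<dots> = (\<integral>\<^sup>+t. (\<integral>\<^sup>+x. indicator {0..1} t * indicator A (x + t *\<^sub>R e) \<partial>lborel) \<partial>(lborel :: real measure))"
    by (simp add: nn_integral_cmult shift)
  also have "\<dots> = (\<integral>\<^sup>+x. (\<integral>\<^sup>+t. indicator {0..1} t * indicator A (x + t *\<^sub>R e) \<partial>(lborel :: real measure)) \<partial>lborel)"
    by (rule lborel_pair.Fubini') measurable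
  also have "\<dots> = (\<integral>\<^sup>+x. 0 \<partial>(lborel :: 'a measure))"
  proof (rule nn_integral_cong)
    fix x :: 'a
    have "{t. x + t *\<^sub>R e \<in> A} \<in> null_sets lborel"
      using c by (rule countable_imp_null_set_lborel)
    then have "AE t in lborel. t \<notin> {t. x + t *\<^sub>R e \<in> A}"
      by (rule AE_not_in)
    then have "(\<integral>\<^sup>+t. indicator {0..1} t * indicator A (x + t *\<^sub>R e) \<partial>(lborel :: real measure)) = (\<integral>\<^sup>+t. 0 \<partial>(lborel :: real measure))"
      by (intro nn_integral_cong_AE) (auto elim!: eventually_mono simp: indicator_def)
    then show "(\<integral>\<^sup>+t. indicator {0..1} t * indicator A (x + t *\<^sub>R e) \<partial>(lborel :: real measure)) = 0"
      by simp
  qed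
  finally show ?thesis by (auto simp: null_sets_def)
qed

section \<open>One-sided derivatives and kinks of convex functions\<close>

lemma convex_on_quotient_mono:
  fixes f :: "'a::real_vector \<Rightarrow> real"
  assumes f: "convex_on S f" and "x \<in> S" "x + h *\<^sub>R v \<in> S" "0 < k" "k \<le> h"
  shows "(f (x + k *\<^sub>R v) - f x) / k \<le> (f (x + h *\<^sub>R v) - f x) / h"
proof -
  have "h > 0" using assms by simp
  have eq: "x + k *\<^sub>R v = (1 - k/h) *\<^sub>R x + (k/h) *\<^sub>R (x + h *\<^sub>R v)"
    using \<open>h > 0\<close> by (simp add: algebra_simps)
  have "f (x + k *\<^sub>R v) \<le> (1 - k/h) * f x + (k/h) * f (x + h *\<^sub>R v)"
    unfolding eq by (rule convex_onD[OF f]) (use assms \<open>h > 0\<close> in auto)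
  then have "f (x + k *\<^sub>R v) - f x \<le> (k/h) * (f (x + h *\<^sub>R v) - f x)"
    by (simp add: algebra_simps)
  then show ?thesis using \<open>0 < k\<close> \<open>h > 0\<close> by (simp add: field_simps)
qed

lemma convex_on_midpoint:
  fixes f :: "'a::real_vector \<Rightarrow> real"
  assumes f: "convex_on S f" and "x + v \<in> S" "x - v \<in> S"
  shows "2 * f x \<le> f (x + v) + f (x - v)"
proof -
  have eq: "x = (1/2) *\<^sub>R (x + v) + (1/2) *\<^sub>R (x - v)"
    by (simp add: algebra_simps flip: scaleR_add_left)
  have "f ((1/2) *\<^sub>R (x + v) + (1/2) *\<^sub>R (x - v)) \<le> (1/2) * f (x + v) + (1/2) * f (x - v)"
    using convex_onD[OF f, of "1/2" "x + v" "x - v"] assms by simp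
  then show ?thesis unfolding eq[symmetric] by simp
qed

text \<open>One-sided, because for a convex function this limit exists at every interior point. The
  two-sided derivative along \<open>v\<close> exists exactly where
  \<open>ddir f x v + ddir f x (-v)\<close> vanishes; elsewhere this sum is positive and is the size
  of the kink.\<close>

definition ddir :: "('a::real_normed_vector \<Rightarrow> real) \<Rightarrow> 'a \<Rightarrow> 'a \<Rightarrow> real" where
  "ddir f x v = Lim (at_right 0) (\<lambda>h. (f (x + h *\<^sub>R v) - f x) / h)"

lemma open_dir_interval:
  fixes x v :: "'a::real_normed_vector"
  assumes "open S" "x \<in> S"
  obtains d where "d > 0" "\<And>h. \<bar>h\<bar> \<le> d \<Longrightarrow> x + h *\<^sub>R v \<in> S"
proof -
  obtain e where e: "e > 0" "ball x e \<subseteq> S" using assms openE by blast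
  show ?thesis
  proof
    show "e / (norm v + 1) / 2 > 0" using e by (simp add: add_nonneg_pos)
    fix h assume h: "\<bar>h\<bar> \<le> e / (norm v + 1) / 2"
    have "norm (h *\<^sub>R v) \<le> \<bar>h\<bar> * (norm v + 1)" by (simp add: mult_left_mono)
    also have "\<dots> \<le> e / (norm v + 1) / 2 * (norm v + 1)"
      by (rule mult_right_mono[OF h]) simp
    also have "\<dots> = e / 2"
      using add_nonneg_pos[OF norm_ge_zero[of v] zero_less_one] by (simp add: field_simps)
    also have "\<dots> < e" using e by simp
    finally show "x + h *\<^sub>R v \<in> S" using e by (auto simp: dist_norm subset_iff)
  qed
qed

text \<open>The difference quotients increase with \<open>h\<close>, and the midpoint inequality
  bounds them below by a backward quotient, so they converge to their infimum as \<open>h\<close>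
  decreases to 0.\<close>

lemma ddir_convex:
  fixes f :: "'a::real_normed_vector \<Rightarrow> real"
  assumes S: "open S" and f: "convex_on S f" and x: "x \<in> S"
  shows ddir_tendsto: "((\<lambda>h. (f (x + h *\<^sub>R v) - f x) / h) \<longlongrightarrow> ddir f x v) (at_right 0)"
    and ddir_le: "\<And>h. h > 0 \<Longrightarrow> x + h *\<^sub>R v \<in> S \<Longrightarrow> ddir f x v \<le> (f (x + h *\<^sub>R v) - f x) / h"
proof -
  obtain d where d: "d > 0" "\<And>h. \<bar>h\<bar> \<le> d \<Longrightarrow> x + h *\<^sub>R v \<in> S"
    using open_dir_interval[OF S x] by metis
  let ?q = "\<lambda>h. (f (x + h *\<^sub>R v) - f x) / h"
  define L where "L = Inf (?q ` {0<..d})"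
  have mono: "?q k \<le> ?q h" if "0 < k" "k \<le> h" "x + h *\<^sub>R v \<in> S" for k h
    by (rule convex_on_quotient_mono[OF f x that(3) that(1,2)])
  have lower: "- ((f (x - d *\<^sub>R v) - f x) / d) \<le> ?q h" if "0 < h" "h \<le> d" for h
  proof -
    have "(f (x + h *\<^sub>R (-v)) - f x) / h \<le> (f (x + d *\<^sub>R (-v)) - f x) / d"
      by (rule convex_on_quotient_mono[OF f x]) (use that d(2)[of "-d"] in auto)
    moreover have "2 * f x \<le> f (x + h *\<^sub>R v) + f (x - h *\<^sub>R v)"
      by (rule convex_on_midpoint[OF f]) (use that d(2)[of h] d(2)[of "-h"] in auto)
    then have "0 \<le> (f (x + h *\<^sub>R v) + f (x - h *\<^sub>R v) - 2 * f x) / h"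
      using that by (intro divide_nonneg_pos) auto
    then have "0 \<le> ?q h + (f (x + h *\<^sub>R (-v)) - f x) / h"
      by (simp add: diff_divide_distrib add_divide_distrib)
    ultimately show ?thesis by simp
  qed
  have bdd: "bdd_below (?q ` {0<..d})"
    by (rule bdd_belowI2[of _ "- ((f (x - d *\<^sub>R v) - f x) / d)"]) (use lower in auto)
  have L: "L \<le> ?q h" if h: "0 < h" "x + h *\<^sub>R v \<in> S" for h
  proof -
    have "L \<le> ?q (min h d)"
      unfolding L_def by (rule cInf_lower[OF _ bdd]) (use that d in auto)
    also have "\<dots> \<le> ?q h" by (rule mono) (use h d in auto)
    finally show ?thesis .
  qed
  have "(?q \<longlongrightarrow> L) (at_right 0)"
  proof (rule order_tendstoI)
    fix a assume "a < L"
    then show "\<forall>\<^sub>F h in at_right 0. a < ?q h"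
      unfolding eventually_at_right_field
      by (intro exI[of _ d]) (use L d in \<open>force simp: abs_if\<close>)
  next
    fix a assume "L < a"
    then obtain k where k: "0 < k" "k \<le> d" "?q k < a"
      unfolding L_def using cInf_less_iff[OF _ bdd, of a] d(1) by auto
    show "\<forall>\<^sub>F h in at_right 0. ?q h < a"
      unfolding eventually_at_right_field
    proof (intro exI[of _ k] conjI allI impI)
      show "0 < k" by fact
      fix h assume "0 < h" "h < k"
      then show "?q h < a" using mono[of h k] k d by fastforce
    qed
  qed
  then have *: "ddir f x v = L" unfolding ddir_def by (intro tendsto_Lim) auto
  show "(?q \<longlongrightarrow> ddir f x v) (at_right 0)" using * \<open>(?q \<longlongrightarrow> L) (at_right 0)\<close> by simp
  show "\<And>h. h > 0 \<Longrightarrow> x + h *\<^sub>R v \<in> S \<Longrightarrow> ddir f x v \<le> ?q h" using * L by simp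
qed

lemma ddir_nonneg:
  fixes f :: "'a::real_normed_vector \<Rightarrow> real"
  assumes S: "open S" and f: "convex_on S f" and x: "x \<in> S"
  shows "0 \<le> ddir f x v + ddir f x (-v)"
proof -
  obtain d where d: "d > 0" "\<And>h. \<bar>h\<bar> \<le> d \<Longrightarrow> x + h *\<^sub>R v \<in> S"
    using open_dir_interval[OF S x] by metis
  have lim: "((\<lambda>h. (f (x + h *\<^sub>R v) - f x) / h + (f (x + h *\<^sub>R (-v)) - f x) / h) \<longlongrightarrow> ddir f x v + ddir f x (-v)) (at_right 0)"
    by (intro tendsto_add ddir_tendsto[OF S f x])
  show ?thesis
  proof (rule tendsto_lowerbound[OF lim])
    show "\<forall>\<^sub>F h in at_right 0. 0 \<le> (f (x + h *\<^sub>R v) - f x) / h + (f (x + h *\<^sub>R (-v)) - f x) / h"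
      unfolding eventually_at_right_field
    proof (intro exI[of _ d] conjI allI impI)
      fix h assume h: "0 < h" "h < d"
      have "2 * f x \<le> f (x + h *\<^sub>R v) + f (x - h *\<^sub>R v)"
        by (rule convex_on_midpoint[OF f]) (use h d(2)[of h] d(2)[of "-h"] in auto)
      then have "0 \<le> (f (x + h *\<^sub>R v) + f (x - h *\<^sub>R v) - 2 * f x) / h"
        using h by (intro divide_nonneg_pos) auto
      then show "0 \<le> (f (x + h *\<^sub>R v) - f x) / h + (f (x + h *\<^sub>R (-v)) - f x) / h"
        by (simp add: diff_divide_distrib add_divide_distrib)
    qed (use d in auto)
  qed simp
qed

text \<open>At a kink the left slope lies strictly below the right slope, and slopes increase along
  the line, so the gaps at different kinks are disjoint. Choosing a rational in each gap injects the
  kinks into the rationals.\<close>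

lemma countable_kinks_on_line:
  fixes f :: "'a::real_normed_vector \<Rightarrow> real"
  assumes S: "open S" and f: "convex_on S f"
  shows "countable {t. x + t *\<^sub>R v \<in> S \<and> ddir f (x + t *\<^sub>R v) v + ddir f (x + t *\<^sub>R v) (-v) \<noteq> 0}"
    (is "countable ?K")
proof -
  let ?u = "\<lambda>t. ddir f (x + t *\<^sub>R v) v" and ?l = "\<lambda>t. - ddir f (x + t *\<^sub>R v) (-v)"
  have "\<forall>t\<in>?K. \<exists>q::rat. ?l t < of_rat q \<and> of_rat q < ?u t"
  proof
    fix t assume "t \<in> ?K"
    then have "?l t < ?u t"
      using ddir_nonneg[OF S f, of "x + t *\<^sub>R v" v] by auto
    then show "\<exists>q::rat. ?l t < of_rat q \<and> of_rat q < ?u t" by (rule of_rat_dense)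
  qed
  from bchoice[OF this] obtain q :: "real \<Rightarrow> rat"
    where q: "\<forall>t\<in>?K. ?l t < of_rat (q t) \<and> of_rat (q t) < ?u t" by blast
  have less: "of_rat (q s) < (of_rat (q t) :: real)" if "s \<in> ?K" "t \<in> ?K" "s < t" for s t
  proof -
    have "?u s \<le> (f (x + s *\<^sub>R v + (t - s) *\<^sub>R v) - f (x + s *\<^sub>R v)) / (t - s)"
      by (rule ddir_le[OF S f]) (use that in \<open>auto simp: algebra_simps\<close>)
    also have "\<dots> = - ((f (x + t *\<^sub>R v + (t - s) *\<^sub>R (-v)) - f (x + t *\<^sub>R v)) / (t - s))"
      by (simp add: algebra_simps minus_divide_left)
    also have "\<dots> \<le> ?l t"
      using ddir_le[OF S f, of "x + t *\<^sub>R v" "t - s" "-v"] that by (auto simp: algebra_simps)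
    finally show ?thesis using bspec[OF q that(1)] bspec[OF q that(2)] by linarith
  qed
  have "inj_on q ?K"
  proof (rule inj_onI)
    fix s t assume "s \<in> ?K" "t \<in> ?K" "q s = q t"
    then show "s = t" using less[of s t] less[of t s] by (metis less_irrefl linorder_neqE_linordered_idom)
  qed
  then show ?thesis by (rule countableI')
qed

text \<open>Prepares measurability of derivatives: the extension of \<open>f\<close> by zero is a
  function on the whole space, and for large \<open>n\<close> the points
  \<open>x + v / (n + 1)\<close> lie in \<open>S\<close>, where the extension is
  \<open>f\<close>.\<close>

lemma quotient_sequence_tendsto:
  fixes f :: "'a::real_normed_vector \<Rightarrow> real"
  assumes S: "open S" and x: "x \<in> S"
    and lim: "((\<lambda>h. (f (x + h *\<^sub>R v) - f x) / h) \<longlongrightarrow> L) (at_right 0)"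
  defines "f0 \<equiv> \<lambda>x. indicator S x *\<^sub>R f x"
  shows "(\<lambda>n. real (Suc n) * (f0 (x + (1 / real (Suc n)) *\<^sub>R v) - f0 x)) \<longlonglongrightarrow> L"
proof -
  have fl: "filterlim (\<lambda>n. 1 / real (Suc n)) (at_right 0) sequentially"
    using LIMSEQ_Suc[OF lim_1_over_n[where 'a=real]] by (simp add: filterlim_at del: of_nat_Suc)
  have 1: "(\<lambda>n. (f (x + (1 / real (Suc n)) *\<^sub>R v) - f x) / (1 / real (Suc n))) \<longlonglongrightarrow> L"
    by (rule filterlim_compose[OF lim fl])
  obtain d where d: "d > 0" "\<And>h. \<bar>h\<bar> \<le> d \<Longrightarrow> x + h *\<^sub>R v \<in> S"
    using open_dir_interval[OF S x] by metis
  have "\<forall>\<^sub>F n in sequentially. 1 / real (Suc n) < d"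
    using order_tendstoD(2)[OF LIMSEQ_Suc[OF lim_1_over_n] d(1)] by simp
  then have "\<forall>\<^sub>F n in sequentially. (f (x + (1 / real (Suc n)) *\<^sub>R v) - f x) / (1 / real (Suc n)) =
      real (Suc n) * (f0 (x + (1 / real (Suc n)) *\<^sub>R v) - f0 x)"
  proof eventually_elim
    case (elim n)
    then have "x + (1 / real (Suc n)) *\<^sub>R v \<in> S" by (intro d) auto
    then show ?case using x by (simp add: f0_def)
  qed
  then show ?thesis by (rule Lim_transform_eventually[OF 1])
qed

lemma ddir_kinks_null:
  fixes f :: "'a::euclidean_space \<Rightarrow> real"
  assumes S: "open S" and f: "convex_on S f"
  shows "{x \<in> S. ddir f x v + ddir f x (-v) \<noteq> 0} \<in> null_sets lborel"
proof -
  define f0 where "f0 x = indicator S x *\<^sub>R f x" for x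
  have f0[measurable]: "f0 \<in> borel_measurable borel"
    unfolding f0_def using S convex_on_continuous[OF S f]
    by (intro borel_measurable_continuous_on_indicator) auto
  \<comment> \<open>A Borel function on the whole space that agrees with \<open>ddir f x v\<close>
    on \<open>S\<close>. It makes the set of kinks Borel, as the Fubini argument requires.\<close>
  define u where "u v x = lim (\<lambda>n. real (Suc n) * (f0 (x + (1 / real (Suc n)) *\<^sub>R v) - f0 x))" for v x
  have [measurable]: "u v \<in> borel_measurable borel" for v
    unfolding u_def by measurable
  have u: "u v x = ddir f x v" if x: "x \<in> S" for x v
    unfolding u_def f0_def by (rule limI[OF quotient_sequence_tendsto[OF S x ddir_tendsto[OF S f x]]])
  have Sb[measurable]: "S \<in> sets borel" using S by simp
  have eq: "{x \<in> S. ddir f x v + ddir f x (-v) \<noteq> 0} = S \<inter> {x. u v x + u (-v) x \<noteq> 0}"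
    using u by auto
  have "{x \<in> S. ddir f x v + ddir f x (-v) \<noteq> 0} \<in> sets borel"
    unfolding eq by measurable
  moreover have "countable {t. x + t *\<^sub>R v \<in> {x \<in> S. ddir f x v + ddir f x (-v) \<noteq> 0}}" for x
    using countable_kinks_on_line[OF S f, of x v] by simp
  ultimately show ?thesis by (rule null_set_countable_lines)
qed

text \<open>\<open>x + v\<close> is the average of its \<open>n\<close> projections to the
  coordinate axes through \<open>x\<close>, each stretched by \<open>n\<close>, so convexity bounds
  \<open>f (x + v) - f x - P v\<close> from above by one-dimensional errors. The midpoint inequality
  between \<open>x + v\<close> and \<open>x - v\<close> turns the upper bound at \<open>-v\<close>
  into the lower bound at \<open>v\<close>.\<close>

lemma convex_on_differentiable_if_partials:
  fixes f :: "'a::euclidean_space \<Rightarrow> real"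
  assumes S: "open S" and f: "convex_on S f" and x: "x \<in> S"
    and p: "\<And>i. i \<in> Basis \<Longrightarrow> ddir f x i + ddir f x (-i) = 0"
  shows "f differentiable (at x)"
proof -
  define P where "P v = (\<Sum>i\<in>Basis. (v \<bullet> i) * ddir f x i)" for v
  have lin: "bounded_linear P"
    unfolding P_def by (intro bounded_linear_sum bounded_linear_mult_const bounded_linear_inner_left)
  let ?n = "real DIM('a)"
  have n: "?n > 0" by simp
  have one: "\<exists>d>0. \<forall>h. \<bar>h\<bar> < d \<longrightarrow> x + h *\<^sub>R i \<in> S \<and> \<bar>f (x + h *\<^sub>R i) - f x - h * ddir f x i\<bar> \<le> e * \<bar>h\<bar>"
    if i: "i \<in> Basis" and e: "e > 0" for i e
  proof -
    obtain d0 where d0: "d0 > 0" "\<And>h. \<bar>h\<bar> \<le> d0 \<Longrightarrow> x + h *\<^sub>R i \<in> S"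
      using open_dir_interval[OF S x] by metis
    obtain d1 where d1: "d1 > 0" "\<And>h. 0 < h \<Longrightarrow> h < d1 \<Longrightarrow> \<bar>(f (x + h *\<^sub>R i) - f x) / h - ddir f x i\<bar> < e"
      using tendstoD[OF ddir_tendsto[OF S f x, of i] e]
      unfolding eventually_at_right_field dist_real_def by auto
    obtain d2 where d2: "d2 > 0" "\<And>h. 0 < h \<Longrightarrow> h < d2 \<Longrightarrow> \<bar>(f (x + h *\<^sub>R (-i)) - f x) / h - ddir f x (-i)\<bar> < e"
      using tendstoD[OF ddir_tendsto[OF S f x, of "-i"] e]
      unfolding eventually_at_right_field dist_real_def by auto
    show ?thesis
    proof (intro exI[of _ "min d0 (min d1 d2)"] conjI allI impI)
      fix h assume h: "\<bar>h\<bar> < min d0 (min d1 d2)"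
      show "x + h *\<^sub>R i \<in> S" using h by (intro d0) auto
      consider "h = 0" | "h > 0" | "h < 0" by linarith
      then show "\<bar>f (x + h *\<^sub>R i) - f x - h * ddir f x i\<bar> \<le> e * \<bar>h\<bar>"
      proof cases
        case 2
        have "\<bar>(f (x + h *\<^sub>R i) - f x) / h - ddir f x i\<bar> * \<bar>h\<bar> \<le> e * \<bar>h\<bar>"
          by (rule mult_right_mono) (use d1(2)[of h] 2 h in auto)
        then show ?thesis using 2 by (simp add: field_simps flip: abs_mult)
      next
        case 3
        have "\<bar>(f (x + (-h) *\<^sub>R (-i)) - f x) / (-h) - ddir f x (-i)\<bar> * \<bar>h\<bar> \<le> e * \<bar>h\<bar>"
          by (rule mult_right_mono) (use d2(2)[of "-h"] 3 h in auto)
        then show ?thesis using 3 p[OF i] by (simp add: field_simps eq_neg_iff_add_eq_0[symmetric] flip: abs_mult)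
      qed simp
    qed (use d0 d1 d2 in auto)
  qed
  have upper: "\<exists>d>0. \<forall>v. norm v < d \<longrightarrow> x + v \<in> S \<and> f (x + v) - f x - P v \<le> e * norm v" if e: "e > 0" for e
  proof -
    have "\<forall>i\<in>Basis. \<exists>d>0. \<forall>h. \<bar>h\<bar> < d \<longrightarrow> x + h *\<^sub>R i \<in> S \<and> \<bar>f (x + h *\<^sub>R i) - f x - h * ddir f x i\<bar> \<le> e / ?n * \<bar>h\<bar>"
      using one[where e="e / ?n"] e n by (intro ballI) simp
    then obtain d where d: "\<And>i. i \<in> Basis \<Longrightarrow> d i > 0"
      "\<And>i h. i \<in> Basis \<Longrightarrow> \<bar>h\<bar> < d i \<Longrightarrow> x + h *\<^sub>R i \<in> S \<and> \<bar>f (x + h *\<^sub>R i) - f x - h * ddir f x i\<bar> \<le> e / ?n * \<bar>h\<bar>"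
      by metis
    define D where "D = Min (d ` Basis)"
    have D: "D > 0" "\<And>i. i \<in> Basis \<Longrightarrow> D \<le> d i" using d(1) by (auto simp: D_def)
    show ?thesis
    proof (intro exI[of _ "D / ?n"] conjI allI impI)
      show "D / ?n > 0" using D n by simp
      fix v :: 'a assume v: "norm v < D / ?n"
      \<comment> \<open>The points on the axes are up to \<open>?n\<close> times as far from
        \<open>x\<close> as \<open>x + v\<close>, hence the radius \<open>D / ?n\<close>.\<close>
      have small: "\<bar>?n * (v \<bullet> i)\<bar> < d i" if "i \<in> Basis" for i
      proof -
        have "\<bar>?n * (v \<bullet> i)\<bar> \<le> ?n * norm v" using Basis_le_norm[OF that] by (simp add: abs_mult)
        also have "\<dots> < D" using v n by (simp add: field_simps)
        finally show ?thesis using D that by fastforce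
      qed
      note dd = d(2)[OF _ small]
      have eq: "x + v = (\<Sum>i\<in>Basis. (1/?n) *\<^sub>R (x + (?n * (v \<bullet> i)) *\<^sub>R i))"
        by (simp add: scaleR_add_right sum.distrib sum_constant_scaleR euclidean_representation del: sum_constant)
      show "x + v \<in> S" unfolding eq
        by (rule convex_sum) (use f dd in \<open>auto simp: convex_on_def\<close>)
      have "f (x + v) \<le> (\<Sum>i\<in>Basis. (1/?n) * f (x + (?n * (v \<bullet> i)) *\<^sub>R i))"
        unfolding eq by (rule convex_on_sum[OF _ _ f]) (use dd in auto)
      also have "\<dots> \<le> (\<Sum>i\<in>Basis. (1/?n) * (f x + (?n * (v \<bullet> i)) * ddir f x i + e / ?n * \<bar>?n * (v \<bullet> i)\<bar>))"
      proof (intro sum_mono mult_left_mono)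
        fix i :: 'a assume "i \<in> Basis"
        from dd[OF this this] show "f (x + (?n * (v \<bullet> i)) *\<^sub>R i) \<le> f x + (?n * (v \<bullet> i)) * ddir f x i + e / ?n * \<bar>?n * (v \<bullet> i)\<bar>" by linarith
      qed simp
      also have "\<dots> = (\<Sum>i\<in>Basis. f x / ?n + (v \<bullet> i) * ddir f x i + e / ?n * \<bar>v \<bullet> i\<bar>)"
        by (intro sum.cong) (auto simp: field_simps abs_mult)
      also have "\<dots> \<le> (\<Sum>i\<in>Basis. f x / ?n + (v \<bullet> i) * ddir f x i + e / ?n * norm v)"
        by (intro sum_mono add_left_mono mult_left_mono Basis_le_norm) (use e in auto)
      also have "\<dots> = f x + P v + e * norm v"
        by (simp add: sum.distrib P_def)
      finally show "f (x + v) - f x - P v \<le> e * norm v" by simp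
    qed
  qed
  have "(f has_derivative P) (at x)"
    unfolding has_derivative_at_alt
  proof (intro conjI lin allI impI)
    fix e :: real assume e: "e > 0"
    obtain d where d: "d > 0" "\<And>v. norm v < d \<Longrightarrow> x + v \<in> S \<and> f (x + v) - f x - P v \<le> e * norm v"
      using upper[OF e] by metis
    show "\<exists>d>0. \<forall>y. norm (y - x) < d \<longrightarrow> norm (f y - f x - P (y - x)) \<le> e * norm (y - x)"
    proof (intro exI[of _ d] conjI allI impI d(1))
      fix y assume y: "norm (y - x) < d"
      define u where "u = y - x"
      from d(2)[of u] d(2)[of "-u"] y
      have a: "f (x + u) - f x - P u \<le> e * norm u" and b: "f (x - u) - f x - P (-u) \<le> e * norm u"
        and "x + u \<in> S" "x - u \<in> S" by (auto simp: u_def[symmetric])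
      then have "2 * f x \<le> f (x + u) + f (x - u)"
        by (intro convex_on_midpoint[OF f])
      moreover have "P (-u) = - P u" using lin by (simp add: bounded_linear.linear linear_neg)
      moreover have "y = x + u" by (simp add: u_def)
      ultimately show "norm (f y - f x - P (y - x)) \<le> e * norm (y - x)"
        using a b by simp
    qed
  qed
  then show ?thesis by (auto simp: differentiable_def)
qed

theorem convex_on_differentiable_almost_everywhere:
  fixes f :: "'a::euclidean_space \<Rightarrow> real"
  assumes S: "open S" and f: "convex_on S f"
  shows "AE x in lborel. x \<in> S \<longrightarrow> f differentiable (at x)"
proof -
  let ?K = "\<Union>i\<in>Basis. {x \<in> S. ddir f x i + ddir f x (-i) \<noteq> 0}"
  have "?K \<in> null_sets lborel"
    by (intro null_sets_UN' countable_finite ddir_kinks_null[OF S f]) auto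
  then have "AE x in lborel. x \<notin> ?K" by (rule AE_not_in)
  then show ?thesis
    by eventually_elim (auto intro!: convex_on_differentiable_if_partials[OF S f])
qed

section \<open>Potentials and convergence of their gradients\<close>

lemma has_derivative_grad:
  assumes "f differentiable (at x)"
  shows "(f has_derivative (\<lambda>v. grad f x \<bullet> v)) (at x)"
proof -
  let ?D = "frechet_derivative f (at x)"
  have D: "(f has_derivative ?D) (at x)" using assms frechet_derivative_works by blast
  have lin: "linear ?D" using D has_derivative_linear by blast
  have "?D v = grad f x \<bullet> v" for v
  proof -
    have "?D v = ?D (\<Sum>i\<in>UNIV. v $ i *\<^sub>R axis i 1)"
      using basis_expansion[of v] by (simp add: scalar_mult_eq_scaleR)
    also have "\<dots> = (\<Sum>i\<in>UNIV. v $ i * ?D (axis i 1))"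
      by (simp add: linear_sum[OF lin] linear_scale[OF lin])
    also have "\<dots> = grad f x \<bullet> v"
      using assms by (simp add: grad_def inner_vec_def mult.commute)
    finally show ?thesis .
  qed
  then show ?thesis using D by (metis (no_types, lifting) ext)
qed

lemma grad_eqI:
  assumes "(f has_derivative (\<lambda>v. g \<bullet> v)) (at x)"
  shows "grad f x = g"
proof -
  have "f differentiable (at x)" using assms differentiable_def by blast
  from has_derivative_unique[OF has_derivative_grad[OF this] assms]
  have "grad f x \<bullet> v = g \<bullet> v" for v by metis
  then show ?thesis by (metis inner_commute vector_eq_ldot)
qed

lemma differentiable_cong_open:
  assumes "open S" "x \<in> S" "\<And>y. y \<in> S \<Longrightarrow> f y = g y" "f differentiable (at x)"
  shows "g differentiable (at x)"
proof -
  obtain D where "(f has_derivative D) (at x)" using assms differentiable_def by blast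
  then have "(g has_derivative D) (at x)"
    by (rule has_derivative_transform_within_open[OF _ assms(1,2)]) (use assms in auto)
  then show ?thesis by (auto simp: differentiable_def)
qed

lemma grad_cong_open:
  assumes S: "open S" "x \<in> S" and eq: "\<And>y. y \<in> S \<Longrightarrow> f y = g y"
  shows "grad f x = grad g x"
proof (cases "f differentiable (at x)")
  case True
  have "(g has_derivative (\<lambda>v. grad f x \<bullet> v)) (at x)"
    by (rule has_derivative_transform_within_open[OF has_derivative_grad[OF True] S]) (use eq in auto)
  then show ?thesis by (rule grad_eqI[symmetric])
next
  case False
  then have "\<not> g differentiable (at x)"
    using differentiable_cong_open[OF S, of g f] eq by auto
  with False show ?thesis by (simp add: grad_def)
qed

lemma ddir_eq_grad:
  assumes d: "f differentiable (at x)"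
  shows "ddir f x v = grad f x \<bullet> v"
    and "((\<lambda>h. (f (x + h *\<^sub>R v) - f x) / h) \<longlongrightarrow> grad f x \<bullet> v) (at_right 0)"
proof -
  have "((\<lambda>h. f (x + h *\<^sub>R v)) has_derivative (\<lambda>h. grad f x \<bullet> (h *\<^sub>R v))) (at 0)"
    by (rule has_derivative_compose[of "\<lambda>h. x + h *\<^sub>R v"]) (auto intro!: derivative_eq_intros has_derivative_grad[OF d])
  then have "((\<lambda>h. f (x + h *\<^sub>R v)) has_real_derivative (grad f x \<bullet> v)) (at 0)"
    by (simp add: has_field_derivative_def mult_commute_abs)
  then have "((\<lambda>h. (f (x + h *\<^sub>R v) - f x) / h) \<longlongrightarrow> grad f x \<bullet> v) (at 0)"
    by (simp add: DERIV_def)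
  then show *: "((\<lambda>h. (f (x + h *\<^sub>R v) - f x) / h) \<longlongrightarrow> grad f x \<bullet> v) (at_right 0)"
    by (simp add: filterlim_at_split)
  then show "ddir f x v = grad f x \<bullet> v"
    unfolding ddir_def by (intro tendsto_Lim) auto
qed

lemma grad_subgradient:
  assumes S: "open S" and f: "convex_on S f" and x: "x \<in> S" and y: "y \<in> S"
    and d: "f differentiable (at x)"
  shows "f x + grad f x \<bullet> (y - x) \<le> f y"
  using ddir_le[OF S f x, of 1 "y - x"] ddir_eq_grad(1)[OF d] y by simp

lemma subgradient_imp_grad:
  assumes S: "open S" and x: "x \<in> S" and d: "f differentiable (at x)"
    and sub: "\<And>y. y \<in> S \<Longrightarrow> f x + g \<bullet> (y - x) \<le> f y"
  shows "g = grad f x"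
proof -
  have "((\<lambda>y. f y - g \<bullet> y) has_derivative (\<lambda>v. grad f x \<bullet> v - g \<bullet> v)) (at x)"
    by (intro derivative_intros has_derivative_grad[OF d])
  then have "(\<lambda>v. grad f x \<bullet> v - g \<bullet> v) = (\<lambda>v. 0)"
    by (rule differential_zero_maxmin[OF x S]) (use sub in \<open>auto simp: algebra_simps\<close>)
  then have "grad f x \<bullet> v = g \<bullet> v" for v by (metis eq_iff_diff_eq_0)
  then show ?thesis by (metis inner_commute vector_eq_ldot)
qed

text \<open>For a fixed small step \<open>h\<close>, the quotient of \<open>F k\<close> lies above
  the slope of \<open>F k\<close> at \<open>x\<close> and converges to the quotient of
  \<open>f\<close>, which is within \<open>e\<close> of the slope of \<open>f\<close>. This controls
  upper limits in every direction; the direction \<open>-v\<close> gives the lower limits.\<close>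

lemma grad_tendsto:
  assumes S: "open S" and x: "x \<in> S"
    and f: "\<And>k. convex_on S (F k)" and conv: "\<And>y. y \<in> S \<Longrightarrow> (\<lambda>k. F k y) \<longlonglongrightarrow> f y"
    and dF: "\<And>k. F k differentiable (at x)" and d: "f differentiable (at x)"
  shows "(\<lambda>k. grad (F k) x) \<longlonglongrightarrow> grad f x"
proof -
  have upper: "\<forall>\<^sub>F k in sequentially. grad (F k) x \<bullet> v < grad f x \<bullet> v + e" if e: "e > 0" for v e
  proof -
    obtain d0 where d0: "d0 > 0" "\<And>h. \<bar>h\<bar> \<le> d0 \<Longrightarrow> x + h *\<^sub>R v \<in> S"
      using open_dir_interval[OF S x] by metis
    have "\<forall>\<^sub>F h in at_right 0. (f (x + h *\<^sub>R v) - f x) / h < grad f x \<bullet> v + e"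
      using order_tendstoD(2)[OF ddir_eq_grad(2)[OF d]] e by simp
    then obtain b where b: "b > 0" "\<And>h. 0 < h \<Longrightarrow> h < b \<Longrightarrow> (f (x + h *\<^sub>R v) - f x) / h < grad f x \<bullet> v + e"
      unfolding eventually_at_right_field by auto
    define h where "h = min (b/2) d0"
    have h: "0 < h" "h < b" "x + h *\<^sub>R v \<in> S" using b(1) d0(1) d0(2)[of h] by (auto simp: h_def)
    have "(\<lambda>k. (F k (x + h *\<^sub>R v) - F k x) / h) \<longlonglongrightarrow> (f (x + h *\<^sub>R v) - f x) / h"
      using h x by (intro tendsto_intros conv) auto
    from order_tendstoD(2)[OF this b(2)[OF h(1,2)]]
    show ?thesis
    proof eventually_elim
      case (elim k)
      then show ?case using ddir_le[OF S f x h(1,3), of k] ddir_eq_grad(1)[OF dF] by simp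
    qed
  qed
  have "(\<lambda>k. grad (F k) x \<bullet> v) \<longlonglongrightarrow> grad f x \<bullet> v" for v
  proof (rule order_tendstoI)
    fix a assume "a < grad f x \<bullet> v"
    then show "\<forall>\<^sub>F k in sequentially. a < grad (F k) x \<bullet> v"
      using upper[of "grad f x \<bullet> v - a" "-v"] by simp
  next
    fix a assume "grad f x \<bullet> v < a"
    then show "\<forall>\<^sub>F k in sequentially. grad (F k) x \<bullet> v < a"
      using upper[of "a - grad f x \<bullet> v" "v"] by simp
  qed
  then have "(\<lambda>k. grad (F k) x \<bullet> axis i 1) \<longlonglongrightarrow> grad f x \<bullet> axis i 1" for i by blast
  then show ?thesis by (intro vec_tendstoI) (simp add: inner_axis)
qed

section \<open>The domain as a probability space, and its normalised convex potentials\<close>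

locale unit_domain =
  fixes \<Omega> :: "(real^3) set" and r :: real
  assumes open_dom: "open \<Omega>" and convex_dom: "convex \<Omega>"
    and emeasure_dom: "emeasure lebesgue \<Omega> = 1" and dom_bound: "\<Omega> \<subseteq> cball 0 r"
begin

abbreviation "\<mu> \<equiv> lebesgue_on \<Omega>"

lemma dom_sets [simp]: "\<Omega> \<in> sets lebesgue" "\<Omega> \<in> sets borel"
  using open_dom by auto

sublocale prob_space \<mu>
  by standard (simp add: space_restrict_space emeasure_restrict_space emeasure_dom)

lemma dom_nonempty: "\<Omega> \<noteq> {}"
  using emeasure_dom by auto

lemma space_mu [simp]: "space \<mu> = \<Omega>"
  by (simp add: space_restrict_space)

lemma AE_dom: "AE x in \<mu>. x \<in> \<Omega>"
  using AE_space[of \<mu>] by simp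

lemma AE_mu_iff: "(AE x in \<mu>. P x) \<longleftrightarrow> (AE x in lebesgue. x \<in> \<Omega> \<longrightarrow> P x)"
  by (rule AE_restrict_space_iff) simp

lemma AE_mu_lborel: "(AE x in lborel. x \<in> \<Omega> \<longrightarrow> P x) \<Longrightarrow> AE x in \<mu>. P x"
  unfolding AE_mu_iff by (rule AE_completion)

lemma norm_dom: "x \<in> \<Omega> \<Longrightarrow> norm x \<le> r"
  using dom_bound by auto

lemma r_nonneg: "r \<ge> 0"
  using dom_nonempty norm_dom norm_ge_zero order_trans by blast

lemma norm_closure: "x \<in> closure \<Omega> \<Longrightarrow> norm x \<le> r"
  using closure_minimal[OF dom_bound] by auto

lemma compact_closure_dom: "compact (closure \<Omega>)"
  using bounded_subset[OF bounded_cball dom_bound] by (simp add: compact_closure)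

lemma measurable_mu_borel: "f \<in> borel_measurable borel \<Longrightarrow> f \<in> borel_measurable \<mu>"
  by (simp add: measurable_completion measurable_restrict_space1)

lemma measurable_mu_continuous: "continuous_on \<Omega> f \<Longrightarrow> f \<in> borel_measurable \<mu>"
  by (rule continuous_imp_measurable_on_sets_lebesgue) auto

lemma AE_differentiable:
  assumes "convex_on \<Omega> f" shows "AE x in \<mu>. f differentiable (at x)"
  using convex_on_differentiable_almost_everywhere[OF open_dom assms] by (rule AE_mu_lborel)

text \<open>On the set \<open>D\<close> of differentiability the gradient is a limit of Borel
  difference quotients, elsewhere it is the default 0. \<open>D\<close> is Lebesgue measurable
  because its complement in the domain is negligible.\<close>

lemma grad_measurable:
  assumes f: "convex_on \<Omega> f" shows "grad f \<in> borel_measurable \<mu>"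
proof -
  define f0 where "f0 x = indicator \<Omega> x *\<^sub>R f x" for x
  have f0[measurable]: "f0 \<in> borel_measurable borel"
    unfolding f0_def using convex_on_continuous[OF open_dom f]
    by (intro borel_measurable_continuous_on_indicator) auto
  define u where "u x = (\<chi> i. lim (\<lambda>n. real (Suc n) * (f0 (x + (1 / real (Suc n)) *\<^sub>R axis i 1) - f0 x)))" for x :: "real^3"
  have u[measurable]: "u \<in> borel_measurable borel"
  proof (subst borel_measurable_euclidean_space, rule ballI)
    fix b :: "real^3" assume "b \<in> Basis"
    then obtain i where "b = axis i 1" by (auto simp: Basis_vec_def)
    then have "(\<lambda>x. u x \<bullet> b) = (\<lambda>x. lim (\<lambda>n. real (Suc n) * (f0 (x + (1 / real (Suc n)) *\<^sub>R axis i 1) - f0 x)))"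
      by (simp add: u_def inner_axis)
    also have "\<dots> \<in> borel_measurable borel" by measurable
    finally show "(\<lambda>x. u x \<bullet> b) \<in> borel_measurable borel" .
  qed
  define D where "D = {x \<in> \<Omega>. f differentiable (at x)}"
  obtain N where N: "\<And>x. x \<in> space lborel - N \<Longrightarrow> x \<in> \<Omega> \<longrightarrow> f differentiable (at x)" "N \<in> null_sets lborel"
    using AE_E3[OF convex_on_differentiable_almost_everywhere[OF open_dom f]] by metis
  have "negligible (\<Omega> - D)"
    by (rule negligible_subset[of N]) (use N in \<open>auto simp: negligible_iff_null_sets D_def null_sets_completionI\<close>)
  then have "\<Omega> - D \<in> sets lebesgue" by (auto simp: negligible_iff_null_sets)
  moreover have "D = \<Omega> - (\<Omega> - D)" by (auto simp: D_def)
  ultimately have "D \<in> sets lebesgue" by (metis dom_sets(1) sets.Diff)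
  then have D[measurable]: "D \<in> sets \<mu>" by (auto simp: sets_restrict_space_iff D_def)
  have eq: "grad f x = (if x \<in> D then u x else 0)" if x: "x \<in> \<Omega>" for x
  proof (cases "x \<in> D")
    case True
    then have d: "f differentiable (at x)" by (simp add: D_def)
    have "lim (\<lambda>n. real (Suc n) * (f0 (x + (1 / real (Suc n)) *\<^sub>R axis i 1) - f0 x)) = grad f x \<bullet> axis i 1" for i
      unfolding f0_def by (rule limI[OF quotient_sequence_tendsto[OF open_dom x ddir_eq_grad(2)[OF d]]])
    then have "lim (\<lambda>n. real (Suc n) * (f0 (x + (1 / real (Suc n)) *\<^sub>R axis i 1) - f0 x)) = grad f x $ i" for i
      by (simp add: inner_axis)
    then show ?thesis using True by (simp add: u_def vec_eq_iff)
  next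
    case False
    then show ?thesis using x by (simp add: D_def grad_def)
  qed
  have "{x \<in> space \<mu>. x \<in> D} = D" by (auto simp: D_def)
  then have "(\<lambda>x. if x \<in> D then u x else 0) \<in> borel_measurable \<mu>"
    using D by (intro measurable_If measurable_mu_borel u) auto
  then show ?thesis
    by (subst measurable_cong[of _ _ "\<lambda>x. if x \<in> D then u x else 0"]) (use eq in auto)
qed

lemma integrable_mu_continuous:
  fixes f :: "real^3 \<Rightarrow> 'b::euclidean_space"
  assumes "continuous_on (closure \<Omega>) f" shows "integrable \<mu> f"
proof -
  have "bounded (f ` closure \<Omega>)"
    by (rule compact_imp_bounded[OF compact_continuous_image[OF assms compact_closure_dom]])
  then obtain B where B: "\<forall>y\<in>f ` closure \<Omega>. norm y \<le> B" by (auto simp: bounded_iff)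
  have "AE x in \<mu>. norm (f x) \<le> B" using AE_dom by eventually_elim (use B closure_subset in auto)
  moreover have "f \<in> borel_measurable \<mu>"
    by (rule measurable_mu_continuous[OF continuous_on_subset[OF assms closure_subset]])
  ultimately show ?thesis by (rule integrable_const_bound)
qed

text \<open>Stated on the closure, where Arzela-Ascoli applies. \<open>R\<close> also bounds the
  gradient and so the support of the image measure; the zero mean fixes the additive
  constant.\<close>

definition pot :: "real \<Rightarrow> (real^3 \<Rightarrow> real) \<Rightarrow> bool" where
  "pot R \<psi> \<longleftrightarrow> convex_on (closure \<Omega>) \<psi> \<and> R-lipschitz_on (closure \<Omega>) \<psi> \<and> (\<integral>x. \<psi> x \<partial>\<mu>) = 0"

lemma pot_convex: assumes "pot R \<psi>" shows "convex_on \<Omega> \<psi>"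
  using assms convex_on_subset[OF _ closure_subset convex_dom] by (simp add: pot_def)

lemma pot_continuous: assumes "pot R \<psi>" shows "continuous_on (closure \<Omega>) \<psi>"
  using assms by (auto simp: pot_def intro: lipschitz_on_continuous_on)

lemma pot_measurable: assumes "pot R \<psi>" shows "\<psi> \<in> borel_measurable \<mu>"
  using pot_continuous[OF assms] closure_subset
  by (intro measurable_mu_continuous) (rule continuous_on_subset)

lemma pot_nonneg: assumes "pot R \<psi>" shows "R \<ge> 0"
  using assms by (auto simp: pot_def dest: lipschitz_on_nonneg)

lemma pot_lipschitz:
  assumes "pot R \<psi>" "x \<in> closure \<Omega>" "y \<in> closure \<Omega>"
  shows "\<bar>\<psi> x - \<psi> y\<bar> \<le> R * norm (x - y)"
  using assms lipschitz_onD[of R "closure \<Omega>" \<psi> x y] by (auto simp: pot_def dist_norm)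

lemma pot_integrable: assumes "pot R \<psi>" shows "integrable \<mu> \<psi>"
  by (rule integrable_mu_continuous[OF pot_continuous[OF assms]])

text \<open>By the zero mean, \<open>\<psi> x\<close> is the average over \<open>y\<close> of
  \<open>\<psi> x - \<psi> y\<close>, and two points of the closure are at most \<open>2 * r\<close>
  apart.\<close>

lemma pot_bound:
  assumes p: "pot R \<psi>" and x: "x \<in> closure \<Omega>"
  shows "\<bar>\<psi> x\<bar> \<le> 2 * r * R"
proof -
  have int: "integrable \<mu> (\<lambda>y. \<psi> x - \<psi> y)" using pot_integrable[OF p] by simp
  have le: "\<bar>\<psi> x - \<psi> y\<bar> \<le> 2 * r * R" if y: "y \<in> \<Omega>" for y
  proof -
    have "\<bar>\<psi> x - \<psi> y\<bar> \<le> R * norm (x - y)"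
      by (rule pot_lipschitz[OF p x]) (use y closure_subset in auto)
    moreover have "norm (x - y) \<le> 2 * r"
      using norm_triangle_ineq4[of x y] norm_closure[OF x] norm_dom[OF y] by linarith
    then have "R * norm (x - y) \<le> R * (2 * r)" using pot_nonneg[OF p] by (rule mult_left_mono)
    ultimately show ?thesis by (simp add: mult_ac)
  qed
  have "\<psi> x = (\<integral>y. \<psi> x - \<psi> y \<partial>\<mu>)"
    using pot_integrable[OF p] p prob_space by (simp add: pot_def)
  then have "\<bar>\<psi> x\<bar> = \<bar>\<integral>y. \<psi> x - \<psi> y \<partial>\<mu>\<bar>" by simp
  also have "\<dots> \<le> (\<integral>y. \<bar>\<psi> x - \<psi> y\<bar> \<partial>\<mu>)" by (rule integral_abs_bound)
  also have "\<dots> \<le> (\<integral>y. 2 * r * R \<partial>\<mu>)"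
    by (rule integral_mono_AE) (use int AE_dom le in \<open>auto elim!: eventually_mono\<close>)
  also have "\<dots> = 2 * r * R" using prob_space by simp
  finally show ?thesis .
qed

text \<open>The subgradient inequality is tested with a step in the direction of the gradient
  itself. Thanks to the default 0 the bound holds at every point of the domain, not just almost
  everywhere.\<close>

lemma norm_grad_le:
  assumes p: "pot R \<psi>" and x: "x \<in> \<Omega>"
  shows "norm (grad \<psi> x) \<le> R"
proof (cases "\<psi> differentiable (at x)")
  case d: True
  obtain e where e: "e > 0" "\<And>h. \<bar>h\<bar> \<le> e \<Longrightarrow> x + h *\<^sub>R grad \<psi> x \<in> \<Omega>"
    using open_dir_interval[OF open_dom x] by metis
  let ?y = "x + e *\<^sub>R grad \<psi> x"
  have y: "?y \<in> \<Omega>" using e by simp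
  have "\<psi> x + grad \<psi> x \<bullet> (?y - x) \<le> \<psi> ?y"
    by (rule grad_subgradient[OF open_dom pot_convex[OF p] x y d])
  moreover have "\<bar>\<psi> ?y - \<psi> x\<bar> \<le> R * norm (?y - x)"
    by (rule pot_lipschitz[OF p]) (use x y closure_subset in auto)
  ultimately have "\<psi> x + e * (norm (grad \<psi> x))\<^sup>2 \<le> \<psi> ?y" "\<bar>\<psi> ?y - \<psi> x\<bar> \<le> R * (e * norm (grad \<psi> x))"
    using e(1) by (simp_all add: dot_square_norm)
  then have "e * (norm (grad \<psi> x))\<^sup>2 \<le> R * (e * norm (grad \<psi> x))" by linarith
  then have "norm (grad \<psi> x) * norm (grad \<psi> x) \<le> R * norm (grad \<psi> x)"
    using e(1) by (simp add: power2_eq_square)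
  then show ?thesis using pot_nonneg[OF p]
    by (cases "grad \<psi> x = 0") auto
qed (use pot_nonneg[OF p] in \<open>simp add: grad_def\<close>)

lemma pot_limit:
  assumes p: "\<And>k. pot R (F k)" and conv: "\<And>x. x \<in> closure \<Omega> \<Longrightarrow> (\<lambda>k. F k x) \<longlonglongrightarrow> \<psi> x"
  shows "pot R \<psi>"
  unfolding pot_def
proof (intro conjI)
  show "convex_on (closure \<Omega>) \<psi>"
  proof (intro convex_onI)
    fix t :: real and x y assume t: "0 < t" "t < 1" and xy: "x \<in> closure \<Omega>" "y \<in> closure \<Omega>"
    have c: "convex (closure \<Omega>)" using convex_dom by (rule convex_closure)
    have z: "(1 - t) *\<^sub>R x + t *\<^sub>R y \<in> closure \<Omega>" using c t xy by (simp add: convex_alt)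
    show "\<psi> ((1 - t) *\<^sub>R x + t *\<^sub>R y) \<le> (1 - t) * \<psi> x + t * \<psi> y"
    proof (rule LIMSEQ_le[OF conv[OF z]])
      show "(\<lambda>k. (1 - t) * F k x + t * F k y) \<longlonglongrightarrow> (1 - t) * \<psi> x + t * \<psi> y"
        by (intro tendsto_intros conv xy)
      show "\<exists>N. \<forall>n\<ge>N. F n ((1 - t) *\<^sub>R x + t *\<^sub>R y) \<le> (1 - t) * F n x + t * F n y"
        using p t xy by (auto simp: pot_def intro!: convex_onD[of "closure \<Omega>"])
    qed
  qed (use convex_dom convex_closure in auto)
  show "R-lipschitz_on (closure \<Omega>) \<psi>"
  proof (rule lipschitz_onI)
    fix x y assume xy: "x \<in> closure \<Omega>" "y \<in> closure \<Omega>"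
    have "(\<lambda>k. \<bar>F k x - F k y\<bar>) \<longlonglongrightarrow> \<bar>\<psi> x - \<psi> y\<bar>"
      by (intro tendsto_intros conv xy)
    then have "\<bar>\<psi> x - \<psi> y\<bar> \<le> R * norm (x - y)"
      by (rule LIMSEQ_le_const2) (use pot_lipschitz[OF p xy] in auto)
    then show "dist (\<psi> x) (\<psi> y) \<le> R * dist x y" by (simp add: dist_norm)
  qed (use pot_nonneg[OF p] in auto)
  have cO: "x \<in> closure \<Omega>" if "x \<in> \<Omega>" for x using that closure_subset by auto
  have "(\<lambda>k. \<integral>x. F k x \<partial>\<mu>) \<longlonglongrightarrow> (\<integral>x. \<psi> x \<partial>\<mu>)"
  proof (rule integral_dominated_convergence[where w="\<lambda>_. 2 * r * R"])
    show "\<psi> \<in> borel_measurable \<mu>"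
      by (rule borel_measurable_LIMSEQ_metric[of F]) (use pot_measurable[OF p] conv cO in auto)
    show "AE x in \<mu>. (\<lambda>k. F k x) \<longlonglongrightarrow> \<psi> x" using AE_dom by eventually_elim (use conv cO in auto)
    show "AE x in \<mu>. norm (F k x) \<le> 2 * r * R" for k
      using AE_dom by eventually_elim (use pot_bound[OF p] cO in auto)
  qed (use pot_measurable[OF p] in auto)
  moreover have "(\<integral>x. F k x \<partial>\<mu>) = 0" for k using p by (simp add: pot_def)
  ultimately show "(\<integral>x. \<psi> x \<partial>\<mu>) = 0" by (simp add: LIMSEQ_const_iff)
qed

lemma AE_grad_tendsto:
  assumes F: "\<And>k. convex_on \<Omega> (F k)" and f: "convex_on \<Omega> f"
    and conv: "\<And>x. x \<in> \<Omega> \<Longrightarrow> (\<lambda>k. F k x) \<longlonglongrightarrow> f x"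
  shows "AE x in \<mu>. (\<lambda>k. grad (F k) x) \<longlonglongrightarrow> grad f x"
proof -
  have "AE x in \<mu>. \<forall>k. F k differentiable (at x)"
    using AE_differentiable[OF F] by (simp add: AE_all_countable)
  with AE_differentiable[OF f] AE_dom show ?thesis
    by eventually_elim (intro grad_tendsto[OF open_dom _ F conv]; simp)
qed

text \<open>Integrands are continuous functions of the triple of position, gradient and time, so
  that Legendre transforms, barycentres, the weak formulation and the energy are all instances of
  the same few lemmas.\<close>

lemma continuous_grad_measurable:
  fixes g :: "(real^3) \<times> (real^3) \<times> real \<Rightarrow> 'b::{banach, second_countable_topology}"
  assumes g: "continuous_on UNIV g" and f: "convex_on \<Omega> f"
  shows "(\<lambda>x. g (x, grad f x, t)) \<in> borel_measurable \<mu>"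
proof -
  have [measurable]: "g \<in> borel_measurable borel" using g by (rule borel_measurable_continuous_onI)
  have [measurable]: "grad f \<in> borel_measurable \<mu>" by (rule grad_measurable[OF f])
  have [measurable]: "(\<lambda>x. x) \<in> borel_measurable \<mu>" by (rule measurable_mu_borel) simp
  show ?thesis by measurable
qed

lemma continuous_grad_bound:
  fixes g :: "(real^3) \<times> (real^3) \<times> real \<Rightarrow> 'b::real_normed_vector"
  assumes g: "continuous_on UNIV g"
  obtains B where "\<And>\<psi> x t. pot R \<psi> \<Longrightarrow> x \<in> \<Omega> \<Longrightarrow> \<bar>t\<bar> \<le> b \<Longrightarrow> norm (g (x, grad \<psi> x, t)) \<le> B"
proof -
  have "compact (g ` (cball 0 r \<times> cball 0 R \<times> cball 0 b))"
    by (intro compact_continuous_image continuous_on_subset[OF g] compact_Times) auto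
  then obtain B where B: "\<And>z. z \<in> cball 0 r \<times> cball 0 R \<times> cball 0 b \<Longrightarrow> norm (g z) \<le> B"
    using compact_imp_bounded bounded_iff by (metis image_eqI)
  show ?thesis
    by (rule that[of B], rule B) (use norm_dom norm_grad_le in auto)
qed

lemma continuous_grad_integrable:
  fixes g :: "(real^3) \<times> (real^3) \<times> real \<Rightarrow> 'b::euclidean_space"
  assumes g: "continuous_on UNIV g" and p: "pot R \<psi>"
  shows "integrable \<mu> (\<lambda>x. g (x, grad \<psi> x, t))"
proof -
  obtain B where B: "\<And>\<psi> x s. pot R \<psi> \<Longrightarrow> x \<in> \<Omega> \<Longrightarrow> \<bar>s\<bar> \<le> \<bar>t\<bar> \<Longrightarrow> norm (g (x, grad \<psi> x, s)) \<le> B"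
    using continuous_grad_bound[OF g] by blast
  have "AE x in \<mu>. norm (g (x, grad \<psi> x, t)) \<le> B"
    using AE_dom by eventually_elim (use B[OF p] in simp)
  then show ?thesis
    by (rule integrable_const_bound[OF _ continuous_grad_measurable[OF g pot_convex[OF p]]])
qed

text \<open>The limit theorem behind moments, barycentres, weak formulation and energy. The
  arguments of \<open>g\<close> stay in a compact set, which provides the constant majorant.\<close>

lemma integral_grad_tendsto:
  fixes g :: "(real^3) \<times> (real^3) \<times> real \<Rightarrow> 'b::euclidean_space"
  assumes g: "continuous_on UNIV g" and F: "\<And>k. pot R (F k)" and p: "pot R \<psi>"
    and conv: "\<And>x. x \<in> \<Omega> \<Longrightarrow> (\<lambda>k. F k x) \<longlonglongrightarrow> \<psi> x" and s: "s \<longlonglongrightarrow> t"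
  shows "(\<lambda>k. \<integral>x. g (x, grad (F k) x, s k) \<partial>\<mu>) \<longlonglongrightarrow> (\<integral>x. g (x, grad \<psi> x, t) \<partial>\<mu>)"
proof -
  obtain b where b: "\<And>k. norm (s k) \<le> b"
    using convergent_imp_Bseq[of s] s by (auto simp: convergent_def Bseq_def)
  obtain B where B: "\<And>\<psi> x s. pot R \<psi> \<Longrightarrow> x \<in> \<Omega> \<Longrightarrow> \<bar>s\<bar> \<le> b \<Longrightarrow> norm (g (x, grad \<psi> x, s)) \<le> B"
    using continuous_grad_bound[OF g] by blast
  show ?thesis
  proof (rule integral_dominated_convergence[where w="\<lambda>_. B"])
    show "AE x in \<mu>. (\<lambda>k. g (x, grad (F k) x, s k)) \<longlonglongrightarrow> g (x, grad \<psi> x, t)"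
      using AE_grad_tendsto[of F, OF pot_convex[OF F] pot_convex[OF p] conv, simplified]
    proof eventually_elim
      case (elim x)
      have "(\<lambda>k. (x, grad (F k) x, s k)) \<longlonglongrightarrow> (x, grad \<psi> x, t)"
        by (intro tendsto_intros elim s)
      then show ?case
        using continuous_on_tendsto_compose[OF g] by auto
    qed
    show "AE x in \<mu>. norm (g (x, grad (F k) x, s k)) \<le> B" for k
      using AE_dom by eventually_elim (use B[OF F] b in auto)
  qed (use continuous_grad_measurable[OF g] pot_convex[OF F] pot_convex[OF p] in auto)
qed

lemma AE_norm_grad_diff:
  assumes "pot R \<psi>" "pot R \<xi>"
  shows "AE x in \<mu>. norm ((norm (grad \<psi> x - grad \<xi> x))\<^sup>2) \<le> (2 * R)\<^sup>2"
  using AE_dom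
proof eventually_elim
  case (elim x)
  have "norm (grad \<psi> x - grad \<xi> x) \<le> 2 * R"
    using norm_triangle_ineq4[of "grad \<psi> x" "grad \<xi> x"] norm_grad_le[OF assms(1) elim] norm_grad_le[OF assms(2) elim]
    by linarith
  then have "(norm (grad \<psi> x - grad \<xi> x))\<^sup>2 \<le> (2 * R)\<^sup>2" by (intro power_mono) auto
  then show ?case by simp
qed

text \<open>Two sequences with a common limit, because the uniform estimate in time compares
  potentials at moving times, where neither of the two is fixed.\<close>

lemma grad_L2_tendsto:
  assumes F: "\<And>k. pot R (F k)" and G: "\<And>k. pot R (G k)" and p: "pot R \<psi>"
    and F_conv: "\<And>x. x \<in> \<Omega> \<Longrightarrow> (\<lambda>k. F k x) \<longlonglongrightarrow> \<psi> x"
    and G_conv: "\<And>x. x \<in> \<Omega> \<Longrightarrow> (\<lambda>k. G k x) \<longlonglongrightarrow> \<psi> x"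
  shows "(\<lambda>k. \<integral>x. (norm (grad (F k) x - grad (G k) x))\<^sup>2 \<partial>\<mu>) \<longlonglongrightarrow> 0"
proof -
  have "(\<lambda>k. \<integral>x. (norm (grad (F k) x - grad (G k) x))\<^sup>2 \<partial>\<mu>) \<longlonglongrightarrow> (\<integral>x. 0 \<partial>\<mu>)"
  proof (rule integral_dominated_convergence[where w="\<lambda>_. (2 * R)\<^sup>2"])
    show "AE x in \<mu>. (\<lambda>k. (norm (grad (F k) x - grad (G k) x))\<^sup>2) \<longlonglongrightarrow> 0"
      using AE_grad_tendsto[of F, OF pot_convex[OF F] pot_convex[OF p] F_conv, simplified]
        AE_grad_tendsto[of G, OF pot_convex[OF G] pot_convex[OF p] G_conv, simplified]
    proof eventually_elim
      case (elim x)
      have "(\<lambda>k. (norm (grad (F k) x - grad (G k) x))\<^sup>2) \<longlonglongrightarrow> (norm (grad \<psi> x - grad \<psi> x))\<^sup>2"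
        by (intro tendsto_intros elim)
      then show ?case by simp
    qed
    show "AE x in \<mu>. norm ((norm (grad (F k) x - grad (G k) x))\<^sup>2) \<le> (2 * R)\<^sup>2" for k
      by (rule AE_norm_grad_diff[OF F G])
    show "(\<lambda>x. (norm (grad (F k) x - grad (G k) x))\<^sup>2) \<in> borel_measurable \<mu>" for k
      using grad_measurable[OF pot_convex[OF F], of k] grad_measurable[OF pot_convex[OF G], of k] by measurable
  qed auto
  then show ?thesis by simp
qed

end

section \<open>Legendre transform and uniqueness of the transport map\<close>

context unit_domain
begin

text \<open>Conjugate of \<psi> extended by infinity outside the domain. As the domain is bounded,
  the supremum is finite for every \<open>y\<close>.\<close>

definition legendre :: "(real^3 \<Rightarrow> real) \<Rightarrow> real^3 \<Rightarrow> real" where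
  "legendre \<psi> y = (SUP x\<in>\<Omega>. x \<bullet> y - \<psi> x)"

lemma inner_dom_le: "x \<in> \<Omega> \<Longrightarrow> x \<bullet> y \<le> r * norm y"
  using norm_cauchy_schwarz[of x y] mult_right_mono[OF norm_dom norm_ge_zero, of x y] by linarith

lemma legendre_bdd: assumes p: "pot R \<psi>" shows "bdd_above ((\<lambda>x. x \<bullet> y - \<psi> x) ` \<Omega>)"
proof (rule bdd_aboveI2)
  fix x assume x: "x \<in> \<Omega>"
  then have "\<bar>\<psi> x\<bar> \<le> 2 * r * R" using closure_subset by (intro pot_bound[OF p]) auto
  then show "x \<bullet> y - \<psi> x \<le> r * norm y + 2 * r * R"
    using inner_dom_le[OF x, of y] by linarith
qed

lemma fenchel: assumes p: "pot R \<psi>" and x: "x \<in> \<Omega>" shows "x \<bullet> y \<le> \<psi> x + legendre \<psi> y"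
proof -
  have "x \<bullet> y - \<psi> x \<le> legendre \<psi> y"
    unfolding legendre_def by (rule cSUP_upper[OF x legendre_bdd[OF p]])
  then show ?thesis by simp
qed

text \<open>A supremum of affine functions of \<open>y\<close> whose slopes are points of the
  domain, hence of norm at most \<open>r\<close>.\<close>

lemma legendre_lipschitz:
  assumes p: "pot R \<psi>" shows "\<bar>legendre \<psi> y - legendre \<psi> z\<bar> \<le> r * norm (y - z)"
proof -
  have "legendre \<psi> y \<le> legendre \<psi> z + r * norm (y - z)" for y z
    unfolding legendre_def[of \<psi> y]
  proof (rule cSUP_least[OF dom_nonempty])
    fix x assume x: "x \<in> \<Omega>"
    have "x \<bullet> y = x \<bullet> z + x \<bullet> (y - z)" by (simp add: inner_diff_right)
    then show "x \<bullet> y - \<psi> x \<le> legendre \<psi> z + r * norm (y - z)"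
      using fenchel[OF p x, of z] inner_dom_le[OF x, of "y - z"] by linarith
  qed
  from this[of y z] this[of z y] show ?thesis by (simp add: norm_minus_commute abs_le_iff)
qed

lemma legendre_continuous: assumes p: "pot R \<psi>" shows "continuous_on UNIV (legendre \<psi>)"
proof -
  have "r-lipschitz_on UNIV (legendre \<psi>)"
    by (rule lipschitz_onI) (use legendre_lipschitz[OF p] r_nonneg in \<open>auto simp: dist_norm\<close>)
  then show ?thesis by (rule lipschitz_on_continuous_on)
qed

lemma legendre_grad:
  assumes p: "pot R \<psi>" and x: "x \<in> \<Omega>" and d: "\<psi> differentiable (at x)"
  shows "\<psi> x + legendre \<psi> (grad \<psi> x) = x \<bullet> grad \<psi> x"
proof (rule antisym)
  have "legendre \<psi> (grad \<psi> x) \<le> x \<bullet> grad \<psi> x - \<psi> x"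
    unfolding legendre_def
  proof (rule cSUP_least[OF dom_nonempty])
    fix y assume y: "y \<in> \<Omega>"
    show "y \<bullet> grad \<psi> x - \<psi> y \<le> x \<bullet> grad \<psi> x - \<psi> x"
      using grad_subgradient[OF open_dom pot_convex[OF p] x y d]
      by (simp add: inner_diff_right inner_commute)
  qed
  then show "\<psi> x + legendre \<psi> (grad \<psi> x) \<le> x \<bullet> grad \<psi> x" by simp
qed (rule fenchel[OF p x])

text \<open>Equality in the Fenchel inequality says that \<open>y\<close> is a subgradient at
  \<open>x\<close>, and where \<psi> is differentiable there is only one.\<close>

lemma fenchel_eq_imp_grad:
  assumes p: "pot R \<psi>" and x: "x \<in> \<Omega>" and d: "\<psi> differentiable (at x)"
    and eq: "\<psi> x + legendre \<psi> y = x \<bullet> y"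
  shows "y = grad \<psi> x"
proof (rule subgradient_imp_grad[OF open_dom x d])
  fix z assume z: "z \<in> \<Omega>"
  show "\<psi> x + y \<bullet> (z - x) \<le> \<psi> z"
    using fenchel[OF p z, of y] eq by (simp add: inner_diff_right inner_commute)
qed

lemma AE_legendre_grad: assumes p: "pot R \<psi>" shows "AE x in \<mu>. \<psi> x + legendre \<psi> (grad \<psi> x) = x \<bullet> grad \<psi> x"
  using AE_differentiable[OF pot_convex[OF p]] AE_dom by eventually_elim (rule legendre_grad[OF p])

lemma integrable_legendre_grad:
  assumes p: "pot R \<psi>" and q: "pot R' \<xi>" shows "integrable \<mu> (\<lambda>x. legendre \<psi> (grad \<xi> x))"
proof -
  have "continuous_on UNIV (\<lambda>z::(real^3)\<times>(real^3)\<times>real. legendre \<psi> (fst (snd z)))"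
    by (rule continuous_on_compose2[OF legendre_continuous[OF p]]) (auto intro!: continuous_intros)
  from continuous_grad_integrable[OF this q, of 0] show ?thesis by simp
qed

lemma integrable_inner_grad:
  assumes q: "pot R \<xi>" shows "integrable \<mu> (\<lambda>x. x \<bullet> grad \<xi> x)"
proof -
  have "continuous_on UNIV (\<lambda>z::(real^3)\<times>(real^3)\<times>real. fst z \<bullet> fst (snd z))"
    by (auto intro!: continuous_intros)
  from continuous_grad_integrable[OF this q, of 0] show ?thesis by simp
qed

text \<open>The integrated equality case of the Fenchel inequality; the potential itself drops out
  by its zero mean.\<close>

lemma integral_inner_grad:
  assumes p: "pot R \<psi>" shows "(\<integral>x. x \<bullet> grad \<psi> x \<partial>\<mu>) = (\<integral>x. legendre \<psi> (grad \<psi> x) \<partial>\<mu>)"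
proof -
  have "(\<integral>x. x \<bullet> grad \<psi> x \<partial>\<mu>) = (\<integral>x. \<psi> x + legendre \<psi> (grad \<psi> x) \<partial>\<mu>)"
    using AE_legendre_grad[OF p] integrable_inner_grad[OF p] integrable_legendre_grad[OF p p] pot_integrable[OF p]
    by (intro integral_cong_AE) (auto elim!: eventually_mono)
  also have "\<dots> = (\<integral>x. legendre \<psi> (grad \<psi> x) \<partial>\<mu>)"
    using integrable_legendre_grad[OF p p] pot_integrable[OF p] p by (simp add: pot_def)
  finally show ?thesis .
qed

text \<open>Complementary slackness: the Fenchel gap of \<open>S\<close> is nonnegative and the
  hypotheses make its integral nonpositive, so it vanishes almost everywhere. Equality of image
  measures enters only through the moment of \<open>legendre \<psi>\<close>, so the lemma serves
  both for optimal maps and for gradients of other potentials.\<close>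

lemma transport_unique:
  assumes p: "pot R \<psi>" and c: "integrable \<mu> (\<lambda>x. legendre \<psi> (S x))" and i: "integrable \<mu> (\<lambda>x. x \<bullet> S x)"
    and eq: "(\<integral>x. legendre \<psi> (S x) \<partial>\<mu>) = (\<integral>x. legendre \<psi> (grad \<psi> x) \<partial>\<mu>)"
    and le: "(\<integral>x. x \<bullet> grad \<psi> x \<partial>\<mu>) \<le> (\<integral>x. x \<bullet> S x \<partial>\<mu>)"
  shows "AE x in \<mu>. S x = grad \<psi> x"
proof -
  let ?h = "\<lambda>x. \<psi> x + legendre \<psi> (S x) - x \<bullet> S x"
  have int: "integrable \<mu> ?h" using pot_integrable[OF p] c i by simp
  have nonneg: "AE x in \<mu>. 0 \<le> ?h x"
    using AE_dom
  proof eventually_elim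
    case (elim x)
    then show ?case using fenchel[OF p elim, of "S x"] by simp
  qed
  have "(\<integral>x. ?h x \<partial>\<mu>) = (\<integral>x. legendre \<psi> (S x) \<partial>\<mu>) - (\<integral>x. x \<bullet> S x \<partial>\<mu>)"
    using pot_integrable[OF p] c i p by (simp add: pot_def)
  also have "\<dots> \<le> 0" using eq le integral_inner_grad[OF p] by simp
  finally have "(\<integral>x. ?h x \<partial>\<mu>) = 0" using integral_nonneg_AE[OF nonneg] by simp
  then have "AE x in \<mu>. ?h x = 0" using integral_nonneg_eq_0_iff_AE[OF int nonneg] by simp
  with AE_differentiable[OF pot_convex[OF p]] AE_dom show ?thesis
    by eventually_elim (rule fenchel_eq_imp_grad[OF p], auto)
qed

text \<open>Slopes increase along the segment, so on each of \<open>n\<close> equal pieces the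
  increments of \<open>f\<close> and of \<open>g\<close> both lie between the slopes at the two
  ends, divided by \<open>n\<close>. The total discrepancy telescopes to
  \<open>(G 1 - G 0) / n\<close>, where \<open>G\<close> is the common slope. Only rational
  parameters occur as division points.\<close>

lemma segment_increment_eq:
  assumes f: "convex_on \<Omega> f" and g: "convex_on \<Omega> g" and a: "a \<in> \<Omega>" and b: "a + v \<in> \<Omega>"
    and good: "\<And>q. q \<in> \<rat> \<Longrightarrow> 0 \<le> q \<Longrightarrow> q \<le> 1 \<Longrightarrow> f differentiable (at (a + q *\<^sub>R v)) \<and>
        g differentiable (at (a + q *\<^sub>R v)) \<and> grad f (a + q *\<^sub>R v) = grad g (a + q *\<^sub>R v)"
  shows "f (a + v) - f a = g (a + v) - g a"
proof -
  let ?G = "\<lambda>q. grad f (a + q *\<^sub>R v) \<bullet> v"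
  have inO: "a + q *\<^sub>R v \<in> \<Omega>" if "0 \<le> q" "q \<le> 1" for q
  proof -
    have "(1 - q) *\<^sub>R a + q *\<^sub>R (a + v) \<in> \<Omega>"
      using convex_dom a b that by (simp add: convex_alt)
    then show ?thesis by (simp add: algebra_simps)
  qed
  have bnd: "\<bar>(f (a + v) - f a) - (g (a + v) - g a)\<bar> \<le> (?G 1 - ?G 0) / real n" if n: "n > 0" for n
  proof -
    define p where "p j = a + (real j / real n) *\<^sub>R v" for j
    have step: "\<bar>(f (p (Suc j)) - f (p j)) - (g (p (Suc j)) - g (p j))\<bar>
        \<le> ?G (real (Suc j) / real n) / real n - ?G (real j / real n) / real n" if j: "j < n" for j
    proof -
      have q: "real j / real n \<in> \<rat>" "real (Suc j) / real n \<in> \<rat>" by auto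
      have b01: "0 \<le> real j / real n" "real j / real n \<le> 1" "0 \<le> real (Suc j) / real n" "real (Suc j) / real n \<le> 1"
        using j by (auto simp: divide_simps)
      have pO: "p j \<in> \<Omega>" "p (Suc j) \<in> \<Omega>" unfolding p_def by (rule inO; fact b01)+
      have d: "p (Suc j) - p j = (1 / real n) *\<^sub>R v"
        unfolding p_def by (simp add: add_divide_distrib scaleR_add_left)
      then have d': "p j - p (Suc j) = - ((1 / real n) *\<^sub>R v)" by (metis minus_diff_eq)
      note g1 = good[OF q(1) b01(1,2), folded p_def] and g2 = good[OF q(2) b01(3,4), folded p_def]
      have F: "f (p j) + (grad f (p j) \<bullet> v) / real n \<le> f (p (Suc j))" "f (p (Suc j)) - (grad f (p (Suc j)) \<bullet> v) / real n \<le> f (p j)"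
        using grad_subgradient[OF open_dom f pO] grad_subgradient[OF open_dom f pO(2,1)] g1 g2 d d' by auto
      have G: "g (p j) + (grad f (p j) \<bullet> v) / real n \<le> g (p (Suc j))" "g (p (Suc j)) - (grad f (p (Suc j)) \<bullet> v) / real n \<le> g (p j)"
        using grad_subgradient[OF open_dom g pO] grad_subgradient[OF open_dom g pO(2,1)] g1 g2 d d' by auto
      show ?thesis using F G unfolding p_def[symmetric] by linarith
    qed
    have f_tel: "(\<Sum>j<n. f (p (Suc j)) - f (p j)) = f (a + v) - f a"
      using n by (subst sum_lessThan_telescope) (simp add: p_def)
    have g_tel: "(\<Sum>j<n. g (p (Suc j)) - g (p j)) = g (a + v) - g a"
      using n by (subst sum_lessThan_telescope) (simp add: p_def)
    have "\<bar>(f (a + v) - f a) - (g (a + v) - g a)\<bar> = \<bar>\<Sum>j<n. (f (p (Suc j)) - f (p j)) - (g (p (Suc j)) - g (p j))\<bar>"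
      by (simp add: sum_subtractf[of "\<lambda>j. f (p (Suc j)) - f (p j)"] f_tel g_tel del: sum_subtractf)
    also have "\<dots> \<le> (\<Sum>j<n. ?G (real (Suc j) / real n) / real n - ?G (real j / real n) / real n)"
      by (rule order_trans[OF sum_abs sum_mono]) (use step in auto)
    also have "\<dots> = ?G (real n / real n) / real n - ?G (real 0 / real n) / real n"
      by (rule sum_lessThan_telescope[of "\<lambda>j. ?G (real j / real n) / real n"])
    finally show ?thesis using n by (simp add: diff_divide_distrib)
  qed
  have "(\<lambda>n. (?G 1 - ?G 0) / real n) \<longlonglongrightarrow> 0" by (rule lim_const_over_n)
  then have "\<bar>(f (a + v) - f a) - (g (a + v) - g a)\<bar> \<le> 0"
    by (rule LIMSEQ_le_const) (use bnd in \<open>auto intro!: exI[of _ 1]\<close>)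
  then show ?thesis by simp
qed

text \<open>Almost every small translate of a segment meets the exceptional null set in no rational point,
  and along such a segment the Riemann sums of the gradients determine the increments.\<close>

lemma AE_grad_eq_imp_const:
  assumes f: "convex_on \<Omega> f" and g: "convex_on \<Omega> g" and eq: "AE x in \<mu>. grad f x = grad g x"
  shows "\<exists>c. \<forall>x\<in>\<Omega>. f x = g x + c"
proof -
  have "AE x in \<mu>. f differentiable (at x) \<and> g differentiable (at x) \<and> grad f x = grad g x"
    using AE_differentiable[OF f] AE_differentiable[OF g] eq by eventually_elim simp
  then obtain N where N: "N \<in> null_sets lebesgue"
    "\<And>x. x \<in> \<Omega> \<Longrightarrow> x \<notin> N \<Longrightarrow> f differentiable (at x) \<and> g differentiable (at x) \<and> grad f x = grad g x"
    unfolding AE_mu_iff by (auto elim!: AE_E3)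
  have incr: "f y - f x = g y - g x" if x: "x \<in> \<Omega>" and y: "y \<in> \<Omega>" for x y
  proof -
    define v where "v = y - x"
    obtain e where e: "e > 0" "ball x e \<subseteq> \<Omega>" "ball y e \<subseteq> \<Omega>"
    proof -
      obtain e1 where "e1 > 0" "ball x e1 \<subseteq> \<Omega>" using open_dom x openE by blast
      moreover obtain e2 where "e2 > 0" "ball y e2 \<subseteq> \<Omega>" using open_dom y openE by blast
      ultimately show ?thesis using that[of "min e1 e2"] by (auto simp: subset_iff)
    qed
    \<comment> \<open>If no such shift existed, a whole ball of shifts would be covered by countably
      many translates of the null set \<open>N\<close>.\<close>
    have ex: "\<exists>h. norm h < min e (1 / real (Suc n)) \<and> (\<forall>q\<in>\<rat>. x + h + q *\<^sub>R v \<notin> N)" for n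
    proof (rule ccontr)
      assume "\<not> ?thesis"
      then have "ball 0 (min e (1 / real (Suc n))) \<subseteq> (\<Union>q\<in>\<rat>. (+) (- (x + q *\<^sub>R v)) ` N)"
        by (force simp: image_iff algebra_simps)
      moreover have "negligible (\<Union>q\<in>\<rat>. (+) (- (x + q *\<^sub>R v)) ` N)"
        using N(1) by (intro negligible_Union_nat negligible_countable_Union countable_image countable_rat)
          (auto simp: negligible_iff_null_sets[symmetric] negligible_translation)
      ultimately have "negligible (ball (0::real^3) (min e (1 / real (Suc n))))"
        by (rule negligible_subset[rotated])
      moreover have "min e (1 / real (Suc n)) > 0" using e(1) by simp
      ultimately show False
        using open_not_negligible[of "ball (0::real^3) (min e (1 / real (Suc n)))"] by (simp del: of_nat_Suc)
    qed
    then obtain h where h: "\<And>n. norm (h n) < min e (1 / real (Suc n))" "\<And>n q. q \<in> \<rat> \<Longrightarrow> x + h n + q *\<^sub>R v \<notin> N"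
      by metis
    have h0: "h \<longlonglongrightarrow> 0"
      by (rule Lim_null_comparison[OF _ LIMSEQ_Suc[OF lim_1_over_n[where 'a=real]]])
         (use h(1) in \<open>auto intro!: always_eventually less_imp_le simp del: of_nat_Suc\<close>)
    have hx: "x + h n \<in> \<Omega>" and hy: "y + h n \<in> \<Omega>" for n
      using e(2,3) h(1)[of n] by (auto simp: subset_iff dist_norm)
    have "f (y + h n) - f (x + h n) = g (y + h n) - g (x + h n)" for n
    proof -
      have yv: "y + h n = x + h n + v" by (simp add: v_def)
      have "f (x + h n + v) - f (x + h n) = g (x + h n + v) - g (x + h n)"
      proof (rule segment_increment_eq[OF f g hx])
        show "x + h n + v \<in> \<Omega>" using hy yv by metis
        fix q :: real assume q: "q \<in> \<rat>" "0 \<le> q" "q \<le> 1"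
        have "(1 - q) *\<^sub>R (x + h n) + q *\<^sub>R (x + h n + v) \<in> \<Omega>"
          using convex_dom hx[of n] hy[of n] q unfolding yv by (simp add: convex_alt)
        then have "x + h n + q *\<^sub>R v \<in> \<Omega>" by (simp add: algebra_simps)
        then show "f differentiable (at (x + h n + q *\<^sub>R v)) \<and> g differentiable (at (x + h n + q *\<^sub>R v)) \<and>
          grad f (x + h n + q *\<^sub>R v) = grad g (x + h n + q *\<^sub>R v)"
          by (rule N(2)[OF _ h(2)[OF q(1)]])
      qed
      then show ?thesis unfolding yv .
    qed
    moreover have cont: "(\<lambda>n. k (z + h n)) \<longlonglongrightarrow> k z" if "convex_on \<Omega> k" "z \<in> \<Omega>" "\<And>n. z + h n \<in> \<Omega>" for k z
    proof (rule continuous_on_tendsto_compose[OF convex_on_continuous[OF open_dom that(1)] _ that(2)])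
      show "(\<lambda>n. z + h n) \<longlonglongrightarrow> z" using tendsto_add[OF tendsto_const h0, of z] by simp
    qed (use that in auto)
    have "(\<lambda>n. f (y + h n) - f (x + h n)) \<longlonglongrightarrow> f y - f x" "(\<lambda>n. g (y + h n) - g (x + h n)) \<longlonglongrightarrow> g y - g x"
      using f g x y hx hy by (auto intro!: tendsto_diff cont)
    ultimately show ?thesis using LIMSEQ_unique by simp
  qed
  obtain x0 where x0: "x0 \<in> \<Omega>" using dom_nonempty by blast
  have "\<forall>x\<in>\<Omega>. f x = g x + (f x0 - g x0)" using incr[OF x0] by (auto simp: algebra_simps)
  then show ?thesis by blast
qed

lemma pots_eq:
  assumes p: "pot R \<psi>" and q: "pot R' \<xi>" and eq: "AE x in \<mu>. grad \<psi> x = grad \<xi> x"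
    and x: "x \<in> closure \<Omega>"
  shows "\<psi> x = \<xi> x"
proof -
  obtain c where c: "\<And>x. x \<in> \<Omega> \<Longrightarrow> \<psi> x = \<xi> x + c"
    using AE_grad_eq_imp_const[OF pot_convex[OF p] pot_convex[OF q] eq] by blast
  have "(\<integral>x. \<psi> x \<partial>\<mu>) = (\<integral>x. \<xi> x + c \<partial>\<mu>)"
    by (rule Bochner_Integration.integral_cong) (use c in auto)
  then have "c = 0" using p q pot_integrable[OF q] prob_space by (simp add: pot_def)
  then have "\<And>x. x \<in> \<Omega> \<Longrightarrow> \<psi> x - \<xi> x = 0" using c by simp
  moreover have "continuous_on (closure \<Omega>) (\<lambda>x. \<psi> x - \<xi> x)"
    by (intro continuous_intros pot_continuous[OF p] pot_continuous[OF q])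
  ultimately have "\<psi> x - \<xi> x = 0"
    using continuous_constant_on_closure[of \<Omega> "\<lambda>x. \<psi> x - \<xi> x" 0 x] x by blast
  then show ?thesis by simp
qed

text \<open>Only the two Legendre transforms are used as test functions, and they are
  \<open>r\<close>-Lipschitz. That of \<psi> gives the equality of dual values, that of \<xi> the
  inequality between the correlations with \<open>x\<close>; together they are the hypotheses of
  \<open>transport_unique\<close> with \<open>S = grad \<xi>\<close>.\<close>

lemma pots_eq_if_same_moments:
  assumes p: "pot R \<psi>" and q: "pot R \<xi>"
    and eq: "\<And>f :: real^3 \<Rightarrow> real. r-lipschitz_on UNIV f \<Longrightarrow> (\<integral>x. f (grad \<psi> x) \<partial>\<mu>) = (\<integral>x. f (grad \<xi> x) \<partial>\<mu>)"
    and x: "x \<in> closure \<Omega>"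
  shows "\<psi> x = \<xi> x"
proof -
  have lip: "r-lipschitz_on UNIV (legendre \<phi>)" if "pot R \<phi>" for \<phi>
    by (rule lipschitz_onI) (use legendre_lipschitz[OF that] r_nonneg in \<open>auto simp: dist_norm\<close>)
  have le: "(\<integral>x. x \<bullet> grad \<xi> x \<partial>\<mu>) \<le> (\<integral>x. x \<bullet> grad \<psi> x \<partial>\<mu>)"
    if p: "pot R \<psi>" and q: "pot R \<xi>" and eq: "(\<integral>x. legendre \<psi> (grad \<psi> x) \<partial>\<mu>) = (\<integral>x. legendre \<psi> (grad \<xi> x) \<partial>\<mu>)" for \<psi> \<xi>
  proof -
    have "(\<integral>x. x \<bullet> grad \<xi> x \<partial>\<mu>) \<le> (\<integral>x. \<psi> x + legendre \<psi> (grad \<xi> x) \<partial>\<mu>)"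
      by (rule integral_mono_AE)
        (use integrable_inner_grad[OF q] integrable_legendre_grad[OF p q] pot_integrable[OF p] AE_dom fenchel[OF p] in \<open>auto elim!: eventually_mono\<close>)
    also have "\<dots> = (\<integral>x. legendre \<psi> (grad \<xi> x) \<partial>\<mu>)"
      using integrable_legendre_grad[OF p q] pot_integrable[OF p] p by (simp add: pot_def)
    finally show ?thesis using eq integral_inner_grad[OF p] by simp
  qed
  have "AE x in \<mu>. grad \<xi> x = grad \<psi> x"
    by (rule transport_unique[OF p integrable_legendre_grad[OF p q] integrable_inner_grad[OF q]])
       (use eq lip[OF p] le[OF q p] eq[OF lip[OF q]] in auto)
  then show ?thesis by (intro pots_eq[OF p q _ x]) (auto elim!: eventually_mono)
qed

end

section \<open>Optimal transport by gradients and compactness\<close>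

text \<open>For a dual lower bound \<open>u\<close> that may be negative, and a cost
  \<open>w\<close> whose integral against an arbitrary coupling may be infinite.\<close>

lemma nn_integral_ge_integral:
  assumes u: "integrable M u" and le: "AE x in M. u x \<le> w x"
  shows "ennreal (\<integral>x. u x \<partial>M) \<le> (\<integral>\<^sup>+x. ennreal (w x) \<partial>M)"
proof -
  have i: "integrable M (\<lambda>x. max 0 (u x))" using u by (intro integrable_max) auto
  have "ennreal (\<integral>x. u x \<partial>M) \<le> ennreal (\<integral>x. max 0 (u x) \<partial>M)"
    by (intro ennreal_leI integral_mono u i) auto
  also have "\<dots> = (\<integral>\<^sup>+x. ennreal (max 0 (u x)) \<partial>M)"
    by (rule nn_integral_eq_integral[symmetric, OF i]) simp
  also have "\<dots> = (\<integral>\<^sup>+x. ennreal (u x) \<partial>M)" by (rule nn_integral_cong) (auto simp: max_def ennreal_neg)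
  also have "\<dots> \<le> (\<integral>\<^sup>+x. ennreal (w x) \<partial>M)"
    by (rule nn_integral_mono_AE) (use le in \<open>auto elim!: eventually_mono intro: ennreal_leI\<close>)
  finally show ?thesis .
qed

lemma W2_nonneg: "W2 \<alpha> \<beta> \<ge> 0"
  unfolding W2_def by simp

lemma is_ot_map_cong:
  assumes "\<And>x. x \<in> \<Omega> \<Longrightarrow> S x = T x"
  shows "is_ot_map \<Omega> \<nu> S \<longleftrightarrow> is_ot_map \<Omega> \<nu> T"
proof -
  have 1: "S -` A \<inter> \<Omega> = T -` A \<inter> \<Omega>" for A using assms by auto
  have 2: "(\<integral>\<^sup>+ x. indicator \<Omega> x * ennreal ((norm (x - S x))\<^sup>2) \<partial>lebesgue) =
    (\<integral>\<^sup>+ x. indicator \<Omega> x * ennreal ((norm (x - T x))\<^sup>2) \<partial>lebesgue)"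
    by (rule nn_integral_cong) (auto simp: indicator_def assms)
  show ?thesis unfolding is_ot_map_def 1 2 ..
qed

context unit_domain
begin

definition push :: "(real^3 \<Rightarrow> real) \<Rightarrow> (real^3) measure" where
  "push \<psi> = distr \<mu> borel (grad \<psi>)"

lemma sets_push [simp]: "sets (push \<psi>) = sets borel" by (simp add: push_def)


lemma id_measurable_mu: "(\<lambda>x. x) \<in> borel_measurable \<mu>"
  by (rule measurable_mu_borel) simp

lemma integral_push:
  fixes f :: "real^3 \<Rightarrow> 'b::{banach, second_countable_topology}"
  assumes p: "pot R \<psi>" and f: "f \<in> borel_measurable borel"
  shows "(\<integral>y. f y \<partial>push \<psi>) = (\<integral>x. f (grad \<psi> x) \<partial>\<mu>)"
  unfolding push_def by (rule integral_distr[OF grad_measurable[OF pot_convex[OF p]] f])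

lemma prob_space_push: assumes p: "pot R \<psi>" shows "prob_space (push \<psi>)"
  unfolding push_def by (rule prob_space_distr[OF grad_measurable[OF pot_convex[OF p]]])

lemma AE_push_norm: assumes p: "pot R \<psi>" shows "AE y in push \<psi>. norm y \<le> R"
  unfolding push_def
proof (subst AE_distr_iff[OF grad_measurable[OF pot_convex[OF p]]])
  show "AE x in \<mu>. norm (grad \<psi> x) \<le> R"
    using AE_dom by eventually_elim (rule norm_grad_le[OF p])
qed simp

lemma push_in_Pc: assumes p: "pot R \<psi>" shows "push \<psi> \<in> Pc"
proof -
  interpret P: prob_space "push \<psi>" by (rule prob_space_push[OF p])
  have "emeasure (push \<psi>) (cball 0 R) = 1"
    by (rule P.emeasure_eq_1_AE) (use AE_push_norm[OF p] in auto)
  then show ?thesis using P.prob_space_axioms by (auto simp: Pc_def intro!: exI[of _ "cball 0 R"])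
qed

text \<open>\<open>LebOmega\<close> is a density against \<open>lborel\<close>, whereas \<mu>
  restricts the completed measure; pushing \<mu> along the identity to the Borel sets reconciles the
  two.\<close>

lemma LebOmega_eq: "LebOmega \<Omega> = distr \<mu> borel (\<lambda>x. x)"
proof (rule measure_eqI)
  fix A assume "A \<in> sets (LebOmega \<Omega>)"
  then have A: "A \<in> sets borel" by (simp add: LebOmega_def)
  have OA: "\<Omega> \<inter> A \<in> sets lborel" using A by auto
  have "emeasure (LebOmega \<Omega>) A = (\<integral>\<^sup>+x. indicator \<Omega> x * indicator A x \<partial>lborel)"
    unfolding LebOmega_def using A by (intro emeasure_density) (auto intro!: borel_measurable_indicator)
  also have "\<dots> = emeasure lborel (\<Omega> \<inter> A)"
    by (simp add: nn_integral_indicator[OF OA] flip: indicator_inter_arith)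
  also have "\<dots> = emeasure \<mu> (A \<inter> \<Omega>)"
    using OA by (subst emeasure_restrict_space) (auto simp: Int_commute)
  also have "\<dots> = emeasure (distr \<mu> borel (\<lambda>x. x)) A"
    using A by (subst emeasure_distr[OF id_measurable_mu]) auto
  finally show "emeasure (LebOmega \<Omega>) A = emeasure (distr \<mu> borel (\<lambda>x. x)) A" .
qed (simp add: LebOmega_def)

lemma joint_coupling:
  assumes S: "S \<in> borel_measurable \<mu>" and T: "T \<in> borel_measurable \<mu>"
  shows "distr \<mu> borel (\<lambda>x. (S x, T x)) \<in> couplings (distr \<mu> borel S) (distr \<mu> borel T)"
    and "(\<integral>\<^sup>+ p. ennreal ((norm (fst p - snd p))\<^sup>2) \<partial>distr \<mu> borel (\<lambda>x. (S x, T x)))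
       = (\<integral>\<^sup>+ x. ennreal ((norm (S x - T x))\<^sup>2) \<partial>\<mu>)"
proof -
  have ST: "(\<lambda>x. (S x, T x)) \<in> borel_measurable \<mu>" using S T by (rule borel_measurable_Pair)
  have f: "(fst :: (real^3)\<times>(real^3) \<Rightarrow> _) \<in> borel_measurable borel" "(snd :: (real^3)\<times>(real^3) \<Rightarrow> _) \<in> borel_measurable borel"
    by (auto intro!: borel_measurable_continuous_onI continuous_intros)
  show "distr \<mu> borel (\<lambda>x. (S x, T x)) \<in> couplings (distr \<mu> borel S) (distr \<mu> borel T)"
    unfolding couplings_def using f ST by (auto simp: distr_distr comp_def)
  show "(\<integral>\<^sup>+ p. ennreal ((norm (fst p - snd p))\<^sup>2) \<partial>distr \<mu> borel (\<lambda>x. (S x, T x)))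
       = (\<integral>\<^sup>+ x. ennreal ((norm (S x - T x))\<^sup>2) \<partial>\<mu>)"
    by (subst nn_integral_distr[OF ST]) (use f in \<open>auto intro!: measurable_compose[OF _ measurable_ennreal] borel_measurable_power borel_measurable_norm borel_measurable_diff\<close>)
qed

text \<open>The joint law of the two gradients under \<mu> is an admissible coupling.\<close>

lemma W2_push_le:
  assumes p: "pot R \<psi>" and q: "pot R \<xi>"
  shows "W2 (push \<psi>) (push \<xi>) \<le> sqrt (\<integral>x. (norm (grad \<psi> x - grad \<xi> x))\<^sup>2 \<partial>\<mu>)"
proof -
  note m = grad_measurable[OF pot_convex[OF p]] grad_measurable[OF pot_convex[OF q]]
  let ?I = "INF \<pi>\<in>couplings (push \<psi>) (push \<xi>). \<integral>\<^sup>+ p. ennreal ((norm (fst p - snd p))\<^sup>2) \<partial>\<pi>"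
  have m2: "(\<lambda>x. (norm (grad \<psi> x - grad \<xi> x))\<^sup>2) \<in> borel_measurable \<mu>" using m by measurable
  have int: "integrable \<mu> (\<lambda>x. (norm (grad \<psi> x - grad \<xi> x))\<^sup>2)"
    by (rule integrable_const_bound[OF AE_norm_grad_diff[OF p q] m2])
  have "?I \<le> (\<integral>\<^sup>+ p. ennreal ((norm (fst p - snd p))\<^sup>2) \<partial>distr \<mu> borel (\<lambda>x. (grad \<psi> x, grad \<xi> x)))"
    unfolding push_def by (rule INF_lower[OF joint_coupling(1)[OF m]])
  also have "\<dots> = (\<integral>\<^sup>+ x. ennreal ((norm (grad \<psi> x - grad \<xi> x))\<^sup>2) \<partial>\<mu>)" by (rule joint_coupling(2)[OF m])
  also have "\<dots> = ennreal (\<integral>x. (norm (grad \<psi> x - grad \<xi> x))\<^sup>2 \<partial>\<mu>)"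
    by (rule nn_integral_eq_integral[OF int]) simp
  finally have "enn2real ?I \<le> (\<integral>x. (norm (grad \<psi> x - grad \<xi> x))\<^sup>2 \<partial>\<mu>)"
    by (intro enn2real_leI) auto
  then show ?thesis unfolding W2_def by (rule real_sqrt_le_mono)
qed

text \<open>Kantorovich duality: a pair of functions whose sum lies below the cost bounds the cost
  of every coupling from below by the same number, and along the gradient the bound is
  attained.\<close>

lemma grad_is_ot_map:
  assumes p: "pot R \<psi>" shows "is_ot_map \<Omega> (push \<psi>) (grad \<psi>)"
  unfolding is_ot_map_def
proof (intro conjI ballI)
  note m = grad_measurable[OF pot_convex[OF p]]
  fix A :: "(real^3) set" assume A: "A \<in> sets borel"
  have "grad \<psi> -` A \<inter> \<Omega> \<in> sets \<mu>" using measurable_sets[OF m A] by simp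
  then show *: "grad \<psi> -` A \<inter> \<Omega> \<in> sets lebesgue" by (simp add: sets_restrict_space_iff)
  show "emeasure lebesgue (grad \<psi> -` A \<inter> \<Omega>) = emeasure (push \<psi>) A"
    unfolding push_def using A by (subst emeasure_distr[OF m]) (auto simp: emeasure_restrict_space)
next
  note m = grad_measurable[OF pot_convex[OF p]]
  fix \<pi> assume "\<pi> \<in> couplings (LebOmega \<Omega>) (push \<psi>)"
  then have pi: "sets \<pi> = sets borel" "distr \<pi> borel fst = distr \<mu> borel (\<lambda>x. x)" "distr \<pi> borel snd = distr \<mu> borel (grad \<psi>)"
    by (auto simp: couplings_def LebOmega_eq push_def)
  have M: "measurable \<pi> (borel :: (real^3) measure) = measurable borel borel"
    by (rule measurable_cong_sets[OF pi(1) refl])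
  have f: "fst \<in> borel_measurable \<pi>" "snd \<in> borel_measurable \<pi>"
    unfolding M by (auto intro!: borel_measurable_continuous_onI continuous_intros)
  \<comment> \<open>The dual pair for the squared distance: expanding the square turns the Fenchel
    inequality into \<open>a x + b y \<le> (norm (x - y))\<^sup>2\<close> on the domain. The
    indicator makes \<open>a\<close> Borel on the whole space.\<close>
  define a where "a x = indicator \<Omega> x *\<^sub>R ((norm x)\<^sup>2 - 2 * \<psi> x)" for x
  define b where "b y = (norm y)\<^sup>2 - 2 * legendre \<psi> y" for y
  have a: "a \<in> borel_measurable borel"
    unfolding a_def using pot_convex[OF p]
    by (intro borel_measurable_continuous_on_indicator continuous_intros convex_on_continuous[OF open_dom]) auto
  have b: "b \<in> borel_measurable borel"
    unfolding b_def by (intro borel_measurable_continuous_onI continuous_intros legendre_continuous[OF p])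
  have cb: "continuous_on UNIV (\<lambda>z::(real^3)\<times>(real^3)\<times>real. b (fst (snd z)))"
    unfolding b_def by (intro continuous_intros continuous_on_compose2[OF legendre_continuous[OF p]]) auto
  have bi: "integrable \<mu> (\<lambda>x. b (grad \<psi> x))"
    using continuous_grad_integrable[OF cb p, of 0] by simp
  have cn: "continuous_on UNIV (\<lambda>z::(real^3)\<times>(real^3)\<times>real. (norm (fst z))\<^sup>2)" by (intro continuous_intros)
  have "integrable \<mu> (\<lambda>x. (norm x)\<^sup>2 - 2 * \<psi> x)"
    using continuous_grad_integrable[OF cn p, of 0] pot_integrable[OF p] by simp
  then have ai: "integrable \<mu> a"
    by (rule Bochner_Integration.integrable_cong[THEN iffD1, rotated -1]) (auto simp: a_def)
  have af: "integrable \<pi> (\<lambda>p. a (fst p))" "(\<integral>p. a (fst p) \<partial>\<pi>) = (\<integral>x. a x \<partial>\<mu>)"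
    using integrable_distr_eq[OF f(1) a] integral_distr[OF f(1) a] integrable_distr_eq[OF id_measurable_mu a] integral_distr[OF id_measurable_mu a] pi(2) ai
    by auto
  have bs: "integrable \<pi> (\<lambda>p. b (snd p))" "(\<integral>p. b (snd p) \<partial>\<pi>) = (\<integral>x. b (grad \<psi> x) \<partial>\<mu>)"
    using integrable_distr_eq[OF f(2) b] integral_distr[OF f(2) b] integrable_distr_eq[OF m b] integral_distr[OF m b] pi(3) bi
    by auto
  have "AE x in distr \<pi> borel fst. x \<in> \<Omega>"
    unfolding pi(2) by (subst AE_distr_iff[OF id_measurable_mu]) (use AE_dom in auto)
  then have "AE p in \<pi>. fst p \<in> \<Omega>" by (subst (asm) AE_distr_iff[OF f(1)]) auto
  then have le: "AE p in \<pi>. a (fst p) + b (snd p) \<le> (norm (fst p - snd p))\<^sup>2"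
  proof eventually_elim
    case (elim q)
    then show ?case
      using fenchel[OF p elim, of "snd q"]
      by (simp add: a_def b_def power2_norm_eq_inner inner_diff_left inner_diff_right inner_commute)
  qed
  have ae: "AE x in \<mu>. (norm (x - grad \<psi> x))\<^sup>2 = a x + b (grad \<psi> x)"
    using AE_legendre_grad[OF p] AE_dom
  proof eventually_elim
    case (elim x)
    then show ?case
      by (simp add: a_def b_def power2_norm_eq_inner inner_diff_left inner_diff_right inner_commute algebra_simps)
  qed
  have "(\<integral>\<^sup>+ x. indicator \<Omega> x * ennreal ((norm (x - grad \<psi> x))\<^sup>2) \<partial>lebesgue) = (\<integral>\<^sup>+ x. ennreal ((norm (x - grad \<psi> x))\<^sup>2) \<partial>\<mu>)"
    by (subst nn_integral_restrict_space) (auto intro!: nn_integral_cong simp: mult.commute)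
  also have "\<dots> = (\<integral>\<^sup>+ x. ennreal (a x + b (grad \<psi> x)) \<partial>\<mu>)"
    by (rule nn_integral_cong_AE) (use ae in \<open>auto elim!: eventually_mono\<close>)
  also have "\<dots> = ennreal (\<integral>x. a x + b (grad \<psi> x) \<partial>\<mu>)"
    by (rule nn_integral_eq_integral) (use ai bi ae in \<open>auto elim!: eventually_mono simp flip: zero_le_power2\<close>, metis zero_le_power2)
  also have "\<dots> = ennreal (\<integral>p. a (fst p) + b (snd p) \<partial>\<pi>)"
    using ai bi af bs by simp
  also have "\<dots> \<le> (\<integral>\<^sup>+ p. ennreal ((norm (fst p - snd p))\<^sup>2) \<partial>\<pi>)"
    by (rule nn_integral_ge_integral[OF _ le]) (use af bs in auto)
  finally show "(\<integral>\<^sup>+ x. indicator \<Omega> x * ennreal ((norm (x - grad \<psi> x))\<^sup>2) \<partial>lebesgue)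
    \<le> (\<integral>\<^sup>+ p. ennreal ((norm (fst p - snd p))\<^sup>2) \<partial>\<pi>)" .
qed

text \<open>The integrals of the squared norms of \<open>x\<close> and of \<open>S x\<close> are
  determined by the two marginals, so a cost no larger than that of \<open>grad \<psi>\<close> means
  a correlation with \<open>x\<close> no smaller, which is what \<open>transport_unique\<close> asks
  for.\<close>

lemma ot_map_eq_grad:
  assumes p: "pot R \<psi>" and S: "S \<in> borel_measurable \<mu>" and ot: "is_ot_map \<Omega> (push \<psi>) S"
  shows "AE x in \<mu>. S x = grad \<psi> x"
proof -
  note m = grad_measurable[OF pot_convex[OF p]]
  have eq: "distr \<mu> borel S = push \<psi>"
  proof (rule measure_eqI)
    fix A assume "A \<in> sets (distr \<mu> borel S)"
    then have A: "A \<in> sets borel" by simp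
    have "emeasure (distr \<mu> borel S) A = emeasure lebesgue (S -` A \<inter> \<Omega>)"
      using A by (subst emeasure_distr[OF S]) (auto simp: emeasure_restrict_space)
    also have "\<dots> = emeasure (push \<psi>) A" using ot A by (auto simp: is_ot_map_def)
    finally show "emeasure (distr \<mu> borel S) A = emeasure (push \<psi>) A" .
  qed simp
  have intS: "integrable \<mu> (\<lambda>x. f (S x)) \<longleftrightarrow> integrable \<mu> (\<lambda>x. f (grad \<psi> x))"
    and eqS: "(\<integral>x. f (S x) \<partial>\<mu>) = (\<integral>x. f (grad \<psi> x) \<partial>\<mu>)" if f: "f \<in> borel_measurable borel" for f :: "real^3 \<Rightarrow> real"
    using integrable_distr_eq[OF S f] integral_distr[OF S f] integrable_distr_eq[OF m f] integral_distr[OF m f] eq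
    by (auto simp: push_def)
  have cb: "legendre \<psi> \<in> borel_measurable borel" by (rule borel_measurable_continuous_onI[OF legendre_continuous[OF p]])
  have nb: "(\<lambda>y::real^3. (norm y)\<^sup>2) \<in> borel_measurable borel" by simp
  have cn: "continuous_on UNIV (\<lambda>z::(real^3)\<times>(real^3)\<times>real. (norm (fst z))\<^sup>2)"
    "continuous_on UNIV (\<lambda>z::(real^3)\<times>(real^3)\<times>real. (norm (fst (snd z)))\<^sup>2)"
    "continuous_on UNIV (\<lambda>z::(real^3)\<times>(real^3)\<times>real. (norm (fst z - fst (snd z)))\<^sup>2)" by (intro continuous_intros)+
  have i1: "integrable \<mu> (\<lambda>x. (norm x)\<^sup>2)" using continuous_grad_integrable[OF cn(1) p, of 0] by simp
  have i2: "integrable \<mu> (\<lambda>x. (norm (grad \<psi> x))\<^sup>2)" using continuous_grad_integrable[OF cn(2) p, of 0] by simp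
  have i3: "integrable \<mu> (\<lambda>x. (norm (x - grad \<psi> x))\<^sup>2)" using continuous_grad_integrable[OF cn(3) p, of 0] by simp
  have i4: "integrable \<mu> (\<lambda>x. (norm (S x))\<^sup>2)" using intS[OF nb] i2 by simp
  have "AE y in distr \<mu> borel S. norm y \<le> R" unfolding eq by (rule AE_push_norm[OF p])
  then have bS: "AE x in \<mu>. norm (S x) \<le> R" by (subst (asm) AE_distr_iff[OF S]) auto
  have mi: "(\<lambda>x. x \<bullet> S x) \<in> borel_measurable \<mu>"
    using id_measurable_mu S by (rule borel_measurable_inner)
  have i5: "integrable \<mu> (\<lambda>x. x \<bullet> S x)"
  proof (rule integrable_const_bound[OF _ mi, of "r * R"])
    show "AE x in \<mu>. norm (x \<bullet> S x) \<le> r * R"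
      using bS AE_dom
    proof eventually_elim
      case (elim x)
      have "\<bar>x \<bullet> S x\<bar> \<le> norm x * norm (S x)" by (rule Cauchy_Schwarz_ineq2)
      also have "\<dots> \<le> r * R" by (rule mult_mono) (use elim norm_dom r_nonneg in auto)
      finally show ?case by simp
    qed
  qed
  have expand: "(norm (x - y))\<^sup>2 = (norm x)\<^sup>2 + (norm y)\<^sup>2 - 2 * (x \<bullet> y)" for x y :: "real^3"
    by (simp add: power2_norm_eq_inner inner_diff_left inner_diff_right inner_commute)
  have i6: "integrable \<mu> (\<lambda>x. (norm (x - S x))\<^sup>2)" unfolding expand using i1 i4 i5 by simp
  have cpl: "distr \<mu> borel (\<lambda>x. (x, grad \<psi> x)) \<in> couplings (LebOmega \<Omega>) (push \<psi>)"
    unfolding LebOmega_eq push_def by (rule joint_coupling(1)[OF id_measurable_mu m])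
  have "ennreal (\<integral>x. (norm (x - S x))\<^sup>2 \<partial>\<mu>) = (\<integral>\<^sup>+ x. ennreal ((norm (x - S x))\<^sup>2) \<partial>\<mu>)"
    by (rule nn_integral_eq_integral[symmetric, OF i6]) simp
  also have "\<dots> = (\<integral>\<^sup>+ x. indicator \<Omega> x * ennreal ((norm (x - S x))\<^sup>2) \<partial>lebesgue)"
    by (subst nn_integral_restrict_space) (auto intro!: nn_integral_cong simp: mult.commute)
  also have "\<dots> \<le> (\<integral>\<^sup>+ p. ennreal ((norm (fst p - snd p))\<^sup>2) \<partial>distr \<mu> borel (\<lambda>x. (x, grad \<psi> x)))"
    using ot cpl unfolding is_ot_map_def by blast
  also have "\<dots> = (\<integral>\<^sup>+ x. ennreal ((norm (x - grad \<psi> x))\<^sup>2) \<partial>\<mu>)"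
    by (rule joint_coupling(2)[OF id_measurable_mu m])
  also have "\<dots> = ennreal (\<integral>x. (norm (x - grad \<psi> x))\<^sup>2 \<partial>\<mu>)"
    by (rule nn_integral_eq_integral[OF i3]) simp
  finally have "(\<integral>x. (norm (x - S x))\<^sup>2 \<partial>\<mu>) \<le> (\<integral>x. (norm (x - grad \<psi> x))\<^sup>2 \<partial>\<mu>)"
    by (subst (asm) ennreal_le_iff) auto
  then have "(\<integral>x. x \<bullet> grad \<psi> x \<partial>\<mu>) \<le> (\<integral>x. x \<bullet> S x \<partial>\<mu>)"
    unfolding expand using i1 i2 i4 i5 integrable_inner_grad[OF p] eqS[OF nb] by simp
  then show ?thesis
    using intS[OF cb] integrable_legendre_grad[OF p p] by (intro transport_unique[OF p _ i5 eqS[OF cb]]) auto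
qed

text \<open>Any candidate has the same gradient almost everywhere by \<open>ot_map_eq_grad\<close>,
  so it differs from \<psi> by a constant on the domain, and the zero means make this constant 0.
  Cutting off outside the domain matches the normalisation in \<open>is_brenier\<close>.\<close>

lemma brenier_push:
  assumes p: "pot R \<psi>" shows "brenier \<Omega> (push \<psi>) = (\<lambda>x. if x \<in> \<Omega> then \<psi> x else 0)"
  unfolding brenier_def
proof (rule the_equality)
  let ?\<psi> = "\<lambda>x. if x \<in> \<Omega> then \<psi> x else 0"
  have g: "grad ?\<psi> x = grad \<psi> x" if "x \<in> \<Omega>" for x
    by (rule grad_cong_open[OF open_dom that]) simp
  show "is_brenier \<Omega> (push \<psi>) ?\<psi>"
    unfolding is_brenier_def
  proof (intro conjI)
    show "convex_on \<Omega> ?\<psi>" using pot_convex[OF p] by (simp add: convex_on_def convex_def)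
    have sq: "integrable \<mu> (\<lambda>x. (\<psi> x)\<^sup>2)"
    proof (rule integrable_const_bound[of _ "(2 * r * R)\<^sup>2"])
      show "AE x in \<mu>. norm ((\<psi> x)\<^sup>2) \<le> (2 * r * R)\<^sup>2"
        using AE_dom
      proof eventually_elim
        case (elim x)
        then have "\<bar>\<psi> x\<bar> \<le> 2 * r * R" using closure_subset by (intro pot_bound[OF p]) auto
        then have "\<bar>\<psi> x\<bar>\<^sup>2 \<le> (2 * r * R)\<^sup>2" by (intro power_mono) auto
        then show ?case by simp
      qed
    qed (use pot_measurable[OF p] in simp)
    show "integrable \<mu> (\<lambda>x. (?\<psi> x)\<^sup>2)"
      by (rule Bochner_Integration.integrable_cong[THEN iffD1, OF refl _ sq]) auto
    have "continuous_on UNIV (\<lambda>z::(real^3)\<times>(real^3)\<times>real. (norm (fst (snd z)))\<^sup>2)" by (intro continuous_intros)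
    from continuous_grad_integrable[OF this p, of 0] have "integrable \<mu> (\<lambda>x. (norm (grad \<psi> x))\<^sup>2)" by simp
    then show "integrable \<mu> (\<lambda>x. (norm (grad ?\<psi> x))\<^sup>2)"
      by (rule Bochner_Integration.integrable_cong[THEN iffD1, OF refl, rotated]) (use g in auto)
    have "(\<integral>x. ?\<psi> x \<partial>\<mu>) = (\<integral>x. \<psi> x \<partial>\<mu>)" by (rule Bochner_Integration.integral_cong) auto
    then show "(\<integral>x. ?\<psi> x \<partial>\<mu>) = 0" using p by (simp add: pot_def)
    show "is_ot_map \<Omega> (push \<psi>) (grad ?\<psi>)"
      using is_ot_map_cong[of \<Omega> "grad ?\<psi>" "grad \<psi>"] g grad_is_ot_map[OF p] by blast
  qed auto
next
  fix \<phi> assume \<phi>: "is_brenier \<Omega> (push \<psi>) \<phi>"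
  then have c: "convex_on \<Omega> \<phi>" by (simp add: is_brenier_def)
  have "AE x in \<mu>. grad \<phi> x = grad \<psi> x"
    by (rule ot_map_eq_grad[OF p grad_measurable[OF c]]) (use \<phi> in \<open>simp add: is_brenier_def\<close>)
  then obtain k where k: "\<And>x. x \<in> \<Omega> \<Longrightarrow> \<phi> x = \<psi> x + k"
    using AE_grad_eq_imp_const[OF c pot_convex[OF p]] by blast
  have "(\<integral>x. \<phi> x \<partial>\<mu>) = (\<integral>x. \<psi> x + k \<partial>\<mu>)"
    by (rule Bochner_Integration.integral_cong) (use k in auto)
  then have "k = 0" using \<phi> p pot_integrable[OF p] prob_space by (simp add: pot_def is_brenier_def)
  then show "\<phi> = (\<lambda>x. if x \<in> \<Omega> then \<psi> x else 0)" using k \<phi> by (auto simp: is_brenier_def)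
qed

lemma grad_brenier_push:
  assumes "pot R \<psi>" "x \<in> \<Omega>" shows "grad (brenier \<Omega> (push \<psi>)) x = grad \<psi> x"
  unfolding brenier_push[OF assms(1)] by (rule grad_cong_open[OF open_dom assms(2)]) simp

section \<open>Compactness of the set of potentials\<close>

lemma pot_subsequence:
  assumes F: "\<And>n. pot R (F n)"
  obtains k \<psi> where "strict_mono (k :: nat \<Rightarrow> nat)" "pot R \<psi>"
    "\<forall>e>0. \<exists>N. \<forall>n\<ge>N. \<forall>x\<in>closure \<Omega>. \<bar>F (k n) x - \<psi> x\<bar> < e"
    "\<forall>x\<in>closure \<Omega>. (\<lambda>n. F (k n) x) \<longlonglongrightarrow> \<psi> x"
proof -
  have R: "R \<ge> 0" by (rule pot_nonneg[OF F])
  obtain \<psi> k where *: "strict_mono (k :: nat \<Rightarrow> nat)"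
    "\<And>e. 0 < e \<Longrightarrow> \<exists>N. \<forall>n x. n \<ge> N \<and> x \<in> closure \<Omega> \<longrightarrow> norm (F (k n) x - \<psi> x) < e"
  proof (rule Arzela_Ascoli[of "closure \<Omega>" F "2 * r * R"])
    show "compact (closure \<Omega>)" by (rule compact_closure_dom)
    show "norm (F n x) \<le> 2 * r * R" if "x \<in> closure \<Omega>" for n x using pot_bound[OF F that] by simp
    show "\<exists>d>0. \<forall>n y. y \<in> closure \<Omega> \<and> norm (x - y) < d \<longrightarrow> norm (F n x - F n y) < e"
      if x: "x \<in> closure \<Omega>" and e: "e > 0" for x e
    proof (intro exI[of _ "e / (R + 1)"] conjI allI impI)
      show "e / (R + 1) > 0" using e R by simp
      fix n y assume y: "y \<in> closure \<Omega> \<and> norm (x - y) < e / (R + 1)"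
      have "\<bar>F n x - F n y\<bar> \<le> R * norm (x - y)" using y by (intro pot_lipschitz[OF F x]) auto
      also have "\<dots> \<le> (R + 1) * norm (x - y)" by (simp add: algebra_simps)
      also have "\<dots> < e" using y R by (simp add: field_simps)
      finally show "norm (F n x - F n y) < e" by simp
    qed
  qed (use that in blast)
  have conv: "(\<lambda>n. F (k n) x) \<longlonglongrightarrow> \<psi> x" if "x \<in> closure \<Omega>" for x
    unfolding LIMSEQ_def dist_norm using *(2) that by meson
  show ?thesis
  proof (rule that[OF *(1)])
    show "pot R \<psi>" by (rule pot_limit[of R "\<lambda>n. F (k n)", OF F conv])
    show "\<forall>e>0. \<exists>N. \<forall>n\<ge>N. \<forall>x\<in>closure \<Omega>. \<bar>F (k n) x - \<psi> x\<bar> < e"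
      using *(2) unfolding real_norm_def by meson
  qed (use conv in auto)
qed

text \<open>The moments depend continuously and injectively on the potential, and the set of
  potentials is compact, so the inverse is uniformly continuous. As a contradiction: two sequences
  with ever closer moments but a persistent gap would have subsequences with distinct limits of
  equal moments. The \<open>d\<close> obtained serves all potentials with bound
  \<open>R\<close>.\<close>

lemma pot_modulus:
  assumes e: "e > 0"
  obtains d where "d > 0"
    "\<And>\<psi> \<xi> x. pot R \<psi> \<Longrightarrow> pot R \<xi> \<Longrightarrow>
      (\<And>f :: real^3 \<Rightarrow> real. 1-lipschitz_on UNIV f \<Longrightarrow> \<bar>(\<integral>x. f (grad \<psi> x) \<partial>\<mu>) - (\<integral>x. f (grad \<xi> x) \<partial>\<mu>)\<bar> \<le> d) \<Longrightarrow>
      x \<in> closure \<Omega> \<Longrightarrow> \<bar>\<psi> x - \<xi> x\<bar> < e"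
proof (rule ccontr)
  assume no: "\<not> thesis"
  have "\<exists>\<psi> \<xi> x. pot R \<psi> \<and> pot R \<xi> \<and> x \<in> closure \<Omega> \<and> \<bar>\<psi> x - \<xi> x\<bar> \<ge> e \<and>
    (\<forall>f :: real^3 \<Rightarrow> real. 1-lipschitz_on UNIV f \<longrightarrow> \<bar>(\<integral>x. f (grad \<psi> x) \<partial>\<mu>) - (\<integral>x. f (grad \<xi> x) \<partial>\<mu>)\<bar> \<le> 1 / real (Suc n))" for n
  proof (rule ccontr)
    assume "\<not> ?thesis"
    then show False using no that[of "1 / real (Suc n)"] by (simp del: of_nat_Suc) (metis not_less)
  qed
  then obtain P Q X where P: "\<And>n. pot R (P n)" and Q: "\<And>n. pot R (Q n)" and X: "\<And>n. X n \<in> closure \<Omega>"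
    "\<And>n. \<bar>P n (X n) - Q n (X n)\<bar> \<ge> e"
    and close: "\<And>n f. 1-lipschitz_on UNIV (f :: real^3 \<Rightarrow> real) \<Longrightarrow> \<bar>(\<integral>x. f (grad (P n) x) \<partial>\<mu>) - (\<integral>x. f (grad (Q n) x) \<partial>\<mu>)\<bar> \<le> 1 / real (Suc n)"
    by metis
  obtain k1 \<psi> where k1: "strict_mono k1" "pot R \<psi>"
    "\<forall>e>0. \<exists>N. \<forall>n\<ge>N. \<forall>x\<in>closure \<Omega>. \<bar>P (k1 n) x - \<psi> x\<bar> < e"
    "\<forall>x\<in>closure \<Omega>. (\<lambda>n. P (k1 n) x) \<longlonglongrightarrow> \<psi> x"
    using pot_subsequence[of R P, OF P] by blast
  obtain k2 \<xi> where k2: "strict_mono k2" "pot R \<xi>"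
    "\<forall>e>0. \<exists>N. \<forall>n\<ge>N. \<forall>x\<in>closure \<Omega>. \<bar>Q (k1 (k2 n)) x - \<xi> x\<bar> < e"
    "\<forall>x\<in>closure \<Omega>. (\<lambda>n. Q (k1 (k2 n)) x) \<longlonglongrightarrow> \<xi> x"
    using pot_subsequence[of R "\<lambda>n. Q (k1 n)", OF Q] by blast
  let ?k = "\<lambda>n. k1 (k2 n)"
  have k: "strict_mono ?k" using k1(1) k2(1) by (simp add: strict_mono_def)
  have cO: "x \<in> closure \<Omega>" if "x \<in> \<Omega>" for x using that closure_subset by auto
  have same: "(\<integral>x. f (grad \<psi> x) \<partial>\<mu>) = (\<integral>x. f (grad \<xi> x) \<partial>\<mu>)" if f: "1-lipschitz_on UNIV f" for f :: "real^3 \<Rightarrow> real"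
  proof -
    have cf: "continuous_on UNIV (\<lambda>z::(real^3)\<times>(real^3)\<times>real. f (fst (snd z)))"
      by (rule continuous_on_compose2[OF lipschitz_on_continuous_on[OF f]]) (auto intro!: continuous_intros)
    have "(\<lambda>n. \<integral>x. f (grad (P (?k n)) x) \<partial>\<mu>) \<longlonglongrightarrow> (\<integral>x. f (grad \<psi> x) \<partial>\<mu>)"
      using integral_grad_tendsto[OF cf, of R "\<lambda>n. P (?k n)" \<psi> "\<lambda>_. 0" 0] P k1(2) LIMSEQ_subseq_LIMSEQ[OF k1(4)[rule_format, OF cO] k2(1)]
      by (simp add: comp_def)
    moreover have "(\<lambda>n. \<integral>x. f (grad (Q (?k n)) x) \<partial>\<mu>) \<longlonglongrightarrow> (\<integral>x. f (grad \<xi> x) \<partial>\<mu>)"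
      using integral_grad_tendsto[OF cf, of R "\<lambda>n. Q (?k n)" \<xi> "\<lambda>_. 0" 0] Q k2(2) k2(4)[rule_format, OF cO] by simp
    ultimately have "(\<lambda>n. \<bar>(\<integral>x. f (grad (P (?k n)) x) \<partial>\<mu>) - (\<integral>x. f (grad (Q (?k n)) x) \<partial>\<mu>)\<bar>) \<longlonglongrightarrow> \<bar>(\<integral>x. f (grad \<psi> x) \<partial>\<mu>) - (\<integral>x. f (grad \<xi> x) \<partial>\<mu>)\<bar>"
      by (intro tendsto_intros)
    moreover have "(\<lambda>n. 1 / real (Suc (?k n))) \<longlonglongrightarrow> 0"
      using LIMSEQ_subseq_LIMSEQ[OF LIMSEQ_Suc[OF lim_1_over_n[where 'a=real]] k] by (simp add: comp_def del: of_nat_Suc)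
    ultimately have "\<bar>(\<integral>x. f (grad \<psi> x) \<partial>\<mu>) - (\<integral>x. f (grad \<xi> x) \<partial>\<mu>)\<bar> \<le> 0"
      by (rule LIMSEQ_le) (use close[OF f] in blast)
    then show ?thesis by simp
  qed
  \<comment> \<open>Closeness was assumed for 1-Lipschitz test functions, but Legendre transforms
    are \<open>r\<close>-Lipschitz. Dividing by \<open>r + 1\<close> rescales them and is also safe
    for \<open>r = 0\<close>.\<close>
  have same_r: "(\<integral>x. f (grad \<psi> x) \<partial>\<mu>) = (\<integral>x. f (grad \<xi> x) \<partial>\<mu>)" if f: "r-lipschitz_on UNIV f" for f :: "real^3 \<Rightarrow> real"
  proof -
    have "1-lipschitz_on UNIV (\<lambda>y. f y / (r + 1))"
    proof (rule lipschitz_onI)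
      fix y z :: "real^3"
      have "\<bar>f y - f z\<bar> \<le> r * dist y z" using lipschitz_onD[OF f, of y z] by (simp add: dist_norm)
      also have "\<dots> \<le> (r + 1) * dist y z" by (simp add: algebra_simps)
      finally show "dist (f y / (r + 1)) (f z / (r + 1)) \<le> 1 * dist y z"
        using r_nonneg by (simp add: dist_real_def field_simps flip: diff_divide_distrib)
    qed simp
    from same[OF this] show ?thesis using r_nonneg by simp
  qed
  have eq: "\<psi> x = \<xi> x" if "x \<in> closure \<Omega>" for x
    by (rule pots_eq_if_same_moments[OF k1(2) k2(2) same_r that])
  obtain N1 where N1: "\<And>n x. n \<ge> N1 \<Longrightarrow> x \<in> closure \<Omega> \<Longrightarrow> \<bar>P (k1 n) x - \<psi> x\<bar> < e / 2" using k1(3)[rule_format, of "e/2"] e by auto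
  obtain N2 where N2: "\<And>n x. n \<ge> N2 \<Longrightarrow> x \<in> closure \<Omega> \<Longrightarrow> \<bar>Q (?k n) x - \<xi> x\<bar> < e / 2" using k2(3)[rule_format, of "e/2"] e by auto
  define n where "n = max N1 N2"
  have "k2 n \<ge> N1" using seq_suble[OF k2(1), of n] by (simp add: n_def)
  then have "\<bar>P (?k n) (X (?k n)) - \<psi> (X (?k n))\<bar> < e / 2" by (intro N1 X)
  moreover have "\<bar>Q (?k n) (X (?k n)) - \<xi> (X (?k n))\<bar> < e / 2" by (intro N2 X) (simp add: n_def)
  ultimately show False using X(2)[of "?k n"] eq[OF X(1)[of "?k n"]] by linarith
qed

end

section \<open>Semi-discrete optimal transport\<close>

text \<open>Bolzano-Weierstrass for finite tuples, encoded as functions of which only the indices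
  below \<open>N\<close> count; the sequence is thinned once for each coordinate.\<close>

lemma finite_index_subsequence:
  fixes w :: "nat \<Rightarrow> nat \<Rightarrow> real"
  assumes "\<And>k i. i < N \<Longrightarrow> \<bar>w k i\<bar> \<le> B i"
  shows "\<exists>s l. strict_mono (s :: nat \<Rightarrow> nat) \<and> (\<forall>i<N. (\<lambda>k. w (s k) i) \<longlonglongrightarrow> l i)"
  using assms
proof (induction N)
  case 0
  show ?case by (rule exI[of _ id]) (simp add: strict_mono_def)
next
  case (Suc N)
  then obtain s l where s: "strict_mono (s :: nat \<Rightarrow> nat)" "\<forall>i<N. (\<lambda>k. w (s k) i) \<longlonglongrightarrow> l i"
    by (auto simp: less_Suc_eq)
  have "bounded (range (\<lambda>k. w (s k) N))"
    using Suc.prems by (intro boundedI[of _ "B N"]) auto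
  from bounded_imp_convergent_subsequence[OF this]
  obtain a q where q: "strict_mono (q :: nat \<Rightarrow> nat)" "(\<lambda>k. w (s (q k)) N) \<longlonglongrightarrow> a" by (auto simp: comp_def)
  have "(\<lambda>k. w (s (q k)) i) \<longlonglongrightarrow> (l(N := a)) i" if "i < Suc N" for i
  proof (cases "i = N")
    case False
    then have "(\<lambda>k. w (s k) i) \<longlonglongrightarrow> l i" using s that by auto
    from LIMSEQ_subseq_LIMSEQ[OF this q(1)] False show ?thesis by (simp add: comp_def)
  qed (use q in simp)
  moreover have "strict_mono (\<lambda>k. s (q k))" using s(1) q(1) by (simp add: strict_mono_def)
  ultimately show ?case by blast
qed

text \<open>A discrete Legendre transform: \<open>w\<close> holds the values of the dual variable at
  the points \<open>z i\<close>, and the region where index \<open>i\<close> attains the maximum is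
  the Laguerre cell of \<open>z i\<close>.\<close>

definition maff :: "nat \<Rightarrow> (nat \<Rightarrow> real^3) \<Rightarrow> (nat \<Rightarrow> real) \<Rightarrow> real^3 \<Rightarrow> real" where
  "maff N z w x = Max ((\<lambda>i. x \<bullet> z i - w i) ` {..<N})"

lemma maff_ge: "i < N \<Longrightarrow> x \<bullet> z i - w i \<le> maff N z w x"
  unfolding maff_def by (rule Max_ge) auto

lemma maff_le: "N > 0 \<Longrightarrow> (\<And>i. i < N \<Longrightarrow> x \<bullet> z i - w i \<le> c) \<Longrightarrow> maff N z w x \<le> c"
  unfolding maff_def by (subst Max_le_iff) auto

lemma maff_attained: "N > 0 \<Longrightarrow> \<exists>i<N. maff N z w x = x \<bullet> z i - w i"
proof -
  assume "N > 0"
  then have "maff N z w x \<in> (\<lambda>i. x \<bullet> z i - w i) ` {..<N}"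
    unfolding maff_def by (intro Max_in) auto
  then show ?thesis by auto
qed

lemma convex_on_maff:
  assumes N: "N > 0" shows "convex_on UNIV (maff N z w)"
proof (rule convex_onI)
  fix t :: real and x y assume t: "0 < t" "t < 1"
  show "maff N z w ((1 - t) *\<^sub>R x + t *\<^sub>R y) \<le> (1 - t) * maff N z w x + t * maff N z w y"
  proof (rule maff_le[OF N])
    fix i assume i: "i < N"
    have "((1 - t) *\<^sub>R x + t *\<^sub>R y) \<bullet> z i - w i = (1 - t) * (x \<bullet> z i - w i) + t * (y \<bullet> z i - w i)"
      by (simp add: inner_add_left algebra_simps)
    also have "\<dots> \<le> (1 - t) * maff N z w x + t * maff N z w y"
      using t by (intro add_mono mult_left_mono maff_ge[OF i]) auto
    finally show "((1 - t) *\<^sub>R x + t *\<^sub>R y) \<bullet> z i - w i \<le> (1 - t) * maff N z w x + t * maff N z w y" .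
  qed
qed simp

lemma maff_lipschitz:
  assumes N: "N > 0" and R: "\<And>i. i < N \<Longrightarrow> norm (z i) \<le> R"
  shows "R-lipschitz_on S (maff N z w)"
proof (rule lipschitz_onI)
  have le: "maff N z w x \<le> maff N z w y + R * norm (x - y)" for x y
  proof (rule maff_le[OF N])
    fix i assume i: "i < N"
    have "x \<bullet> z i - w i = (y \<bullet> z i - w i) + (x - y) \<bullet> z i" by (simp add: inner_diff_left)
    also have "(x - y) \<bullet> z i \<le> norm (x - y) * norm (z i)" by (rule norm_cauchy_schwarz)
    also have "\<dots> \<le> norm (x - y) * R" by (intro mult_left_mono R i) auto
    finally show "x \<bullet> z i - w i \<le> maff N z w y + R * norm (x - y)"
      using maff_ge[OF i, of y z w] by (simp add: mult.commute)
  qed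
  show "dist (maff N z w x) (maff N z w y) \<le> R * dist x y" for x y
    using le[of x y] le[of y x] by (simp add: dist_norm norm_minus_commute abs_le_iff)
  show "0 \<le> R" using R[OF N] norm_ge_zero order_trans by blast
qed

lemma maff_diff_le:
  assumes N: "N > 0"
  shows "maff N z v x \<le> maff N z w x + (\<Sum>i<N. \<bar>v i - w i\<bar>)"
proof (rule maff_le[OF N])
  fix i assume i: "i < N"
  have "\<bar>v i - w i\<bar> \<le> (\<Sum>i<N. \<bar>v i - w i\<bar>)" by (rule member_le_sum) (use i in auto)
  then show "x \<bullet> z i - v i \<le> maff N z w x + (\<Sum>i<N. \<bar>v i - w i\<bar>)"
    using maff_ge[OF i, of x z w] by linarith
qed

lemma maff_shift: "N > 0 \<Longrightarrow> maff N z (\<lambda>i. w i + c) = (\<lambda>x. maff N z w x - c)"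
proof (intro ext antisym)
  fix x assume N: "N > 0"
  show "maff N z (\<lambda>i. w i + c) x \<le> maff N z w x - c"
    by (rule maff_le[OF N]) (use maff_ge[of _ N x z w] in \<open>simp add: algebra_simps\<close>)
  have "maff N z w x \<le> maff N z (\<lambda>i. w i + c) x + c"
    by (rule maff_le[OF N]) (use maff_ge[of _ N x z "\<lambda>i. w i + c"] in \<open>simp add: algebra_simps\<close>)
  then show "maff N z w x - c \<le> maff N z (\<lambda>i. w i + c) x" by simp
qed

context unit_domain
begin

lemma integrable_maff: assumes N: "N > 0" shows "integrable \<mu> (maff N z w)"
proof (rule integrable_mu_continuous)
  have "(Max ((\<lambda>i. norm (z i)) ` {..<N}))-lipschitz_on (closure \<Omega>) (maff N z w)"
    by (rule maff_lipschitz[OF N]) auto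
  then show "continuous_on (closure \<Omega>) (maff N z w)" by (rule lipschitz_on_continuous_on)
qed

text \<open>As the masses sum to 1, \<open>G\<close> is invariant under adding a constant to
  \<open>w\<close>, so the smallest weight may be taken to be 0. The affine function with this
  weight bounds the integral below by \<open>- (r * R)\<close>, and then \<open>m j > 0\<close>
  bounds every other weight along a minimising sequence.\<close>

lemma semidiscrete_minimiser:
  fixes m :: "nat \<Rightarrow> real" and z :: "nat \<Rightarrow> real^3"
  assumes m: "\<And>i. i < N \<Longrightarrow> m i > 0" and sum: "(\<Sum>i<N. m i) = 1"
  defines "G \<equiv> \<lambda>w. (\<integral>x. maff N z w x \<partial>\<mu>) + (\<Sum>i<N. m i * w i)"
  shows "\<exists>w. \<forall>v. G w \<le> G v"
proof -
  have N: "N > 0" using sum by (cases N) auto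
  define R where "R = Max ((\<lambda>i. norm (z i)) ` {..<N})"
  have R: "norm (z i) \<le> R" if "i < N" for i unfolding R_def using that by (intro Max_ge) auto
  have Gshift: "G (\<lambda>i. w i + c) = G w" for w c
  proof -
    have "(\<Sum>i<N. m i * (w i + c)) = (\<Sum>i<N. m i * w i) + c"
      using sum by (simp add: distrib_left sum.distrib sum_distrib_right[symmetric])
    then show ?thesis
      unfolding G_def using integrable_maff[OF N] prob_space by (simp add: maff_shift[OF N])
  qed
  have norm: "\<exists>v. G v = G w \<and> (\<forall>i<N. v i \<ge> 0) \<and> (\<exists>i<N. v i = 0)" for w
  proof -
    define c where "c = Min (w ` {..<N})"
    have "c \<in> w ` {..<N}" unfolding c_def by (rule Min_in) (use N in auto)
    then have "\<exists>i<N. w i = c" by auto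
    moreover have "c \<le> w i" if "i < N" for i unfolding c_def using that by (intro Min_le) auto
    ultimately show ?thesis using Gshift[of w "-c"] by (intro exI[of _ "\<lambda>i. w i + -c"]) auto
  qed
  have low: "G v \<ge> - (r * R) + m j * v j" if v: "\<forall>i<N. v i \<ge> 0" "\<exists>i<N. v i = 0" and j: "j < N" for v j
  proof -
    obtain i where i: "i < N" "v i = 0" using v by auto
    have "- (r * R) \<le> maff N z v x" if x: "x \<in> \<Omega>" for x
    proof -
      have "\<bar>x \<bullet> z i\<bar> \<le> norm x * norm (z i)" by (rule Cauchy_Schwarz_ineq2)
      also have "\<dots> \<le> r * R" using norm_dom[OF x] R[OF i(1)] r_nonneg by (intro mult_mono) auto
      finally show ?thesis using maff_ge[OF i(1), of x z v] i by simp
    qed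
    then have "(\<integral>x. - (r * R) \<partial>\<mu>) \<le> (\<integral>x. maff N z v x \<partial>\<mu>)"
      using integrable_maff[OF N] AE_dom by (intro integral_mono_AE) (auto elim!: eventually_mono)
    moreover have "m j * v j \<le> (\<Sum>i<N. m i * v i)"
      by (rule member_le_sum[of j "{..<N}" "\<lambda>i. m i * v i"]) (use j v less_imp_le[OF m] in auto)
    ultimately show ?thesis using prob_space by (simp add: G_def)
  qed
  have lowG: "G w \<ge> - (r * R)" for w
  proof -
    obtain v where v: "G v = G w" "\<forall>i<N. v i \<ge> 0" "\<exists>i<N. v i = 0" using norm by blast
    have "0 \<le> m 0 * v 0" using v m[OF N] N by simp
    then show ?thesis using low[OF v(2,3) N] v(1) by linarith
  qed
  define I where "I = Inf (range G)"
  have bdd: "bdd_below (range G)" by (rule bdd_belowI2[OF lowG])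
  have I_le: "I \<le> G v" for v unfolding I_def by (rule cInf_lower[OF _ bdd]) simp
  have "\<exists>v. G v < I + 1 / real (Suc k) \<and> (\<forall>i<N. v i \<ge> 0) \<and> (\<exists>i<N. v i = 0)" for k
  proof -
    have "Inf (range G) < I + 1 / real (Suc k)" by (simp add: I_def)
    from cInf_lessD[OF _ this] obtain w where "G w < I + 1 / real (Suc k)" by auto
    with norm[of w] show ?thesis by metis
  qed
  then obtain V where V: "\<And>k. G (V k) < I + 1 / real (Suc k)" "\<And>k. \<forall>i<N. V k i \<ge> 0" "\<And>k. \<exists>i<N. V k i = 0"
    by metis
  have "\<bar>V k i\<bar> \<le> (I + 1 + r * R) / m i" if i: "i < N" for k i
  proof -
    have "1 / real (Suc k) \<le> 1" by simp
    then have "m i * V k i \<le> I + 1 + r * R" using low[OF V(2,3) i, of k] V(1)[of k] by linarith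
    then show ?thesis using m[OF i] V(2)[of k] i by (simp add: field_simps)
  qed
  from finite_index_subsequence[of N V "\<lambda>i. (I + 1 + r * R) / m i", OF this]
  obtain s l where s: "strict_mono (s :: nat \<Rightarrow> nat)" "\<forall>i<N. (\<lambda>k. V (s k) i) \<longlonglongrightarrow> l i" by blast
  have Gl: "G l \<le> I + 1 / real (Suc (s k)) + (\<Sum>i<N. (1 + m i) * \<bar>V (s k) i - l i\<bar>)" for k
  proof -
    have "(\<integral>x. maff N z l x \<partial>\<mu>) \<le> (\<integral>x. maff N z (V (s k)) x + (\<Sum>i<N. \<bar>l i - V (s k) i\<bar>) \<partial>\<mu>)"
      using integrable_maff[OF N] by (intro integral_mono) (auto intro: maff_diff_le[OF N])
    also have "\<dots> = (\<integral>x. maff N z (V (s k)) x \<partial>\<mu>) + (\<Sum>i<N. \<bar>V (s k) i - l i\<bar>)"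
      using integrable_maff[OF N] prob_space by (simp add: abs_minus_commute)
    finally have "(\<integral>x. maff N z l x \<partial>\<mu>) \<le> (\<integral>x. maff N z (V (s k)) x \<partial>\<mu>) + (\<Sum>i<N. \<bar>V (s k) i - l i\<bar>)" .
    moreover have "(\<Sum>i<N. m i * l i) \<le> (\<Sum>i<N. m i * V (s k) i + m i * \<bar>V (s k) i - l i\<bar>)"
    proof (rule sum_mono)
      fix i assume "i \<in> {..<N}"
      then have "m i * l i \<le> m i * (V (s k) i + \<bar>V (s k) i - l i\<bar>)" using m[of i] by (intro mult_left_mono) auto
      then show "m i * l i \<le> m i * V (s k) i + m i * \<bar>V (s k) i - l i\<bar>" by (simp add: distrib_left)
    qed
    ultimately have "G l \<le> G (V (s k)) + (\<Sum>i<N. (1 + m i) * \<bar>V (s k) i - l i\<bar>)"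
      unfolding G_def by (simp add: sum.distrib distrib_right)
    then show ?thesis using V(1)[of "s k"] by linarith
  qed
  have "(\<lambda>k. I + 1 / real (Suc (s k)) + (\<Sum>i<N. (1 + m i) * \<bar>V (s k) i - l i\<bar>)) \<longlonglongrightarrow> I + 0 + (\<Sum>i<N. (1 + m i) * \<bar>l i - l i\<bar>)"
    using LIMSEQ_subseq_LIMSEQ[OF LIMSEQ_Suc[OF lim_1_over_n[where 'a=real]] s(1)] s(2)
    by (intro tendsto_intros) (auto simp: comp_def simp del: of_nat_Suc)
  then have "G l \<le> I" using LIMSEQ_le_const[of _ _ "G l"] Gl by fastforce
  then have "\<forall>v. G l \<le> G v" using I_le order_trans by blast
  then show ?thesis by blast
qed

text \<open>A tie confines \<open>x\<close> to a hyperplane with normal \<open>z i - z j\<close>,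
  which is not 0.\<close>

lemma AE_no_ties:
  fixes N :: nat and z :: "nat \<Rightarrow> real^3"
  assumes z: "inj_on z {..<N}"
  shows "AE x in \<mu>. \<forall>i<N. \<forall>j<N. i \<noteq> j \<longrightarrow> x \<bullet> z i - w i \<noteq> x \<bullet> z j - w j"
proof -
  have "AE x in lebesgue. x \<bullet> z i - w i \<noteq> x \<bullet> z j - w j" if "i < N" "j < N" "i \<noteq> j" for i j
  proof -
    have "z i - z j \<noteq> 0" using z that by (auto simp: inj_on_def)
    then have "negligible {x. (z i - z j) \<bullet> x = w i - w j}" by (intro negligible_hyperplane) auto
    then have "AE x in lebesgue. x \<notin> {x. (z i - z j) \<bullet> x = w i - w j}"
      by (intro AE_not_in) (simp add: negligible_iff_null_sets)
    then show ?thesis by eventually_elim (auto simp: inner_diff_left inner_commute algebra_simps)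
  qed
  then have "AE x in lebesgue. \<forall>i\<in>{..<N}. \<forall>j\<in>{..<N}. i \<noteq> j \<longrightarrow> x \<bullet> z i - w i \<noteq> x \<bullet> z j - w j"
    by (intro AE_finite_allI) auto
  then show ?thesis unfolding AE_mu_iff by eventually_elim auto
qed

text \<open>Minimality only gives that each cell has at most its prescribed mass; since the cells fill \<open>\<Omega>\<close>,
  all these inequalities are equalities.\<close>

lemma semidiscrete_exists:
  fixes m :: "nat \<Rightarrow> real"
  assumes m: "\<And>i. i < N \<Longrightarrow> m i > 0" and sum: "(\<Sum>i<N. m i) = 1" and z: "inj_on z {..<N}"
  shows "\<exists>w. (\<integral>x. maff N z w x \<partial>\<mu>) = 0 \<and>
    (\<forall>i<N. measure \<mu> {x \<in> \<Omega>. grad (maff N z w) x = z i} = m i) \<and>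
    (AE x in \<mu>. \<exists>i<N. grad (maff N z w) x = z i \<and> maff N z w x = x \<bullet> z i - w i)"
proof -
  have N: "N > 0" using sum by (cases N) auto
  obtain w0 where w0: "\<And>v. (\<integral>x. maff N z w0 x \<partial>\<mu>) + (\<Sum>i<N. m i * w0 i) \<le> (\<integral>x. maff N z v x \<partial>\<mu>) + (\<Sum>i<N. m i * v i)"
    using semidiscrete_minimiser[OF m sum] by blast
  \<comment> \<open>Adding \<open>c\<close> to all weights lowers the potential by \<open>c\<close>,
    so shifting by the mean gives zero mean. Minimality survives because the masses sum to
    1.\<close>
  define w where "w i = w0 i + (\<integral>x. maff N z w0 x \<partial>\<mu>)" for i
  have mean: "(\<integral>x. maff N z w x \<partial>\<mu>) = 0"
    unfolding w_def using integrable_maff[OF N] prob_space by (simp add: maff_shift[OF N])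
  have "(\<Sum>i<N. m i * w i) = (\<Sum>i<N. m i * w0 i) + (\<integral>x. maff N z w0 x \<partial>\<mu>)"
    using sum by (simp add: w_def distrib_left sum.distrib sum_distrib_right[symmetric])
  then have min: "(\<Sum>i<N. m i * w i) \<le> (\<integral>x. maff N z v x \<partial>\<mu>) + (\<Sum>i<N. m i * v i)" for v
    using w0[of v] by simp
  \<comment> \<open>The part of the cell where index \<open>i\<close> wins by a margin of at least
    \<open>h\<close>. Raising \<open>w i\<close> by \<open>h\<close> lowers the maximum by at least
    \<open>h\<close> there and raises it nowhere, so minimality is exploited by finite differences
    without differentiating the functional. As \<open>h\<close> decreases to 0 these sets exhaust
    the strict cell \<open>D i\<close>.\<close>
  define C where "C i h = {x \<in> \<Omega>. \<forall>j<N. j \<noteq> i \<longrightarrow> x \<bullet> z j - w j \<le> x \<bullet> z i - w i - h}" for i h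
  define D where "D i = {x \<in> \<Omega>. \<forall>j<N. j \<noteq> i \<longrightarrow> x \<bullet> z j - w j < x \<bullet> z i - w i}" for i
  have D_eq: "D i = \<Omega> \<inter> (\<Inter>j\<in>{j. j < N \<and> j \<noteq> i}. {x. x \<bullet> z j - w j < x \<bullet> z i - w i})" for i
    by (auto simp: D_def)
  have D_open: "open (D i)" for i
    unfolding D_eq by (intro open_Int open_dom open_INT ballI open_Collect_less continuous_intros) auto
  have sets_mu: "A \<in> sets \<mu>" if "A \<in> sets borel" "A \<subseteq> \<Omega>" for A
    using that by (simp add: sets_restrict_space_iff)
  have C_eq: "C i h = \<Omega> \<inter> (\<Inter>j\<in>{j. j < N \<and> j \<noteq> i}. {x. x \<bullet> z j - w j \<le> x \<bullet> z i - w i - h})" for i h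
    by (auto simp: C_def)
  have "closed (\<Inter>j\<in>{j. j < N \<and> j \<noteq> i}. {x. x \<bullet> z j - w j \<le> x \<bullet> z i - w i - h})" for i h
    by (intro closed_INT ballI closed_Collect_le continuous_intros)
  then have C_sets: "C i h \<in> sets \<mu>" for i h
    by (intro sets_mu) (auto simp: C_eq)
  have D_sets: "D i \<in> sets \<mu>" for i by (intro sets_mu borel_open[OF D_open]) (auto simp: D_def)
  have C_le: "measure \<mu> (C i h) \<le> m i" if i: "i < N" and h: "h > 0" for i h
  proof -
    let ?v = "w(i := w i + h)"
    have ptw: "maff N z ?v x + h * indicator (C i h) x \<le> maff N z w x" for x
    proof (cases "x \<in> C i h")
      case True
      have "maff N z ?v x \<le> x \<bullet> z i - w i - h"
        by (rule maff_le[OF N]) (use True in \<open>auto simp: C_def\<close>)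
      then show ?thesis using maff_ge[OF i, of x z w] True by simp
    next
      case False
      have "maff N z ?v x \<le> maff N z w x"
      proof (rule maff_le[OF N])
        fix j assume "j < N"
        then show "x \<bullet> z j - ?v j \<le> maff N z w x" using maff_ge[of j N x z w] h by auto
      qed
      then show ?thesis using False by simp
    qed
    have "(\<integral>x. maff N z ?v x + h * indicator (C i h) x \<partial>\<mu>) \<le> (\<integral>x. maff N z w x \<partial>\<mu>)"
      using integrable_maff[OF N] C_sets ptw by (intro integral_mono) (auto simp: emeasure_eq_measure)
    also have "(\<integral>x. maff N z ?v x + h * indicator (C i h) x \<partial>\<mu>) = (\<integral>x. maff N z ?v x \<partial>\<mu>) + h * measure \<mu> (C i h)"
      using integrable_maff[OF N] C_sets[of i h] sets.sets_into_space[OF C_sets[of i h]]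
      by (subst Bochner_Integration.integral_add) (auto simp: emeasure_eq_measure Int_absorb2)
    finally have 1: "(\<integral>x. maff N z ?v x \<partial>\<mu>) + h * measure \<mu> (C i h) \<le> 0" using mean by simp
    have "(\<Sum>j<N. m j * ?v j) = (\<Sum>j<N. m j * w j + (if j = i then m i * h else 0))"
      by (rule sum.cong) (auto simp: algebra_simps)
    also have "\<dots> = (\<Sum>j<N. m j * w j) + m i * h" using i by (simp add: sum.distrib)
    finally have "h * measure \<mu> (C i h) \<le> h * m i" using min[of ?v] 1 by (simp add: mult.commute)
    then show ?thesis using h by simp
  qed
  have D_le: "measure \<mu> (D i) \<le> m i" if i: "i < N" for i
  proof -
    let ?C = "\<lambda>n. C i (1 / real (Suc n))"
    have inc: "incseq ?C"
    proof (rule incseq_SucI)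
      fix n
      have "1 / real (Suc (Suc n)) \<le> 1 / real (Suc n)" by (simp add: frac_le)
      then show "?C n \<subseteq> ?C (Suc n)" unfolding C_def by fastforce
    qed
    have "D i \<subseteq> (\<Union>n. ?C n)"
    proof
      fix x assume x: "x \<in> D i"
      define e where "e = Min (insert 1 ((\<lambda>j. (x \<bullet> z i - w i) - (x \<bullet> z j - w j)) ` {j. j < N \<and> j \<noteq> i}))"
      have e: "e > 0" unfolding e_def using x by (subst Min_gr_iff) (auto simp: D_def)
      have le: "e \<le> (x \<bullet> z i - w i) - (x \<bullet> z j - w j)" if "j < N" "j \<noteq> i" for j
        unfolding e_def by (rule Min_le) (use that in auto)
      obtain n where "1 / real (Suc n) < e" using e nat_approx_posE by metis
      then have "x \<in> ?C n" using x le by (fastforce simp: C_def D_def)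
      then show "x \<in> (\<Union>n. ?C n)" by blast
    qed
    then have "measure \<mu> (D i) \<le> measure \<mu> (\<Union>n. ?C n)"
      by (intro finite_measure_mono) (use C_sets in auto)
    also have "\<dots> \<le> m i"
    proof (rule LIMSEQ_le_const2)
      show "(\<lambda>n. measure \<mu> (?C n)) \<longlonglongrightarrow> measure \<mu> (\<Union>n. ?C n)"
        using C_sets inc by (intro finite_Lim_measure_incseq) auto
    qed (use C_le[OF i] in auto)
    finally show ?thesis .
  qed
  have cover: "AE x in \<mu>. \<exists>i<N. x \<in> D i \<and> maff N z w x = x \<bullet> z i - w i"
    using AE_no_ties[OF z, of w] AE_dom
  proof eventually_elim
    case (elim x)
    obtain i where i: "i < N" "maff N z w x = x \<bullet> z i - w i" using maff_attained[OF N] by blast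
    have "x \<bullet> z j - w j < x \<bullet> z i - w i" if "j < N" "j \<noteq> i" for j
      using maff_ge[OF that(1), of x z w] elim(1) i that by (metis order_le_less)
    then show ?case using i elim(2) by (auto simp: D_def)
  qed
  have disj: "disjoint_family_on D {..<N}"
    unfolding disjoint_family_on_def D_def by (auto dest: less_asym)
  have "measure \<mu> (\<Union>i<N. D i) = 1"
    using D_sets cover by (subst prob_eq_1) (auto elim!: eventually_mono)
  then have "(\<Sum>i<N. measure \<mu> (D i)) = 1"
    using finite_measure_finite_Union[of "{..<N}" D, OF _ _ disj] D_sets by auto
  then have D_meas: "measure \<mu> (D i) = m i" if "i < N" for i
    using sum_mono_inv[of "\<lambda>i. measure \<mu> (D i)" "{..<N}" m i] sum D_le that by auto
  have gradD: "grad (maff N z w) x = z i" if x: "x \<in> D i" and i: "i < N" for x i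
  proof (rule grad_eqI)
    have "((\<lambda>x. x \<bullet> z i - w i) has_derivative (\<lambda>v. z i \<bullet> v)) (at x)"
      by (auto intro!: derivative_eq_intros simp: inner_commute)
    then show "(maff N z w has_derivative (\<lambda>v. z i \<bullet> v)) (at x)"
    proof (rule has_derivative_transform_within_open[OF _ D_open x])
      fix y assume y: "y \<in> D i"
      show "y \<bullet> z i - w i = maff N z w y"
      proof (rule antisym[OF maff_ge[OF i] maff_le[OF N]])
        fix j assume "j < N"
        then show "y \<bullet> z j - w j \<le> y \<bullet> z i - w i" using y by (cases "j = i") (auto simp: D_def intro: less_imp_le)
      qed
    qed
  qed
  have cvx: "convex_on \<Omega> (maff N z w)" using convex_on_maff[OF N] convex_dom convex_on_subset by blast
  have AE2: "AE x in \<mu>. \<exists>i<N. grad (maff N z w) x = z i \<and> maff N z w x = x \<bullet> z i - w i"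
    using cover by eventually_elim (use gradD in blast)
  have "measure \<mu> {x \<in> \<Omega>. grad (maff N z w) x = z i} = m i" if i: "i < N" for i
  proof -
    have s: "{x \<in> \<Omega>. grad (maff N z w) x = z i} \<in> sets \<mu>"
      using measurable_sets[OF grad_measurable[OF cvx], of "{z i}"] by (simp add: vimage_def Int_def conj_commute)
    have "measure \<mu> {x \<in> \<Omega>. grad (maff N z w) x = z i} = measure \<mu> (D i)"
    proof (rule measure_eq_AE[OF _ s D_sets])
      show "AE x in \<mu>. x \<in> {x \<in> \<Omega>. grad (maff N z w) x = z i} \<longleftrightarrow> x \<in> D i"
        using cover AE_dom
      proof eventually_elim
        case (elim x)
        then obtain j where j: "j < N" "x \<in> D j" by blast
        have "grad (maff N z w) x = z j" by (rule gradD[OF j(2,1)])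
        moreover have "z j = z i \<Longrightarrow> i = j" using z i j by (auto simp: inj_on_def)
        ultimately show ?case using gradD[OF _ i] elim j by auto
      qed
    qed
    then show ?thesis using D_meas[OF i] by simp
  qed
  then show ?thesis using mean AE2 by blast
qed

end

section \<open>Cells and barycentres\<close>

definition masses :: "nat \<Rightarrow> (nat \<Rightarrow> real) \<Rightarrow> bool" where
  "masses N m \<longleftrightarrow> (\<forall>i<N. m i > 0) \<and> (\<Sum>i<N. m i) = 1"

lemma masses_pos: "masses N m \<Longrightarrow> N > 0"
  by (cases N) (auto simp: masses_def)

lemma sum_indicator_select:
  fixes F :: "nat \<Rightarrow> 'b::real_vector"
  assumes "i < N" "\<forall>j<N. x \<in> A j \<longleftrightarrow> j = i"
  shows "(\<Sum>j<N. indicator (A j) x *\<^sub>R F j) = F i"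
proof -
  have "(\<Sum>j<N. indicator (A j) x *\<^sub>R F j) = (\<Sum>j<N. if j = i then F i else 0)"
    by (rule sum.cong) (use assms(2) in auto)
  then show ?thesis using assms(1) by simp
qed

context unit_domain
begin

text \<open>An arbitrary choice. Continuity in \<open>z\<close> comes later from the fact that the
  image measure determines the potential, not from the way the weights are chosen.\<close>

definition sdw :: "nat \<Rightarrow> (nat \<Rightarrow> real) \<Rightarrow> (nat \<Rightarrow> real^3) \<Rightarrow> nat \<Rightarrow> real" where
  "sdw N m z = (SOME w. (\<integral>x. maff N z w x \<partial>\<mu>) = 0 \<and>
    (\<forall>i<N. measure \<mu> {x \<in> \<Omega>. grad (maff N z w) x = z i} = m i) \<and>
    (AE x in \<mu>. \<exists>i<N. grad (maff N z w) x = z i \<and> maff N z w x = x \<bullet> z i - w i))"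

definition sdp :: "nat \<Rightarrow> (nat \<Rightarrow> real) \<Rightarrow> (nat \<Rightarrow> real^3) \<Rightarrow> real^3 \<Rightarrow> real" where
  "sdp N m z = maff N z (sdw N m z)"

text \<open>The Laguerre cell up to a null set. Taken as a level set of the gradient, the cells of
  distinct points are disjoint without a convention for ties.\<close>

definition cell :: "nat \<Rightarrow> (nat \<Rightarrow> real) \<Rightarrow> (nat \<Rightarrow> real^3) \<Rightarrow> nat \<Rightarrow> (real^3) set" where
  "cell N m z i = {x \<in> \<Omega>. grad (sdp N m z) x = z i}"

text \<open>Not normalised: the barycentre of the cell is \<open>bary N m z i\<close> divided by its mass \<open>m i\<close>.\<close>

definition bary :: "nat \<Rightarrow> (nat \<Rightarrow> real) \<Rightarrow> (nat \<Rightarrow> real^3) \<Rightarrow> nat \<Rightarrow> real^3" where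
  "bary N m z i = (\<integral>x. indicator (cell N m z i) x *\<^sub>R x \<partial>\<mu>)"

lemma sd_spec:
  assumes "masses N m" "inj_on z {..<N}"
  shows sd_mean: "(\<integral>x. sdp N m z x \<partial>\<mu>) = 0"
    and cell_measure: "\<And>i. i < N \<Longrightarrow> measure \<mu> (cell N m z i) = m i"
    and AE_sdp: "AE x in \<mu>. \<exists>i<N. grad (sdp N m z) x = z i \<and> sdp N m z x = x \<bullet> z i - sdw N m z i"
  using someI_ex[OF semidiscrete_exists[of N m z]] assms
  unfolding sdp_def cell_def masses_def sdw_def by blast+

lemma sd_pot:
  assumes "masses N m" "inj_on z {..<N}" "\<And>i. i < N \<Longrightarrow> norm (z i) \<le> R"
  shows "pot R (sdp N m z)"
proof -
  note N = masses_pos[OF assms(1)]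
  have "convex_on (closure \<Omega>) (sdp N m z)" unfolding sdp_def
    by (rule convex_on_subset[OF convex_on_maff[OF N]]) (use convex_dom convex_closure in auto)
  moreover have "R-lipschitz_on (closure \<Omega>) (sdp N m z)" unfolding sdp_def
    by (rule maff_lipschitz[OF N assms(3)])
  ultimately show ?thesis using sd_mean[OF assms(1,2)] by (simp add: pot_def)
qed

lemma sdp_convex: "masses N m \<Longrightarrow> convex_on \<Omega> (sdp N m z)"
  unfolding sdp_def using convex_on_maff[OF masses_pos] convex_dom convex_on_subset by blast

lemma cell_sets: "masses N m \<Longrightarrow> cell N m z i \<in> sets \<mu>"
  using measurable_sets[OF grad_measurable[OF sdp_convex], of N m "{z i}" z]
  by (simp add: cell_def vimage_def Int_def conj_commute)

lemma AE_cells: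
  assumes m: "masses N m" and z: "inj_on z {..<N}"
  shows "AE x in \<mu>. \<exists>i<N. (\<forall>j<N. x \<in> cell N m z j \<longleftrightarrow> j = i) \<and> grad (sdp N m z) x = z i \<and>
    sdp N m z x = x \<bullet> z i - sdw N m z i"
  using AE_sdp[OF m z] AE_dom
proof eventually_elim
  case (elim x)
  then obtain i where i: "i < N" "grad (sdp N m z) x = z i" "sdp N m z x = x \<bullet> z i - sdw N m z i" by blast
  then have "\<forall>j<N. x \<in> cell N m z j \<longleftrightarrow> j = i"
    using elim(2) z by (auto simp: cell_def inj_on_def)
  with i show ?case by blast
qed

lemma integrable_cell:
  fixes f :: "real^3 \<Rightarrow> 'b::euclidean_space"
  assumes "masses N m" "integrable \<mu> f"
  shows "integrable \<mu> (\<lambda>x. indicator (cell N m z i) x *\<^sub>R f x)"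
  using cell_sets[OF assms(1)] assms(2) by (rule integrable_mult_indicator)

lemma integrable_id: "integrable \<mu> (\<lambda>x::real^3. x)"
  by (rule integrable_mu_continuous) (rule continuous_on_id)

lemma integral_cell_const:
  fixes c :: "'b::euclidean_space"
  assumes "masses N m" "inj_on z {..<N}" "i < N"
  shows "(\<integral>x. indicator (cell N m z i) x *\<^sub>R c \<partial>\<mu>) = m i *\<^sub>R c"
proof -
  have "(\<integral>x. indicator (cell N m z i) x *\<^sub>R c \<partial>\<mu>) = measure \<mu> (cell N m z i) *\<^sub>R c"
    by (intro has_bochner_integral_integral_eq has_bochner_integral_indicator cell_sets[OF assms(1)])
      (simp add: emeasure_eq_measure)
  then show ?thesis using cell_measure[OF assms] by simp
qed

lemma integral_cells:
  fixes g :: "(real^3) \<times> (real^3) \<times> real \<Rightarrow> 'b::euclidean_space"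
  assumes m: "masses N m" and z: "inj_on z {..<N}" and g: "continuous_on UNIV g"
  shows "(\<integral>x. g (x, grad (sdp N m z) x, t) \<partial>\<mu>) = (\<Sum>i<N. \<integral>x. indicator (cell N m z i) x *\<^sub>R g (x, z i, t) \<partial>\<mu>)"
proof -
  have int: "integrable \<mu> (\<lambda>x. indicator (cell N m z i) x *\<^sub>R g (x, z i, t))" for i
    by (intro integrable_cell[OF m] integrable_mu_continuous continuous_on_compose2[OF g] continuous_intros) auto
  have "(\<integral>x. g (x, grad (sdp N m z) x, t) \<partial>\<mu>) = (\<integral>x. (\<Sum>i<N. indicator (cell N m z i) x *\<^sub>R g (x, z i, t)) \<partial>\<mu>)"
  proof (rule integral_cong_AE)
    show "AE x in \<mu>. g (x, grad (sdp N m z) x, t) = (\<Sum>i<N. indicator (cell N m z i) x *\<^sub>R g (x, z i, t))"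
      using AE_cells[OF m z]
    proof eventually_elim
      case (elim x)
      then obtain i where i: "i < N" "\<forall>j<N. x \<in> cell N m z j \<longleftrightarrow> j = i" "grad (sdp N m z) x = z i" by blast
      show ?case unfolding i(3) by (rule sum_indicator_select[OF i(1,2), of "\<lambda>j. g (x, z j, t)", symmetric])
    qed
    show "(\<lambda>x. \<Sum>i<N. indicator (cell N m z i) x *\<^sub>R g (x, z i, t)) \<in> borel_measurable \<mu>"
      by (intro borel_measurable_sum borel_measurable_integrable int)
  qed (rule continuous_grad_measurable[OF g sdp_convex[OF m]])
  also have "\<dots> = (\<Sum>i<N. \<integral>x. indicator (cell N m z i) x *\<^sub>R g (x, z i, t) \<partial>\<mu>)"
    by (rule Bochner_Integration.integral_sum) (rule int)
  finally show ?thesis .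
qed

lemma integral_grad_sdp:
  fixes f :: "real^3 \<Rightarrow> 'b::euclidean_space"
  assumes m: "masses N m" and z: "inj_on z {..<N}" and f: "continuous_on UNIV f"
  shows "(\<integral>x. f (grad (sdp N m z) x) \<partial>\<mu>) = (\<Sum>i<N. m i *\<^sub>R f (z i))"
proof -
  have "continuous_on UNIV (\<lambda>p::(real^3)\<times>(real^3)\<times>real. f (fst (snd p)))"
    by (rule continuous_on_compose2[OF f]) (auto intro!: continuous_intros)
  from integral_cells[OF m z this, of 0]
  have "(\<integral>x. f (grad (sdp N m z) x) \<partial>\<mu>) = (\<Sum>i<N. \<integral>x. indicator (cell N m z i) x *\<^sub>R f (z i) \<partial>\<mu>)" by simp
  also have "\<dots> = (\<Sum>i<N. m i *\<^sub>R f (z i))"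
    by (intro sum.cong integral_cell_const[OF m z]) auto
  finally show ?thesis .
qed

text \<open>Both configurations carry the same masses, so pairing particles of equal index is a
  transport plan whose mean displacement is the right-hand side.\<close>

lemma moment_diff:
  fixes f :: "real^3 \<Rightarrow> real"
  assumes m: "masses N m" and y: "inj_on y {..<N}" and z: "inj_on z {..<N}" and f: "1-lipschitz_on UNIV f"
  shows "\<bar>(\<integral>x. f (grad (sdp N m y) x) \<partial>\<mu>) - (\<integral>x. f (grad (sdp N m z) x) \<partial>\<mu>)\<bar> \<le> (\<Sum>i<N. m i * norm (y i - z i))"
proof -
  note c = lipschitz_on_continuous_on[OF f]
  have "(\<integral>x. f (grad (sdp N m y) x) \<partial>\<mu>) - (\<integral>x. f (grad (sdp N m z) x) \<partial>\<mu>) = (\<Sum>i<N. m i * (f (y i) - f (z i)))"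
    using integral_grad_sdp[OF m y c] integral_grad_sdp[OF m z c] by (simp add: right_diff_distrib sum_subtractf)
  also have "\<bar>\<dots>\<bar> \<le> (\<Sum>i<N. \<bar>m i * (f (y i) - f (z i))\<bar>)" by (rule sum_abs)
  also have "\<dots> \<le> (\<Sum>i<N. m i * norm (y i - z i))"
  proof (rule sum_mono)
    fix i assume "i \<in> {..<N}"
    then have "m i > 0" using m by (simp add: masses_def)
    moreover have "\<bar>f (y i) - f (z i)\<bar> \<le> norm (y i - z i)"
      using lipschitz_onD[OF f, of "y i" "z i"] by (simp add: dist_norm)
    ultimately show "\<bar>m i * (f (y i) - f (z i))\<bar> \<le> m i * norm (y i - z i)"
      by (simp add: abs_mult)
  qed
  finally show ?thesis .
qed

lemma norm_bary:
  assumes m: "masses N m" and z: "inj_on z {..<N}" and i: "i < N"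
  shows "norm (bary N m z i) \<le> m i * r"
proof -
  have "norm (bary N m z i) \<le> (\<integral>x. norm (indicator (cell N m z i) x *\<^sub>R x) \<partial>\<mu>)"
    unfolding bary_def by (rule integral_norm_bound)
  also have "\<dots> \<le> (\<integral>x. indicator (cell N m z i) x *\<^sub>R r \<partial>\<mu>)"
  proof (rule integral_mono_AE)
    show "integrable \<mu> (\<lambda>x. norm (indicator (cell N m z i) x *\<^sub>R x))"
      by (intro integrable_norm integrable_cell[OF m] integrable_id)
    show "integrable \<mu> (\<lambda>x. indicator (cell N m z i) x *\<^sub>R r)"
      by (intro integrable_cell[OF m]) simp
    show "AE x in \<mu>. norm (indicator (cell N m z i) x *\<^sub>R x) \<le> indicator (cell N m z i) x *\<^sub>R r"
      using AE_dom by eventually_elim (auto simp: indicator_def norm_dom)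
  qed
  also have "\<dots> = m i * r" using integral_cell_const[OF m z i, of r] by simp
  finally show ?thesis .
qed

lemma bary_inner:
  assumes m: "masses N m"
  shows "bary N m z i \<bullet> v = (\<integral>x. indicator (cell N m z i) x * (x \<bullet> v) \<partial>\<mu>)"
    "integrable \<mu> (\<lambda>x. indicator (cell N m z i) x * (x \<bullet> v))"
proof -
  have i: "integrable \<mu> (\<lambda>x. indicator (cell N m z i) x *\<^sub>R x)"
    by (rule integrable_cell[OF m integrable_id])
  show "bary N m z i \<bullet> v = (\<integral>x. indicator (cell N m z i) x * (x \<bullet> v) \<partial>\<mu>)"
    unfolding bary_def using integral_inner_left[of v \<mu> "\<lambda>x. indicator (cell N m z i) x *\<^sub>R x"] i by simp
  show "integrable \<mu> (\<lambda>x. indicator (cell N m z i) x * (x \<bullet> v))"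
    using integrable_inner_left[of v \<mu> "\<lambda>x. indicator (cell N m z i) x *\<^sub>R x"] i by simp
qed

text \<open>Semi-discrete duality, with the cells of \<open>y\<close> tested against the weights of
  \<open>z\<close>: on the \<open>i\<close>-th cell of \<open>y\<close> the \<open>i\<close>-th
  affine function of \<open>z\<close> lies below \<open>sdp N m z\<close>. For \<open>y = z\<close>
  it attains the maximum there, hence equality.\<close>

lemma bary_dual:
  assumes m: "masses N m" and y: "inj_on y {..<N}" and z: "inj_on z {..<N}"
  shows "(\<Sum>i<N. bary N m y i \<bullet> z i) \<le> (\<Sum>i<N. m i * sdw N m z i)"
    and "y = z \<Longrightarrow> (\<Sum>i<N. bary N m y i \<bullet> z i) = (\<Sum>i<N. m i * sdw N m z i)"
proof -
  let ?L = "\<lambda>x. \<Sum>i<N. indicator (cell N m y i) x * (x \<bullet> z i)"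
  let ?U = "\<lambda>x. sdp N m z x + (\<Sum>i<N. indicator (cell N m y i) x * sdw N m z i)"
  note N = masses_pos[OF m]
  have L2: "integrable \<mu> ?L" by (intro Bochner_Integration.integrable_sum bary_inner(2)[OF m])
  have L1: "(\<Sum>i<N. bary N m y i \<bullet> z i) = (\<integral>x. ?L x \<partial>\<mu>)"
    unfolding bary_inner(1)[OF m]
    by (rule Bochner_Integration.integral_sum[symmetric]) (rule bary_inner(2)[OF m])
  note L = L1 L2
  have ci: "integrable \<mu> (\<lambda>x. indicator (cell N m y i) x * sdw N m z i)" for i
    using integrable_cell[OF m, of "\<lambda>_. sdw N m z i"] by simp
  have si: "integrable \<mu> (sdp N m z)" unfolding sdp_def by (rule integrable_maff[OF N])
  have ss: "integrable \<mu> (\<lambda>x. \<Sum>i<N. indicator (cell N m y i) x * sdw N m z i)"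
    by (intro Bochner_Integration.integrable_sum ci)
  have U1: "integrable \<mu> ?U" by (intro Bochner_Integration.integrable_add si ss)
  have "(\<integral>x. ?U x \<partial>\<mu>) = (\<integral>x. sdp N m z x \<partial>\<mu>) + (\<integral>x. (\<Sum>i<N. indicator (cell N m y i) x * sdw N m z i) \<partial>\<mu>)"
    by (rule Bochner_Integration.integral_add[OF si ss])
  also have "(\<integral>x. (\<Sum>i<N. indicator (cell N m y i) x * sdw N m z i) \<partial>\<mu>) = (\<Sum>i<N. \<integral>x. indicator (cell N m y i) x * sdw N m z i \<partial>\<mu>)"
    by (rule Bochner_Integration.integral_sum) (rule ci)
  also have "\<dots> = (\<Sum>i<N. m i * sdw N m z i)"
    using integral_cell_const[OF m y, where 'b=real] by (intro sum.cong) auto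
  finally have U2: "(\<integral>x. ?U x \<partial>\<mu>) = (\<Sum>i<N. m i * sdw N m z i)" using sd_mean[OF m z] by simp
  note U = U1 U2
  have le: "AE x in \<mu>. ?L x \<le> ?U x \<and> (y = z \<longrightarrow> ?L x = ?U x)"
    using AE_cells[OF m y]
  proof eventually_elim
    case (elim x)
    then obtain i where i: "i < N" "\<forall>j<N. x \<in> cell N m y j \<longleftrightarrow> j = i" "sdp N m y x = x \<bullet> y i - sdw N m y i" by blast
    note sel = sum_indicator_select[OF i(1,2), where 'b=real, unfolded real_scaleR_def]
    have "x \<bullet> z i - sdw N m z i \<le> sdp N m z x" unfolding sdp_def by (rule maff_ge[OF i(1)])
    then show ?case unfolding sel using i(3) by auto
  qed
  have "(\<integral>x. ?L x \<partial>\<mu>) \<le> (\<integral>x. ?U x \<partial>\<mu>)"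
    by (rule integral_mono_AE[OF L(2) U(1)]) (use le in \<open>auto elim!: eventually_mono\<close>)
  then show "(\<Sum>i<N. bary N m y i \<bullet> z i) \<le> (\<Sum>i<N. m i * sdw N m z i)" by (simp only: L U)
  assume "y = z"
  then have "AE x in \<mu>. ?L x = ?U x" using le by (auto elim!: eventually_mono)
  then have "(\<integral>x. ?L x \<partial>\<mu>) = (\<integral>x. ?U x \<partial>\<mu>)"
    by (intro integral_cong_AE borel_measurable_integrable L(2) U(1))
  then show "(\<Sum>i<N. bary N m y i \<bullet> z i) = (\<Sum>i<N. m i * sdw N m z i)" by (simp only: L U)
qed

text \<open>Among partitions with the prescribed masses, the cells of \<open>z\<close> correlate
  best with \<open>z\<close>; the cells of \<open>y\<close> are a competitor. This is the optimality
  that \<open>constant_if_optimal\<close> exploits for the energy.\<close>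

lemma bary_optimal:
  assumes "masses N m" "inj_on y {..<N}" "inj_on z {..<N}"
  shows "(\<Sum>i<N. bary N m y i \<bullet> z i) \<le> (\<Sum>i<N. bary N m z i \<bullet> z i)"
  using bary_dual(1)[OF assms] bary_dual(2)[OF assms(1,3,3) refl] by simp

lemma emeasure_push_sdp:
  assumes m: "masses N m" and z: "inj_on z {..<N}" and A: "A \<in> sets borel"
  shows "emeasure (push (sdp N m z)) A = (\<Sum>i<N. ennreal (m i) * indicator A (z i))"
proof -
  note gm = grad_measurable[OF sdp_convex[OF m]]
  have gA: "grad (sdp N m z) -` A \<inter> \<Omega> \<in> sets \<mu>" using measurable_sets[OF gm A] by simp
  have "emeasure (push (sdp N m z)) A = emeasure \<mu> (grad (sdp N m z) -` A \<inter> \<Omega>)"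
    unfolding push_def using A by (subst emeasure_distr[OF gm]) auto
  also have "\<dots> = (\<integral>\<^sup>+x. indicator (grad (sdp N m z) -` A \<inter> \<Omega>) x \<partial>\<mu>)" using gA by simp
  also have "\<dots> = (\<integral>\<^sup>+x. (\<Sum>i<N. indicator (cell N m z i) x * indicator A (z i)) \<partial>\<mu>)"
  proof (rule nn_integral_cong_AE)
    show "AE x in \<mu>. indicator (grad (sdp N m z) -` A \<inter> \<Omega>) x = (\<Sum>i<N. indicator (cell N m z i) x * (indicator A (z i) :: ennreal))"
      using AE_cells[OF m z] AE_dom
    proof eventually_elim
      case (elim x)
      then obtain i where i: "i < N" "\<forall>j<N. x \<in> cell N m z j \<longleftrightarrow> j = i" "grad (sdp N m z) x = z i" by blast
      have "(\<Sum>j<N. indicator (cell N m z j) x * (indicator A (z j) :: ennreal)) = (\<Sum>j<N. if j = i then indicator A (z i) else 0)"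
        by (rule sum.cong) (use i in auto)
      then show ?case using i elim(2) by (simp add: indicator_def)
    qed
  qed
  also have "\<dots> = (\<Sum>i<N. \<integral>\<^sup>+x. indicator (cell N m z i) x * indicator A (z i) \<partial>\<mu>)"
    using cell_sets[OF m] by (intro nn_integral_sum) auto
  also have "\<dots> = (\<Sum>i<N. ennreal (m i) * indicator A (z i))"
  proof (rule sum.cong[OF refl])
    fix i assume i: "i \<in> {..<N}"
    have "(\<integral>\<^sup>+x. indicator (cell N m z i) x * indicator A (z i) \<partial>\<mu>) = emeasure \<mu> (cell N m z i) * indicator A (z i)"
      using cell_sets[OF m, of z i] by (simp add: nn_integral_multc)
    then show "(\<integral>\<^sup>+x. indicator (cell N m z i) x * indicator A (z i) \<partial>\<mu>) = ennreal (m i) * indicator A (z i)"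
      using cell_measure[OF m z, of i] i by (simp add: emeasure_eq_measure)
  qed
  finally show ?thesis .
qed

text \<open>Convergence of the particles makes all 1-Lipschitz moments converge uniformly in the
  test function, and \<open>pot_modulus\<close> carries this over to the potentials. A convergent
  sequence is bounded, which supplies the common \<open>R\<close>.\<close>

lemma sdp_tendsto:
  assumes m: "masses N m" and Z: "\<And>k. inj_on (Z k) {..<N}" and z: "inj_on z {..<N}"
    and conv: "\<And>i. i < N \<Longrightarrow> (\<lambda>k. Z k i) \<longlonglongrightarrow> z i"
  obtains R where "\<And>k. pot R (sdp N m (Z k))" "pot R (sdp N m z)"
    "\<And>x. x \<in> closure \<Omega> \<Longrightarrow> (\<lambda>k. sdp N m (Z k) x) \<longlonglongrightarrow> sdp N m z x"
proof -
  have "\<exists>B. \<forall>k. norm (Z k i) \<le> B" if "i < N" for i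
    using convergent_imp_Bseq[of "\<lambda>k. Z k i"] conv[OF that] by (auto simp: convergent_def Bseq_def)
  then obtain B where B: "\<And>i k. i < N \<Longrightarrow> norm (Z k i) \<le> B i" by metis
  define R where "R = Max (B ` {..<N})"
  have R: "norm (Z k i) \<le> R" if "i < N" for k i
  proof -
    have "B i \<le> R" unfolding R_def using that by (intro Max_ge) auto
    then show ?thesis using B[OF that, of k] by simp
  qed
  have R': "norm (z i) \<le> R" if "i < N" for i
    by (rule LIMSEQ_le_const2[OF tendsto_norm[OF conv[OF that]]]) (use R[OF that] in auto)
  have p: "pot R (sdp N m (Z k))" for k by (rule sd_pot[OF m Z R])
  have q: "pot R (sdp N m z)" by (rule sd_pot[OF m z R'])
  have "(\<lambda>k. sdp N m (Z k) x) \<longlonglongrightarrow> sdp N m z x" if x: "x \<in> closure \<Omega>" for x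
    unfolding LIMSEQ_def
  proof (intro allI impI)
    fix e :: real assume e: "e > 0"
    obtain d where d: "d > 0" "\<And>\<psi> \<xi> x. pot R \<psi> \<Longrightarrow> pot R \<xi> \<Longrightarrow>
      (\<And>f :: real^3 \<Rightarrow> real. 1-lipschitz_on UNIV f \<Longrightarrow> \<bar>(\<integral>x. f (grad \<psi> x) \<partial>\<mu>) - (\<integral>x. f (grad \<xi> x) \<partial>\<mu>)\<bar> \<le> d) \<Longrightarrow>
      x \<in> closure \<Omega> \<Longrightarrow> \<bar>\<psi> x - \<xi> x\<bar> < e" using pot_modulus[OF e] by blast
    have "(\<lambda>k. \<Sum>i<N. m i * norm (Z k i - z i)) \<longlonglongrightarrow> (\<Sum>i<N. m i * norm (z i - z i))"
      by (intro tendsto_intros conv) auto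
    then have "(\<lambda>k. \<Sum>i<N. m i * norm (Z k i - z i)) \<longlonglongrightarrow> 0" by simp
    from order_tendstoD(2)[OF this d(1)]
    obtain K where K: "\<And>k. k \<ge> K \<Longrightarrow> (\<Sum>i<N. m i * norm (Z k i - z i)) < d"
      by (auto simp: eventually_sequentially)
    have "dist (sdp N m (Z k) x) (sdp N m z x) < e" if k: "k \<ge> K" for k
      unfolding dist_real_def
    proof (rule d(2)[OF p q _ x])
      fix f :: "real^3 \<Rightarrow> real" assume "1-lipschitz_on UNIV f"
      from moment_diff[OF m Z z this, of k] K[OF k]
      show "\<bar>(\<integral>x. f (grad (sdp N m (Z k)) x) \<partial>\<mu>) - (\<integral>x. f (grad (sdp N m z) x) \<partial>\<mu>)\<bar> \<le> d" by linarith
    qed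
    then show "\<exists>no. \<forall>n\<ge>no. dist (sdp N m (Z n) x) (sdp N m z x) < e" by blast
  qed
  with p q show ?thesis using that by blast
qed

text \<open>As the third coordinates are fixed, a tent function of the third coordinate singles out the
  \<open>i\<close>-th cell, which turns the barycentre into the integral of a continuous function of the gradient.\<close>

lemma bary_tendsto:
  fixes \<zeta> :: "nat \<Rightarrow> real"
  assumes m: "masses N m" and \<zeta>: "inj_on \<zeta> {..<N}"
    and Z: "\<And>k i. i < N \<Longrightarrow> Z k i $ 3 = \<zeta> i" and z: "\<And>i. i < N \<Longrightarrow> z i $ 3 = \<zeta> i"
    and conv: "\<And>i. i < N \<Longrightarrow> (\<lambda>k. Z k i) \<longlonglongrightarrow> z i" and i: "i < N"
  shows "(\<lambda>k. bary N m (Z k) i) \<longlonglongrightarrow> bary N m z i"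
proof -
  have inj: "inj_on y {..<N}" if "\<And>i. i < N \<Longrightarrow> y i $ 3 = \<zeta> i" for y :: "nat \<Rightarrow> real^3"
    using \<zeta> that unfolding inj_on_def by (metis lessThan_iff)
  \<comment> \<open>Half-width of the tent: no other height lies strictly within \<delta> of
    \<open>\<zeta> i\<close>. Inserting 1 keeps the set nonempty when \<open>N = 1\<close>.\<close>
  define \<delta> where "\<delta> = Min (insert 1 ((\<lambda>j. \<bar>\<zeta> j - \<zeta> i\<bar>) ` ({..<N} - {i})))"
  have \<delta>: "\<delta> > 0" unfolding \<delta>_def using \<zeta> i by (subst Min_gr_iff) (auto simp: inj_on_def)
  have \<delta>j: "\<delta> \<le> \<bar>\<zeta> j - \<zeta> i\<bar>" if "j < N" "j \<noteq> i" for j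
    unfolding \<delta>_def by (rule Min_le) (use that in auto)
  define g where "g p = max 0 (1 - \<bar>fst (snd p) $ 3 - \<zeta> i\<bar> / \<delta>) *\<^sub>R fst p" for p :: "(real^3) \<times> (real^3) \<times> real"
  have g: "continuous_on UNIV g" unfolding g_def using \<delta> by (intro continuous_intros) auto
  have rep: "bary N m y i = (\<integral>x. g (x, grad (sdp N m y) x, 0) \<partial>\<mu>)" if y: "\<And>i. i < N \<Longrightarrow> y i $ 3 = \<zeta> i" for y
  proof -
    have "(\<integral>x. g (x, grad (sdp N m y) x, 0) \<partial>\<mu>) = (\<Sum>j<N. \<integral>x. indicator (cell N m y j) x *\<^sub>R g (x, y j, 0) \<partial>\<mu>)"
      by (rule integral_cells[OF m inj[OF y] g])
    also have "\<dots> = (\<Sum>j<N. if j = i then bary N m y i else 0)"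
    proof (rule sum.cong[OF refl])
      fix j assume j: "j \<in> {..<N}"
      have "g (x, y j, 0) = (if j = i then x else 0)" for x
      proof (cases "j = i")
        case False
        then have "1 \<le> \<bar>\<zeta> j - \<zeta> i\<bar> / \<delta>" using \<delta>j[of j] j \<delta> by simp
        then show ?thesis using False y[of j] j by (simp add: g_def)
      qed (use y[of j] j in \<open>simp add: g_def\<close>)
      then show "(\<integral>x. indicator (cell N m y j) x *\<^sub>R g (x, y j, 0) \<partial>\<mu>) = (if j = i then bary N m y i else 0)"
        by (simp add: bary_def)
    qed
    finally show ?thesis using i by simp
  qed
  obtain R where R: "\<And>k. pot R (sdp N m (Z k))" "pot R (sdp N m z)"
    "\<And>x. x \<in> closure \<Omega> \<Longrightarrow> (\<lambda>k. sdp N m (Z k) x) \<longlonglongrightarrow> sdp N m z x"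
    using sdp_tendsto[of N m Z z, OF m inj[OF Z] inj[OF z] conv] by blast
  have "(\<lambda>k. \<integral>x. g (x, grad (sdp N m (Z k)) x, 0) \<partial>\<mu>) \<longlonglongrightarrow> (\<integral>x. g (x, grad (sdp N m z) x, 0) \<partial>\<mu>)"
    by (rule integral_grad_tendsto[OF g R(1,2)]) (use R(3) closure_subset in auto)
  then show ?thesis using rep[OF Z] rep[OF z] by simp
qed

end

section \<open>Particle trajectories\<close>

text \<open>Tonelli's device: with a positive delay the Picard iterates become stationary on \<open>{0..T}\<close>, so no
  Lipschitz condition is needed.\<close>

lemma delay_solution:
  fixes V :: "(nat \<Rightarrow> 'a::euclidean_space) \<Rightarrow> nat \<Rightarrow> 'a" and y :: "nat \<Rightarrow> 'a"
  assumes T: "T > 0" and c: "c \<ge> 0" and \<tau>: "\<tau> > 0" "T \<le> real n * \<tau>"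
    and growth: "\<And>z i. i < N \<Longrightarrow> norm (V z i) \<le> norm (z i) + c"
    and cont: "\<And>Z z i. (\<And>j. j < N \<Longrightarrow> (\<lambda>k. Z k j) \<longlonglongrightarrow> z j) \<Longrightarrow> i < N \<Longrightarrow> (\<lambda>k. V (Z k) i) \<longlonglongrightarrow> V z i"
  shows "\<exists>W. \<forall>i<N. continuous_on {0..T} (W i) \<and>
    (\<forall>t\<in>{0..T}. norm (W i t) + c \<le> (norm (y i) + c) * exp t \<and>
      W i t = y i + integral {0..t} (\<lambda>s. V (\<lambda>j. W j (max 0 (s - \<tau>))) i)) \<and>
    continuous_on {0..T} (\<lambda>s. V (\<lambda>j. W j (max 0 (s - \<tau>))) i) \<and>
    (\<forall>s\<in>{0..T}. norm (V (\<lambda>j. W j (max 0 (s - \<tau>))) i) \<le> (norm (y i) + c) * exp T)"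
proof -
  define \<Phi> where "\<Phi> Z i t = y i + integral {0..t} (\<lambda>s. V (\<lambda>j. Z j (max 0 (s - \<tau>))) i)" for Z :: "nat \<Rightarrow> real \<Rightarrow> 'a" and i t
  \<comment> \<open>The growth condition reads \<open>u' \<le> u\<close> for
    \<open>u = norm z + c\<close>. The bound by \<open>exp t\<close> is the solution of
    \<open>u' = u\<close>, so one application of \<Phi> reproduces it exactly.\<close>
  define Inv where "Inv Z \<longleftrightarrow> (\<forall>i<N. continuous_on {0..T} (Z i) \<and> (\<forall>t\<in>{0..T}. norm (Z i t) + c \<le> (norm (y i) + c) * exp t))" for Z :: "nat \<Rightarrow> real \<Rightarrow> 'a"
  have Vcont: "continuous_on {0..T} (\<lambda>s. V (\<lambda>j. Z j (max 0 (s - \<tau>))) i)" if Z: "Inv Z" and i: "i < N" for Z i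
    unfolding continuous_on_sequentially comp_def
  proof (intro allI ballI impI, elim conjE)
    fix s a assume a: "a \<in> {0..T}" and s: "\<forall>k. s k \<in> {0..T}" and lim: "s \<longlonglongrightarrow> a"
    show "(\<lambda>k. V (\<lambda>j. Z j (max 0 (s k - \<tau>))) i) \<longlonglongrightarrow> V (\<lambda>j. Z j (max 0 (a - \<tau>))) i"
    proof (rule cont[OF _ i])
      fix j assume j: "j < N"
      have mem: "max 0 (u - \<tau>) \<in> {0..T}" if "u \<in> {0..T}" for u using that \<tau>(1) T by auto
      have Zj: "continuous_on {0..T} (Z j)" using Z j by (simp add: Inv_def)
      have "(\<lambda>k. max 0 (s k - \<tau>)) \<longlonglongrightarrow> max 0 (a - \<tau>)" by (intro tendsto_intros lim)
      moreover have "\<forall>\<^sub>F k in sequentially. max 0 (s k - \<tau>) \<in> {0..T}"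
        using s by (intro always_eventually allI mem) simp
      ultimately show "(\<lambda>k. Z j (max 0 (s k - \<tau>))) \<longlonglongrightarrow> Z j (max 0 (a - \<tau>))"
        by (rule continuous_on_tendsto_compose[OF Zj _ mem[OF a]])
    qed
  qed
  have Vbound: "norm (V (\<lambda>j. Z j (max 0 (s - \<tau>))) i) \<le> (norm (y i) + c) * exp s" if Z: "Inv Z" and i: "i < N" and s: "s \<in> {0..T}" for Z i s
  proof -
    have mem: "max 0 (s - \<tau>) \<in> {0..T}" using s \<tau>(1) T by auto
    have "norm (V (\<lambda>j. Z j (max 0 (s - \<tau>))) i) \<le> norm (Z i (max 0 (s - \<tau>))) + c" by (rule growth[OF i])
    also have "\<dots> \<le> (norm (y i) + c) * exp (max 0 (s - \<tau>))" using Z i mem by (auto simp: Inv_def)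
    also have "\<dots> \<le> (norm (y i) + c) * exp s" using s \<tau>(1) c by (intro mult_left_mono) auto
    finally show ?thesis .
  qed
  have Inv0: "Inv (\<lambda>i t. y i)"
    unfolding Inv_def
  proof (intro allI impI conjI ballI)
    fix i t assume "t \<in> {0..T}"
    then have "(norm (y i) + c) * 1 \<le> (norm (y i) + c) * exp t" using c by (intro mult_left_mono) auto
    then show "norm (y i) + c \<le> (norm (y i) + c) * exp t" by simp
  qed simp
  have Inv\<Phi>: "Inv (\<Phi> Z)" if Z: "Inv Z" for Z
    unfolding Inv_def
  proof (intro allI impI conjI ballI)
    fix i assume i: "i < N"
    note C = Vcont[OF Z i]
    show "continuous_on {0..T} (\<Phi> Z i)"
      unfolding \<Phi>_def by (intro continuous_intros indefinite_integral_continuous_1 integrable_continuous_interval C)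
    fix t assume t: "t \<in> {0..T}"
    have exp_int: "((\<lambda>s. (norm (y i) + c) * exp s) has_integral (norm (y i) + c) * exp t - (norm (y i) + c) * exp 0) {0..t}"
      using t by (intro fundamental_theorem_of_calculus)
        (auto intro!: derivative_eq_intros simp flip: has_real_derivative_iff_has_vector_derivative)
    have "norm (integral {0..t} (\<lambda>s. V (\<lambda>j. Z j (max 0 (s - \<tau>))) i)) \<le> integral {0..t} (\<lambda>s. (norm (y i) + c) * exp s)"
      using t exp_int by (intro integral_norm_bound_integral integrable_continuous_interval continuous_on_subset[OF C] Vbound[OF Z i])
        (auto intro!: continuous_intros)
    also have "\<dots> = (norm (y i) + c) * exp t - (norm (y i) + c)"
      using integral_unique[OF exp_int] by simp
    finally show "norm (\<Phi> Z i t) + c \<le> (norm (y i) + c) * exp t"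
      unfolding \<Phi>_def using norm_triangle_ineq[of "y i" "integral {0..t} (\<lambda>s. V (\<lambda>j. Z j (max 0 (s - \<tau>))) i)"] by linarith
  qed
  have Inv: "Inv ((\<Phi> ^^ k) (\<lambda>i t. y i))" for k
    by (induction k) (use Inv0 Inv\<Phi> in auto)
  \<comment> \<open>Continuity applied to a constant sequence: nothing is assumed about indices from
    \<open>N\<close> on, so \<open>V\<close> cannot depend on them.\<close>
  have dep: "V z i = V z' i" if "\<And>j. j < N \<Longrightarrow> z j = z' j" "i < N" for z z' i
  proof -
    have "(\<lambda>k::nat. V z i) \<longlonglongrightarrow> V z' i" by (rule cont[of "\<lambda>_. z"]) (use that in auto)
    then show ?thesis by (simp add: LIMSEQ_const_iff)
  qed
  \<comment> \<open>At time \<open>s\<close> the integrand looks back to \<open>s - \<tau>\<close>,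
    so each iteration settles one further interval of length \<tau>.\<close>
  have stat: "\<forall>i<N. \<forall>t\<in>{0..T}. t \<le> real k * \<tau> \<longrightarrow> \<Phi> ((\<Phi> ^^ k) (\<lambda>i t. y i)) i t = (\<Phi> ^^ k) (\<lambda>i t. y i) i t" for k
  proof (induction k)
    case 0
    show ?case by (auto simp: \<Phi>_def)
  next
    case (Suc k)
    let ?Z = "(\<Phi> ^^ k) (\<lambda>i t. y i)"
    have "\<Phi> (\<Phi> ?Z) i t = \<Phi> ?Z i t" if i: "i < N" and t: "t \<in> {0..T}" "t \<le> real (Suc k) * \<tau>" for i t
    proof -
      have "integral {0..t} (\<lambda>s. V (\<lambda>j. \<Phi> ?Z j (max 0 (s - \<tau>))) i) = integral {0..t} (\<lambda>s. V (\<lambda>j. ?Z j (max 0 (s - \<tau>))) i)"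
      proof (rule integral_cong, rule dep[OF _ i])
        fix s j assume s: "s \<in> {0..t}" and j: "j < N"
        have "max 0 (s - \<tau>) \<in> {0..T}" "max 0 (s - \<tau>) \<le> real k * \<tau>"
          using s t \<tau>(1) by (auto simp: algebra_simps)
        then show "\<Phi> ?Z j (max 0 (s - \<tau>)) = ?Z j (max 0 (s - \<tau>))" using Suc j by blast
      qed
      then show ?thesis unfolding \<Phi>_def[of "\<Phi> ?Z"] \<Phi>_def[of ?Z] by simp
    qed
    then show ?case by simp
  qed
  let ?W = "(\<Phi> ^^ n) (\<lambda>i t. y i)"
  show ?thesis
  proof (intro exI[of _ ?W] allI impI conjI ballI)
    fix i assume i: "i < N"
    show "continuous_on {0..T} (?W i)" using Inv[of n] i by (simp add: Inv_def)
    show "continuous_on {0..T} (\<lambda>s. V (\<lambda>j. ?W j (max 0 (s - \<tau>))) i)" by (rule Vcont[OF Inv i])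
    fix t assume t: "t \<in> {0..T}"
    show "norm (?W i t) + c \<le> (norm (y i) + c) * exp t" using Inv[of n] i t by (simp add: Inv_def)
    show "?W i t = y i + integral {0..t} (\<lambda>s. V (\<lambda>j. ?W j (max 0 (s - \<tau>))) i)"
      using stat[of n] i t \<tau>(2) unfolding \<Phi>_def[of ?W] by fastforce
    have "norm (V (\<lambda>j. ?W j (max 0 (t - \<tau>))) i) \<le> (norm (y i) + c) * exp t" by (rule Vbound[OF Inv i t])
    also have "\<dots> \<le> (norm (y i) + c) * exp T" using t c by (intro mult_left_mono) auto
    finally show "norm (V (\<lambda>j. ?W j (max 0 (t - \<tau>))) i) \<le> (norm (y i) + c) * exp T" .
  qed
qed

text \<open>The index becomes a real coordinate, so that the finite family is one function on a
  compact set; the floor decodes it. Points closer than 1/2 have the same index, which is why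
  equicontinuity has to be checked only in time.\<close>

lemma finite_family_Arzela_Ascoli:
  fixes W :: "nat \<Rightarrow> nat \<Rightarrow> real \<Rightarrow> 'a::euclidean_space"
  assumes bound: "\<And>k i t. i < N \<Longrightarrow> t \<in> {0..T} \<Longrightarrow> norm (W k i t) \<le> B"
    and lip: "\<And>k i s t. i < N \<Longrightarrow> s \<in> {0..T} \<Longrightarrow> t \<in> {0..T} \<Longrightarrow> norm (W k i s - W k i t) \<le> L * \<bar>s - t\<bar>"
    and L: "L \<ge> 0"
  obtains Z k where "strict_mono (k :: nat \<Rightarrow> nat)"
    "\<forall>i<N. \<forall>t\<in>{0..T}. (\<lambda>n. W (k n) i t) \<longlonglongrightarrow> Z i t"
proof -
  let ?S = "{0..T} \<times> (real ` {..<N})"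
  let ?F = "\<lambda>k (p :: real \<times> real). W k (nat \<lfloor>snd p\<rfloor>) (fst p)"
  obtain g k where gk: "strict_mono (k :: nat \<Rightarrow> nat)"
    "\<And>e. 0 < e \<Longrightarrow> \<exists>M. \<forall>n x. n \<ge> M \<and> x \<in> ?S \<longrightarrow> norm (?F (k n) x - g x) < e"
  proof (rule Arzela_Ascoli[of ?S ?F B])
    show "compact ?S" by (rule compact_Times[OF compact_Icc finite_imp_compact]) auto
    show "norm (?F n x) \<le> B" if "x \<in> ?S" for n x using that by (auto intro!: bound)
    show "\<exists>d>0. \<forall>n y. y \<in> ?S \<and> norm (x - y) < d \<longrightarrow> norm (?F n x - ?F n y) < e" if x: "x \<in> ?S" and e: "e > 0" for x e
    proof -
      obtain s i where xi: "x = (s, real i)" "s \<in> {0..T}" "i < N" using x by auto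
      let ?d = "min (1/2) (e / (L + 1))"
      show ?thesis
      proof (intro exI[of _ ?d] conjI allI impI)
        show "?d > 0" using e L by simp
        fix n y assume y: "y \<in> ?S \<and> norm (x - y) < ?d"
        then obtain t j where yj: "y = (t, real j)" "t \<in> {0..T}" "j < N" by auto
        have d1: "\<bar>s - t\<bar> \<le> norm (x - y)" "\<bar>real i - real j\<bar> \<le> norm (x - y)"
          using norm_fst_le[of "s - t" "real i - real j"] norm_snd_le[of "real i - real j" "s - t"] xi yj by auto
        then have "\<bar>real i - real j\<bar> < 1" using y by linarith
        then have "i = j" by linarith
        have "norm (?F n x - ?F n y) \<le> L * \<bar>s - t\<bar>"
          unfolding xi(1) yj(1) using lip[OF xi(3,2) yj(2)] \<open>i = j\<close> by simp
        also have "\<dots> \<le> (L + 1) * \<bar>s - t\<bar>" by (simp add: algebra_simps)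
        also have "\<dots> < e" using d1 y L by (simp add: field_simps) (smt (verit) mult_left_mono)
        finally show "norm (?F n x - ?F n y) < e" .
      qed
    qed
  qed (use that in blast)
  show ?thesis
  proof (rule that[of k "\<lambda>i t. g (t, real i)", OF gk(1)], intro allI impI ballI)
    fix i t assume it: "i < N" "t \<in> {0..T}"
    show "(\<lambda>n. W (k n) i t) \<longlonglongrightarrow> g (t, real i)"
      unfolding LIMSEQ_def dist_norm
    proof (intro allI impI)
      fix e :: real assume "e > 0"
      from gk(2)[OF this] obtain M where "\<forall>n x. n \<ge> M \<and> x \<in> ?S \<longrightarrow> norm (?F (k n) x - g x) < e" by blast
      then have "\<forall>n\<ge>M. norm (?F (k n) (t, real i) - g (t, real i)) < e" using it by blast
      then show "\<exists>M. \<forall>n\<ge>M. norm (W (k n) i t - g (t, real i)) < e" by auto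
    qed
  qed
qed

text \<open>The delayed solutions share the Lipschitz constant \<open>L = (B + c) * exp T\<close>. A
  subsequence converges as the delays tend to 0, and replacing a delayed argument by the current one
  costs at most \<open>L\<close> times the delay, so the limit solves the undelayed integral
  equation.\<close>

theorem peano_finite_family:
  fixes V :: "(nat \<Rightarrow> 'a::euclidean_space) \<Rightarrow> nat \<Rightarrow> 'a" and y :: "nat \<Rightarrow> 'a"
  assumes T: "T > 0" and c: "c \<ge> 0" and B: "\<And>i. i < N \<Longrightarrow> norm (y i) \<le> B"
    and growth: "\<And>z i. i < N \<Longrightarrow> norm (V z i) \<le> norm (z i) + c"
    and cont: "\<And>Z z i. (\<And>j. j < N \<Longrightarrow> (\<lambda>k. Z k j) \<longlonglongrightarrow> z j) \<Longrightarrow> i < N \<Longrightarrow> (\<lambda>k. V (Z k) i) \<longlonglongrightarrow> V z i"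
  obtains Z where "\<forall>i<N. Z i 0 = y i"
    "\<forall>i<N. \<forall>t\<in>{0..T}. norm (Z i t) + c \<le> (B + c) * exp T"
    "\<forall>i<N. \<forall>t\<in>{0..T}. (Z i has_vector_derivative V (\<lambda>j. Z j t) i) (at t within {0..T})"
proof (cases "N = 0")
  case True
  then show ?thesis using that by auto
next
  case False
  then have "B \<ge> 0" using B[of 0] norm_ge_zero order_trans by blast
  define L where "L = (B + c) * exp T"
  have L: "L \<ge> 0" using \<open>B \<ge> 0\<close> c by (simp add: L_def)
  \<comment> \<open>Chosen so that \<open>Suc k\<close> intervals of length \<open>\<tau> k\<close>
    fill \<open>{0..T}\<close>, as \<open>delay_solution\<close> requires.\<close>
  define \<tau> where "\<tau> k = T / real (Suc k)" for k
  have \<tau>: "\<tau> k > 0" "T \<le> real (Suc k) * \<tau> k" for k using T by (auto simp: \<tau>_def)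
  have "\<forall>k. \<exists>W. \<forall>i<N. continuous_on {0..T} (W i) \<and>
    (\<forall>t\<in>{0..T}. norm (W i t) + c \<le> (norm (y i) + c) * exp t \<and>
      W i t = y i + integral {0..t} (\<lambda>s. V (\<lambda>j. W j (max 0 (s - \<tau> k))) i)) \<and>
    continuous_on {0..T} (\<lambda>s. V (\<lambda>j. W j (max 0 (s - \<tau> k))) i) \<and>
    (\<forall>s\<in>{0..T}. norm (V (\<lambda>j. W j (max 0 (s - \<tau> k))) i) \<le> (norm (y i) + c) * exp T)"
    by (intro allI delay_solution[where V=V and N=N, OF T c \<tau> growth cont])
  from choice[OF this] obtain W where W: "\<forall>k. \<forall>i<N. continuous_on {0..T} (W k i) \<and>
    (\<forall>t\<in>{0..T}. norm (W k i t) + c \<le> (norm (y i) + c) * exp t \<and>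
      W k i t = y i + integral {0..t} (\<lambda>s. V (\<lambda>j. W k j (max 0 (s - \<tau> k))) i)) \<and>
    continuous_on {0..T} (\<lambda>s. V (\<lambda>j. W k j (max 0 (s - \<tau> k))) i) \<and>
    (\<forall>s\<in>{0..T}. norm (V (\<lambda>j. W k j (max 0 (s - \<tau> k))) i) \<le> (norm (y i) + c) * exp T)" by blast
  have yL: "(norm (y i) + c) * exp t \<le> L" if "i < N" "t \<le> T" for i t
    unfolding L_def using B[OF that(1)] that(2) c \<open>B \<ge> 0\<close> by (intro mult_mono) auto
  have Wb: "norm (W k i t) + c \<le> L" if "i < N" "t \<in> {0..T}" for k i t
  proof -
    have "norm (W k i t) + c \<le> (norm (y i) + c) * exp t" using W that by blast
    then show ?thesis using yL[OF that(1), of t] that(2) by simp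
  qed
  have Weq: "W k i t = y i + integral {0..t} (\<lambda>s. V (\<lambda>j. W k j (max 0 (s - \<tau> k))) i)" if "i < N" "t \<in> {0..T}" for k i t
    using W that by blast
  have VL: "norm (V (\<lambda>j. W k j (max 0 (s - \<tau> k))) i) \<le> L" if "i < N" "s \<in> {0..T}" for k i s
  proof -
    have "norm (V (\<lambda>j. W k j (max 0 (s - \<tau> k))) i) \<le> (norm (y i) + c) * exp T" using W that by blast
    then show ?thesis using yL[OF that(1) order_refl] by linarith
  qed
  have Vc: "continuous_on {0..T} (\<lambda>s. V (\<lambda>j. W k j (max 0 (s - \<tau> k))) i)" if "i < N" for k i
    using W that by blast
  have lip0: "norm (W k i t - W k i s) \<le> L * (t - s)" if i: "i < N" and st: "0 \<le> s" "s \<le> t" "t \<le> T" for k i s t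
  proof -
    let ?f = "\<lambda>s. V (\<lambda>j. W k j (max 0 (s - \<tau> k))) i"
    have c1: "continuous_on {0..t} ?f" "continuous_on {s..t} ?f"
      by (rule continuous_on_subset[OF Vc[OF i]]; use st in auto)+
    have "integral {0..s} ?f + integral {s..t} ?f = integral {0..t} ?f"
      using st by (intro Henstock_Kurzweil_Integration.integral_combine integrable_continuous_interval c1) auto
    then have "W k i t - W k i s = integral {s..t} ?f"
      using Weq[OF i, of t k] Weq[OF i, of s k] st by (simp add: algebra_simps)
    also have "norm \<dots> \<le> L * (t - s)"
      by (rule integral_bound[OF st(2) c1(2)]) (use VL[OF i] st in auto)
    finally show ?thesis .
  qed
  have lip: "norm (W k i s - W k i t) \<le> L * \<bar>s - t\<bar>" if i: "i < N" and st: "s \<in> {0..T}" "t \<in> {0..T}" for k i s t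
    using lip0[OF i, of s t k] lip0[OF i, of t s k] st by (cases "s \<le> t") (auto simp: norm_minus_commute)
  have Wn: "norm (W k i t) \<le> L" if "i < N" "t \<in> {0..T}" for k i t using Wb[OF that] c by (smt (verit))
  have "\<exists>Z q. strict_mono (q :: nat \<Rightarrow> nat) \<and> (\<forall>i<N. \<forall>t\<in>{0..T}. (\<lambda>n. W (q n) i t) \<longlonglongrightarrow> Z i t)"
    by (rule finite_family_Arzela_Ascoli[of N T W L L, OF Wn lip L]) (assumption | (intro exI conjI, assumption, assumption))+
  then obtain Z q where q1: "strict_mono (q :: nat \<Rightarrow> nat)"
    and q2: "\<forall>i<N. \<forall>t\<in>{0..T}. (\<lambda>n. W (q n) i t) \<longlonglongrightarrow> Z i t" by blast
  note q = q1 q2[rule_format]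
  have \<tau>q: "(\<lambda>n. \<tau> (q n)) \<longlonglongrightarrow> 0"
    using LIMSEQ_subseq_LIMSEQ[OF LIMSEQ_Suc[OF lim_const_over_n[of T]] q(1)] by (simp add: \<tau>_def comp_def del: of_nat_Suc)
  have shifted: "(\<lambda>n. W (q n) j (max 0 (s - \<tau> (q n)))) \<longlonglongrightarrow> Z j s" if j: "j < N" and s: "s \<in> {0..T}" for j s
  proof -
    have "(\<lambda>n. W (q n) j (max 0 (s - \<tau> (q n))) - W (q n) j s) \<longlonglongrightarrow> 0"
    proof (rule Lim_null_comparison[of _ "\<lambda>n. L * \<tau> (q n)"])
      have "norm (W (q n) j (max 0 (s - \<tau> (q n))) - W (q n) j s) \<le> L * \<tau> (q n)" for n
      proof -
        have mem: "max 0 (s - \<tau> (q n)) \<in> {0..T}" using s \<tau>(1)[of "q n"] by auto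
        have "norm (W (q n) j (max 0 (s - \<tau> (q n))) - W (q n) j s) \<le> L * \<bar>max 0 (s - \<tau> (q n)) - s\<bar>"
          by (rule lip[OF j mem s])
        also have "\<dots> \<le> L * \<tau> (q n)" using s \<tau>(1)[of "q n"] L by (intro mult_left_mono) auto
        finally show ?thesis .
      qed
      then show "\<forall>\<^sub>F n in sequentially. norm (W (q n) j (max 0 (s - \<tau> (q n))) - W (q n) j s) \<le> L * \<tau> (q n)" by simp
      show "(\<lambda>n. L * \<tau> (q n)) \<longlonglongrightarrow> 0" using tendsto_mult_right_zero[OF \<tau>q] by simp
    qed
    from tendsto_add[OF this q(2)[OF j s]] show ?thesis by simp
  qed
  have Zlip: "norm (Z i s - Z i t) \<le> L * \<bar>s - t\<bar>" if "i < N" "s \<in> {0..T}" "t \<in> {0..T}" for i s t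
    by (rule LIMSEQ_le_const2[OF tendsto_norm[OF tendsto_diff[OF q(2) q(2)]]]) (use that lip in auto)
  have Zc: "continuous_on {0..T} (Z i)" if "i < N" for i
  proof (rule lipschitz_on_continuous_on)
    show "L-lipschitz_on {0..T} (Z i)"
      by (rule lipschitz_onI) (use Zlip[OF that] L in \<open>auto simp: dist_norm\<close>)
  qed
  have VZc: "continuous_on {0..T} (\<lambda>s. V (\<lambda>j. Z j s) i)" if i: "i < N" for i
    unfolding continuous_on_sequentially comp_def
  proof (intro allI ballI impI, elim conjE)
    fix s a assume "a \<in> {0..T}" "\<forall>k. s k \<in> {0..T}" "s \<longlonglongrightarrow> a"
    then show "(\<lambda>k. V (\<lambda>j. Z j (s k)) i) \<longlonglongrightarrow> V (\<lambda>j. Z j a) i"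
      by (intro cont[OF _ i] continuous_on_tendsto_compose[OF Zc]) auto
  qed
  have Zeq: "Z i t = y i + integral {0..t} (\<lambda>s. V (\<lambda>j. Z j s) i)" if i: "i < N" and t: "t \<in> {0..T}" for i t
  proof -
    have "(\<lambda>n. integral {0..t} (\<lambda>s. V (\<lambda>j. W (q n) j (max 0 (s - \<tau> (q n)))) i)) \<longlonglongrightarrow> integral {0..t} (\<lambda>s. V (\<lambda>j. Z j s) i)"
    proof (rule dominated_convergence(2)[where h="\<lambda>_. L"])
      show "(\<lambda>s. V (\<lambda>j. W (q n) j (max 0 (s - \<tau> (q n)))) i) integrable_on {0..t}" for n
        by (intro integrable_continuous_interval continuous_on_subset[OF Vc[OF i]]) (use t in auto)
      show "(\<lambda>n. V (\<lambda>j. W (q n) j (max 0 (s - \<tau> (q n)))) i) \<longlonglongrightarrow> V (\<lambda>j. Z j s) i" if "s \<in> {0..t}" for s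
        by (rule cont[OF shifted i]) (use that t in auto)
      show "norm (V (\<lambda>j. W (q n) j (max 0 (s - \<tau> (q n)))) i) \<le> L" if "s \<in> {0..t}" for n s
        by (rule VL[OF i]) (use that t in auto)
    qed (rule integrable_const_ivl)
    then have "(\<lambda>n. W (q n) i t) \<longlonglongrightarrow> y i + integral {0..t} (\<lambda>s. V (\<lambda>j. Z j s) i)"
      unfolding Weq[OF i t] by (intro tendsto_add tendsto_const)
    then show ?thesis using LIMSEQ_unique q(2)[OF i t] by blast
  qed
  show ?thesis
  proof (rule that; intro allI impI ballI)
    fix i assume i: "i < N"
    show "Z i 0 = y i" using Zeq[OF i, of 0] T by simp
    fix t assume t: "t \<in> {0..T}"
    show "norm (Z i t) + c \<le> (B + c) * exp T"
      unfolding L_def[symmetric]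
      by (rule LIMSEQ_le_const2[OF tendsto_add[OF tendsto_norm[OF q(2)[OF i t]] tendsto_const]]) (use Wb[OF i t] in auto)
    have "((\<lambda>t. y i + integral {0..t} (\<lambda>s. V (\<lambda>j. Z j s) i)) has_vector_derivative 0 + V (\<lambda>j. Z j t) i) (at t within {0..T})"
      by (intro has_vector_derivative_add has_vector_derivative_const integral_has_vector_derivative[OF VZc[OF i] t])
    then have "((\<lambda>t. y i + integral {0..t} (\<lambda>s. V (\<lambda>j. Z j s) i)) has_vector_derivative V (\<lambda>j. Z j t) i) (at t within {0..T})"
      by simp
    then show "(Z i has_vector_derivative V (\<lambda>j. Z j t) i) (at t within {0..T})"
      by (rule has_vector_derivative_transform[OF t, rotated]) (use Zeq[OF i] in auto)
  qed
qed

section \<open>The rotation \<open>Jmat\<close> and the particle system\<close>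

lemma Jmat_nth: "(Jmat *v v) $ 1 = - v $ 2" "(Jmat *v v) $ 2 = v $ 1" "(Jmat *v v) $ 3 = 0"
  by (simp_all add: Jmat_def matrix_vector_mult_def sum_3)

lemma norm_Jmat_le: "norm (Jmat *v v) \<le> norm v"
proof -
  have "(norm (Jmat *v v))\<^sup>2 \<le> (norm v)\<^sup>2"
    by (simp only: power2_norm_eq_inner inner_vec_def sum_3 Jmat_nth inner_real_def) (simp add: power2_eq_square)
  then show ?thesis by (rule power2_le_imp_le) simp
qed

lemma inner_Jmat: "v \<bullet> (Jmat *v v) = 0"
  by (simp add: inner_vec_def sum_3 Jmat_nth)

context unit_domain
begin

theorem particle_flow_exists:
  fixes y :: "nat \<Rightarrow> real^3"
  assumes T: "T > 0" and m: "masses N m" and \<zeta>: "inj_on (\<lambda>i. y i $ 3) {..<N}"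
    and B: "\<And>i. i < N \<Longrightarrow> norm (y i) \<le> B"
  obtains Z where "\<forall>i<N. Z i 0 = y i"
    "\<forall>i<N. \<forall>t\<in>{0..T}. Z i t $ 3 = y i $ 3"
    "\<forall>i<N. \<forall>t\<in>{0..T}. norm (Z i t) + r \<le> (B + r) * exp T"
    "\<forall>i<N. \<forall>t\<in>{0..T}.
      (Z i has_vector_derivative Jmat *v (Z i t - (1 / m i) *\<^sub>R bary N m (\<lambda>j. Z j t) i)) (at t within {0..T})"
proof -
  \<comment> \<open>Peano's theorem needs a continuous field on all configurations, even those with
    coinciding points, which have no usable cells. Overwriting third coordinates by the initial ones
    keeps the points distinct; as the field preserves third coordinates, the solution does not
    notice the change.\<close>
  define lift where "lift z j = (\<chi> k. if k = 3 then y j $ 3 else z j $ k)" for z :: "nat \<Rightarrow> real^3" and j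
  define V where "V z i = Jmat *v (z i - (1 / m i) *\<^sub>R bary N m (lift z) i)" for z i
  have lift3: "lift z j $ 3 = y j $ 3" for z j by (simp add: lift_def)
  have inj: "inj_on (lift z) {..<N}" for z using \<zeta> lift3 unfolding inj_on_def by metis
  have growth: "norm (V z i) \<le> norm (z i) + r" if i: "i < N" for z i
  proof -
    have "m i > 0" using m i by (simp add: masses_def)
    have "norm (V z i) \<le> norm (z i - (1 / m i) *\<^sub>R bary N m (lift z) i)" unfolding V_def by (rule norm_Jmat_le)
    also have "\<dots> \<le> norm (z i) + norm ((1 / m i) *\<^sub>R bary N m (lift z) i)" by (rule norm_triangle_ineq4)
    also have "norm ((1 / m i) *\<^sub>R bary N m (lift z) i) \<le> r"
      using norm_bary[OF m inj i, of z] \<open>m i > 0\<close> by (simp add: field_simps)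
    finally show ?thesis by simp
  qed
  have cont: "(\<lambda>k. V (Y k) i) \<longlonglongrightarrow> V z i" if conv: "\<And>j. j < N \<Longrightarrow> (\<lambda>k. Y k j) \<longlonglongrightarrow> z j" and i: "i < N" for Y z i
  proof -
    have "(\<lambda>k. bary N m (lift (Y k)) i) \<longlonglongrightarrow> bary N m (lift z) i"
    proof (rule bary_tendsto[OF m \<zeta> _ _ _ i])
      fix j assume j: "j < N"
      show "(\<lambda>k. lift (Y k) j) \<longlonglongrightarrow> lift z j"
        unfolding lift_def
      proof (rule vec_tendstoI)
        fix k
        show "(\<lambda>n. (\<chi> k. if k = 3 then y j $ 3 else Y n j $ k) $ k) \<longlonglongrightarrow> (\<chi> k. if k = 3 then y j $ 3 else z j $ k) $ k"
          using tendsto_vec_nth[OF conv[OF j], of k] by simp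
      qed
    qed (simp_all add: lift3)
    then have "(\<lambda>k. Y k i - (1 / m i) *\<^sub>R bary N m (lift (Y k)) i) \<longlonglongrightarrow> z i - (1 / m i) *\<^sub>R bary N m (lift z) i"
      by (intro tendsto_intros conv[OF i])
    then show ?thesis
      unfolding V_def by (rule bounded_linear.tendsto[OF matrix_vector_mul_bounded_linear])
  qed
  obtain Z where Z0: "\<forall>i<N. Z i 0 = y i"
    "\<forall>i<N. \<forall>t\<in>{0..T}. norm (Z i t) + r \<le> (B + r) * exp T"
    "\<forall>i<N. \<forall>t\<in>{0..T}. (Z i has_vector_derivative V (\<lambda>j. Z j t) i) (at t within {0..T})"
    using peano_finite_family[where V=V and N=N and y=y, OF T r_nonneg B growth cont] by blast
  note Z = Z0[rule_format]
  have third: "Z i t $ 3 = y i $ 3" if i: "i < N" and t: "t \<in> {0..T}" for i t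
  proof -
    have "\<exists>c. \<forall>t\<in>{0..T}. Z i t $ 3 = c"
    proof (rule has_derivative_zero_constant)
      fix s assume s: "s \<in> {0..T}"
      have "((\<lambda>t. Z i t $ 3) has_derivative (\<lambda>h. (h *\<^sub>R V (\<lambda>j. Z j s) i) $ 3)) (at s within {0..T})"
        using bounded_linear.has_derivative[OF bounded_linear_vec_nth Z(3)[OF i s, unfolded has_vector_derivative_def]] .
      then show "((\<lambda>t. Z i t $ 3) has_derivative (\<lambda>h. 0)) (at s within {0..T})"
        by (simp add: V_def Jmat_nth)
    qed simp
    then show ?thesis using t T Z(1)[OF i] by (metis atLeastAtMost_iff less_imp_le order_refl)
  qed
  have "V (\<lambda>j. Z j t) i = Jmat *v (Z i t - (1 / m i) *\<^sub>R bary N m (\<lambda>j. Z j t) i)" if i: "i < N" and t: "t \<in> {0..T}" for i t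
  proof -
    \<comment> \<open>\<open>bary_tendsto\<close> on a constant sequence serves as a congruence
      rule, since the two configurations are known to agree only at indices below
      \<open>N\<close>.\<close>
    have "(\<lambda>k::nat. bary N m (lift (\<lambda>j. Z j t)) i) \<longlonglongrightarrow> bary N m (\<lambda>j. Z j t) i"
    proof (rule bary_tendsto[OF m \<zeta> _ _ _ i])
      fix j assume j: "j < N"
      have "lift (\<lambda>j. Z j t) j = Z j t" using third[OF j t] by (simp add: lift_def vec_eq_iff)
      then show "(\<lambda>k::nat. lift (\<lambda>j. Z j t) j) \<longlonglongrightarrow> Z j t" by simp
    qed (use third[OF _ t] lift3 in auto)
    then show ?thesis by (simp add: LIMSEQ_const_iff V_def)
  qed
  then show ?thesis using that[of Z] Z third by simp
qed

end

section \<open>Weak formulation and energy along paths of potentials\<close>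

lemma smooth_compactD:
  assumes "smooth_compact \<phi>"
  shows "\<phi> differentiable (at p)" "continuous_on UNIV (\<lambda>p. frechet_derivative \<phi> (at p) v)" "continuous_on UNIV \<phi>"
proof -
  have "Ck (Suc 0) \<phi>" using assms by (simp only: smooth_compact_def)
  then show "\<phi> differentiable (at p)" "continuous_on UNIV (\<lambda>p. frechet_derivative \<phi> (at p) v)" by auto
  from \<open>Ck (Suc 0) \<phi>\<close> have "\<phi> differentiable_on UNIV" by (auto simp: differentiable_on_def)
  then show "continuous_on UNIV \<phi>" by (rule differentiable_imp_continuous_on)
qed

lemma continuous_tderiv:
  assumes "smooth_compact \<phi>" "continuous_on S f" "continuous_on S g"
  shows "continuous_on S (\<lambda>q. tderiv \<phi> (f q) (g q))"
  unfolding tderiv_def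
  by (rule continuous_on_compose2[OF smooth_compactD(2)[OF assms(1)], of S "\<lambda>q. (f q, g q)"])
    (auto intro!: continuous_intros assms)

lemma continuous_sgrad:
  assumes "smooth_compact \<phi>" "continuous_on S f" "continuous_on S g"
  shows "continuous_on S (\<lambda>q. sgrad \<phi> (f q) (g q))"
  unfolding sgrad_def
  by (intro continuous_on_vec_lambda continuous_on_compose2[OF smooth_compactD(2)[OF assms(1)], of S "\<lambda>q. (f q, g q)"])
    (auto intro!: continuous_intros assms)

lemma frechet_derivative_split:
  assumes "smooth_compact \<phi>"
  shows "frechet_derivative \<phi> (at (z, t)) (v, s) = sgrad \<phi> z t \<bullet> v + s * tderiv \<phi> z t"
proof -
  let ?D = "frechet_derivative \<phi> (at (z, t))"
  have lin: "linear ?D"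
    using smooth_compactD(1)[OF assms] by (rule linear_frechet_derivative)
  have "(v, s) = (\<Sum>i\<in>UNIV. v $ i *\<^sub>R (axis i 1, 0)) + s *\<^sub>R (0, 1)"
    using basis_expansion[of v] by (simp add: prod_eq_iff fst_sum snd_sum scalar_mult_eq_scaleR)
  then have "?D (v, s) = (\<Sum>i\<in>UNIV. v $ i * ?D (axis i 1, 0)) + s * ?D (0, 1)"
    by (simp add: linear_add[OF lin] linear_sum[OF lin] linear_scale[OF lin] del: scaleR_Pair)
  then show ?thesis by (simp add: sgrad_def tderiv_def inner_vec_def mult.commute)
qed

lemma inner_Jmat_left: "(Jmat *v x) \<bullet> v = - (x \<bullet> (Jmat *v v))"
  by (simp add: inner_vec_def sum_3 Jmat_nth)

text \<open>Optimality squeezes the increment of \<open>h\<close> at \<open>t\<close> between two increments: with \<open>b\<close> frozen at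
  \<open>t\<close> and with \<open>b\<close> frozen at \<open>s\<close>. Both are \<open>o(s - t)\<close>, although \<open>b\<close> is only continuous.\<close>

lemma constant_if_optimal:
  fixes Z b :: "nat \<Rightarrow> real \<Rightarrow> 'a::euclidean_space" and m :: "nat \<Rightarrow> real"
  assumes der: "\<And>i t. i < N \<Longrightarrow> t \<in> {0..T} \<Longrightarrow> (Z i has_vector_derivative Z' i t) (at t within {0..T})"
    and lip: "\<And>i s t. i < N \<Longrightarrow> s \<in> {0..T} \<Longrightarrow> t \<in> {0..T} \<Longrightarrow> norm (Z i s - Z i t) \<le> L * \<bar>s - t\<bar>"
    and b: "\<And>i. i < N \<Longrightarrow> continuous_on {0..T} (b i)"
    and opt: "\<And>s t. s \<in> {0..T} \<Longrightarrow> t \<in> {0..T} \<Longrightarrow> (\<Sum>i<N. b i t \<bullet> Z i s) \<le> (\<Sum>i<N. b i s \<bullet> Z i s)"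
    and orth: "\<And>i t. i < N \<Longrightarrow> t \<in> {0..T} \<Longrightarrow> (m i *\<^sub>R Z i t - b i t) \<bullet> Z' i t = 0"
  defines "h \<equiv> \<lambda>t. (\<Sum>i<N. m i / 2 * (Z i t \<bullet> Z i t)) - (\<Sum>i<N. b i t \<bullet> Z i t)"
  shows "\<exists>c. \<forall>t\<in>{0..T}. h t = c"
proof (rule has_derivative_zero_constant)
  fix t assume t: "t \<in> {0..T}"
  define U where "U s = (\<Sum>i<N. m i / 2 * (Z i s \<bullet> Z i s)) - (\<Sum>i<N. b i t \<bullet> Z i s)" for s
  have "(U has_derivative (\<lambda>k. (\<Sum>i<N. m i / 2 * (Z i t \<bullet> (k *\<^sub>R Z' i t) + (k *\<^sub>R Z' i t) \<bullet> Z i t)) - (\<Sum>i<N. b i t \<bullet> (k *\<^sub>R Z' i t)))) (at t within {0..T})"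
    unfolding U_def
    by (intro derivative_intros) (use der t in \<open>simp_all add: has_vector_derivative_def\<close>)
  moreover have "(\<Sum>i<N. m i / 2 * (Z i t \<bullet> (k *\<^sub>R Z' i t) + (k *\<^sub>R Z' i t) \<bullet> Z i t)) - (\<Sum>i<N. b i t \<bullet> (k *\<^sub>R Z' i t)) = 0" for k
  proof -
    have "(\<Sum>i<N. m i / 2 * (Z i t \<bullet> (k *\<^sub>R Z' i t) + (k *\<^sub>R Z' i t) \<bullet> Z i t)) - (\<Sum>i<N. b i t \<bullet> (k *\<^sub>R Z' i t))
        = (\<Sum>i<N. k * ((m i *\<^sub>R Z i t - b i t) \<bullet> Z' i t))"
      by (simp add: inner_diff_left inner_commute algebra_simps sum_subtractf)
    also have "\<dots> = 0" using orth t by simp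
    finally show ?thesis .
  qed
  ultimately have dU: "(U has_derivative (\<lambda>k. 0)) (at t within {0..T})" by simp
  then have limU: "((\<lambda>s. norm (U s - U t) / norm (s - t)) \<longlongrightarrow> 0) (at t within {0..T})"
    by (simp add: has_derivative_iff_norm)
  have bd: "norm (h s - h t) / norm (s - t) \<le> norm (U s - U t) / norm (s - t) + L * (\<Sum>i<N. norm (b i s - b i t))"
    if s: "s \<in> {0..T}" "s \<noteq> t" for s
  proof -
    have eq: "h s - h t = (U s - U t) - ((\<Sum>i<N. b i s \<bullet> Z i s) - (\<Sum>i<N. b i t \<bullet> Z i s))"
      by (simp add: h_def U_def)
    have up: "h s - h t \<le> U s - U t" using opt[OF s(1) t] eq by simp
    \<comment> \<open>The two frozen increments differ by a sum of products of increments. One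
      factor tends to 0 by continuity of \<open>b\<close>, the other is at most
      \<open>L * \<bar>s - t\<bar>\<close>, so no derivative of \<open>b\<close> is needed.\<close>
    have "(\<Sum>i<N. (b i s - b i t) \<bullet> (Z i s - Z i t)) = ((\<Sum>i<N. b i s \<bullet> Z i s) - (\<Sum>i<N. b i t \<bullet> Z i s)) - ((\<Sum>i<N. b i s \<bullet> Z i t) - (\<Sum>i<N. b i t \<bullet> Z i t))"
      by (simp add: inner_diff_left inner_diff_right sum_subtractf sum.distrib algebra_simps)
    then have low: "U s - U t - (\<Sum>i<N. (b i s - b i t) \<bullet> (Z i s - Z i t)) \<le> h s - h t"
      using opt[OF t s(1)] eq by simp
    have "\<bar>\<Sum>i<N. (b i s - b i t) \<bullet> (Z i s - Z i t)\<bar> \<le> (\<Sum>i<N. norm (b i s - b i t) * (L * \<bar>s - t\<bar>))"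
    proof (rule order_trans[OF sum_abs sum_mono])
      fix i assume i: "i \<in> {..<N}"
      have "\<bar>(b i s - b i t) \<bullet> (Z i s - Z i t)\<bar> \<le> norm (b i s - b i t) * norm (Z i s - Z i t)"
        by (rule Cauchy_Schwarz_ineq2)
      also have "\<dots> \<le> norm (b i s - b i t) * (L * \<bar>s - t\<bar>)"
        using i by (intro mult_left_mono lip s t) auto
      finally show "\<bar>(b i s - b i t) \<bullet> (Z i s - Z i t)\<bar> \<le> norm (b i s - b i t) * (L * \<bar>s - t\<bar>)" .
    qed
    also have "\<dots> = L * (\<Sum>i<N. norm (b i s - b i t)) * \<bar>s - t\<bar>"
      by (simp add: sum_distrib_left sum_distrib_right mult_ac)
    finally have "norm (h s - h t) \<le> norm (U s - U t) + L * (\<Sum>i<N. norm (b i s - b i t)) * \<bar>s - t\<bar>"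
      using up low by (auto simp: abs_le_iff)
    then show ?thesis using s(2) by (simp add: field_simps)
  qed
  have "((\<lambda>s. norm (U s - U t) / norm (s - t) + L * (\<Sum>i<N. norm (b i s - b i t))) \<longlongrightarrow> 0 + L * (\<Sum>i<N. norm (b i t - b i t))) (at t within {0..T})"
    using b t by (intro tendsto_intros limU) (auto simp: continuous_on_def)
  then have lim: "((\<lambda>s. norm (U s - U t) / norm (s - t) + L * (\<Sum>i<N. norm (b i s - b i t))) \<longlongrightarrow> 0) (at t within {0..T})"
    by simp
  have "((\<lambda>s. norm (h s - h t) / norm (s - t)) \<longlongrightarrow> 0) (at t within {0..T})"
  proof (rule Lim_null_comparison[OF _ lim])
    have "\<forall>\<^sub>F s in at t within {0..T}. s \<in> {0..T} \<and> s \<noteq> t" by (simp add: eventually_at_filter)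
    then show "\<forall>\<^sub>F s in at t within {0..T}. norm (norm (h s - h t) / norm (s - t)) \<le> norm (U s - U t) / norm (s - t) + L * (\<Sum>i<N. norm (b i s - b i t))"
      by eventually_elim (use bd in simp)
  qed
  then show "(h has_derivative (\<lambda>k. 0)) (at t within {0..T})"
    by (simp add: has_derivative_iff_norm)
qed simp

section \<open>Curves of potentials\<close>

context unit_domain
begin

text \<open>Continuity in time is required only at each fixed point; convergence of the gradients
  and the common bound \<open>R\<close> turn it into continuity of all the integrals and of
  \<open>W2\<close>.\<close>

definition potpath :: "real \<Rightarrow> real \<Rightarrow> (real \<Rightarrow> real^3 \<Rightarrow> real) \<Rightarrow> bool" where
  "potpath R T P \<longleftrightarrow> (\<forall>t\<in>{0..T}. pot R (P t)) \<and> (\<forall>x\<in>closure \<Omega>. continuous_on {0..T} (\<lambda>t. P t x))"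

lemma potpathD: "potpath R T P \<Longrightarrow> t \<in> {0..T} \<Longrightarrow> pot R (P t)"
  by (simp add: potpath_def)

lemma potpath_tendsto:
  assumes P: "potpath R T P" and s: "\<And>k. s k \<in> {0..T}" and t: "t \<in> {0..T}" and lim: "s \<longlonglongrightarrow> t" and x: "x \<in> \<Omega>"
  shows "(\<lambda>k. P (s k) x) \<longlonglongrightarrow> P t x"
proof -
  have "continuous_on {0..T} (\<lambda>t. P t x)" using P x closure_subset by (auto simp: potpath_def)
  then show ?thesis by (rule continuous_on_tendsto_compose[OF _ lim t]) (use s in simp)
qed

lemma potpath_W2_continuous:
  assumes P: "potpath R T P" shows "W2_continuous T (\<lambda>t. push (P t))"
  unfolding W2_continuous_def
proof (intro conjI ballI allI impI)
  show "push (P t) \<in> Pc" if "t \<in> {0..T}" for t by (rule push_in_Pc[OF potpathD[OF P that]])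
  fix t e :: real assume t: "t \<in> {0..T}" and e: "e > 0"
  show "\<exists>d>0. \<forall>s\<in>{0..T}. \<bar>s - t\<bar> < d \<longrightarrow> W2 (push (P s)) (push (P t)) < e"
  proof (rule ccontr)
    assume no: "\<not> ?thesis"
    have "\<exists>s\<in>{0..T}. \<bar>s - t\<bar> < 1 / real (Suc n) \<and> e \<le> W2 (push (P s)) (push (P t))" for n
    proof -
      have "1 / real (Suc n) > 0" by simp
      then show ?thesis using no by (metis not_less)
    qed
    then obtain s where s: "\<And>n. s n \<in> {0..T}" "\<And>n. \<bar>s n - t\<bar> < 1 / real (Suc n)" "\<And>n. e \<le> W2 (push (P (s n))) (push (P t))"
      by metis
    have "(\<lambda>n. s n - t) \<longlonglongrightarrow> 0"
      by (rule Lim_null_comparison[OF _ LIMSEQ_Suc[OF lim_1_over_n[where 'a=real]]])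
         (use s(2) in \<open>auto intro!: always_eventually less_imp_le simp del: of_nat_Suc\<close>)
    then have lim: "s \<longlonglongrightarrow> t" by (simp add: LIM_zero_iff)
    have "(\<lambda>n. sqrt (\<integral>x. (norm (grad (P (s n)) x - grad (P t) x))\<^sup>2 \<partial>\<mu>)) \<longlonglongrightarrow> sqrt 0"
      by (intro tendsto_real_sqrt grad_L2_tendsto[OF potpathD[OF P s(1)] potpathD[OF P t] potpathD[OF P t]]
        potpath_tendsto[OF P s(1) t lim] tendsto_const)
    moreover have "e \<le> sqrt (\<integral>x. (norm (grad (P (s n)) x - grad (P t) x))\<^sup>2 \<partial>\<mu>)" for n
      using s(3)[of n] W2_push_le[OF potpathD[OF P s(1)] potpathD[OF P t], of n] by linarith
    ultimately have "e \<le> sqrt 0" using LIMSEQ_le_const by blast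
    then show False using e by simp
  qed
qed

lemma potpath_integral_continuous:
  fixes g :: "(real^3) \<times> (real^3) \<times> real \<Rightarrow> real"
  assumes P: "potpath R T P" and g: "continuous_on UNIV g"
  shows "continuous_on {0..T} (\<lambda>t. \<integral>x. g (x, grad (P t) x, t) \<partial>\<mu>)"
  unfolding continuous_on_sequentially comp_def
proof (intro allI ballI impI, elim conjE)
  fix s t assume t: "t \<in> {0..T}" and s: "\<forall>k. s k \<in> {0..T}" and lim: "s \<longlonglongrightarrow> t"
  show "(\<lambda>k. \<integral>x. g (x, grad (P (s k)) x, s k) \<partial>\<mu>) \<longlonglongrightarrow> (\<integral>x. g (x, grad (P t) x, t) \<partial>\<mu>)"
    using s t by (intro integral_grad_tendsto[OF g potpathD[OF P] potpathD[OF P] potpath_tendsto[OF P _ t lim] lim]) auto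
qed

text \<open>The common form of the two double integrals of the weak formulation; continuity in
  \<open>t\<close> of the inner integral makes the outer one a Riemann integral.\<close>

definition spacetime :: "real \<Rightarrow> ((real^3) \<times> (real^3) \<times> real \<Rightarrow> real) \<Rightarrow> (real \<Rightarrow> real^3 \<Rightarrow> real) \<Rightarrow> real" where
  "spacetime T g P = integral {0..T} (\<lambda>t. \<integral>x. g (x, grad (P t) x, t) \<partial>\<mu>)"

lemma spacetime_tendsto:
  assumes F: "\<And>n. potpath R T (F n)" and P: "potpath R T P" and g: "continuous_on UNIV g"
    and conv: "\<And>t x. t \<in> {0..T} \<Longrightarrow> x \<in> \<Omega> \<Longrightarrow> (\<lambda>n. F n t x) \<longlonglongrightarrow> P t x"
  shows "(\<lambda>n. spacetime T g (F n)) \<longlonglongrightarrow> spacetime T g P"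
proof -
  obtain B where B: "\<And>\<psi> x t. pot R \<psi> \<Longrightarrow> x \<in> \<Omega> \<Longrightarrow> \<bar>t\<bar> \<le> T \<Longrightarrow> norm (g (x, grad \<psi> x, t)) \<le> B"
    using continuous_grad_bound[OF g] by blast
  show ?thesis
    unfolding spacetime_def
  proof (rule dominated_convergence(2)[where h="\<lambda>_. B"])
    show "(\<lambda>t. \<integral>x. g (x, grad (F n t) x, t) \<partial>\<mu>) integrable_on {0..T}" for n
      by (rule integrable_continuous_interval[OF potpath_integral_continuous[OF F g]])
    show "norm (\<integral>x. g (x, grad (F n t) x, t) \<partial>\<mu>) \<le> B" if t: "t \<in> {0..T}" for n t
    proof -
      have "norm (\<integral>x. g (x, grad (F n t) x, t) \<partial>\<mu>) \<le> (\<integral>x. norm (g (x, grad (F n t) x, t)) \<partial>\<mu>)"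
        by (rule integral_norm_bound)
      also have "\<dots> \<le> (\<integral>x. B \<partial>\<mu>)"
        by (rule integral_mono_AE)
          (use continuous_grad_integrable[OF g potpathD[OF F t]] B[OF potpathD[OF F t]] AE_dom t in \<open>auto elim!: eventually_mono\<close>)
      finally show ?thesis using prob_space by simp
    qed
    show "(\<lambda>n. \<integral>x. g (x, grad (F n t) x, t) \<partial>\<mu>) \<longlonglongrightarrow> (\<integral>x. g (x, grad (P t) x, t) \<partial>\<mu>)" if t: "t \<in> {0..T}" for t
      by (rule integral_grad_tendsto[OF g potpathD[OF F t] potpathD[OF P t] conv[OF t] tendsto_const])
  qed (rule integrable_const_ivl)
qed

text \<open>Named after the variable that \<open>Jmat\<close> acts on: the gradient \<open>y\<close>
  in dual space here, the point \<open>x\<close> of the physical domain in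
  \<open>physical_integrand\<close>.\<close>

definition dual_integrand :: "((real^3) \<times> real \<Rightarrow> real) \<Rightarrow> (real^3) \<times> (real^3) \<times> real \<Rightarrow> real" where
  "dual_integrand \<phi> = (\<lambda>(x, y, t). tderiv \<phi> y t + (Jmat *v y) \<bullet> sgrad \<phi> y t)"

definition physical_integrand :: "((real^3) \<times> real \<Rightarrow> real) \<Rightarrow> (real^3) \<times> (real^3) \<times> real \<Rightarrow> real" where
  "physical_integrand \<phi> = (\<lambda>(x, y, t). (Jmat *v x) \<bullet> sgrad \<phi> y t)"

lemma continuous_integrands:
  assumes "smooth_compact \<phi>"
  shows "continuous_on UNIV (dual_integrand \<phi>)" "continuous_on UNIV (physical_integrand \<phi>)"
proof -
  have J: "continuous_on S (\<lambda>q. Jmat *v f q)" if "continuous_on S f" for S and f :: "(real^3) \<times> (real^3) \<times> real \<Rightarrow> real^3"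
    using that by (rule bounded_linear.continuous_on[OF matrix_vector_mul_bounded_linear])
  show "continuous_on UNIV (dual_integrand \<phi>)" "continuous_on UNIV (physical_integrand \<phi>)"
    unfolding dual_integrand_def physical_integrand_def case_prod_unfold
    by (intro continuous_intros J continuous_tderiv[OF assms] continuous_sgrad[OF assms])+
qed

text \<open>Removes measures and \<open>brenier\<close> from the solution concept. What remains is
  an identity between integrals over the domain, which survives pointwise convergence of the
  potentials.\<close>

lemma geostrophic_solutionI:
  assumes P: "potpath R T P" and T: "T > 0"
    and weak: "\<And>\<phi>. smooth_compact \<phi> \<Longrightarrow> spacetime T (dual_integrand \<phi>) P - spacetime T (physical_integrand \<phi>) P
      = (\<integral>x. \<phi> (grad (P T) x, T) \<partial>\<mu>) - (\<integral>z. \<phi> (z, 0) \<partial>\<alpha>0)"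
  shows "geostrophic_solution \<Omega> T \<alpha>0 (\<lambda>t. push (P t))"
  unfolding geostrophic_solution_def
proof (intro conjI allI impI)
  show "W2_continuous T (\<lambda>t. push (P t))" by (rule potpath_W2_continuous[OF P])
  fix \<phi> :: "(real^3) \<times> real \<Rightarrow> real" assume \<phi>: "smooth_compact \<phi>"
  have J: "continuous_on UNIV (\<lambda>q::real^3. Jmat *v q)"
    by (rule bounded_linear.continuous_on[OF matrix_vector_mul_bounded_linear continuous_on_id])
  have 1: "integral {0..T} (\<lambda>t. \<integral>z. tderiv \<phi> z t + (Jmat *v z) \<bullet> sgrad \<phi> z t \<partial>push (P t)) = spacetime T (dual_integrand \<phi>) P"
    unfolding spacetime_def
  proof (rule integral_cong)
    fix t assume t: "t \<in> {0..T}"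
    have "(\<lambda>z. tderiv \<phi> z t + (Jmat *v z) \<bullet> sgrad \<phi> z t) \<in> borel_measurable borel"
      by (intro borel_measurable_continuous_onI continuous_intros continuous_tderiv[OF \<phi>] continuous_sgrad[OF \<phi>] J)
    from integral_push[OF potpathD[OF P t] this]
    show "(\<integral>z. tderiv \<phi> z t + (Jmat *v z) \<bullet> sgrad \<phi> z t \<partial>push (P t)) = (\<integral>x. dual_integrand \<phi> (x, grad (P t) x, t) \<partial>\<mu>)"
      by (simp add: dual_integrand_def)
  qed
  have 2: "integral {0..T} (\<lambda>t. \<integral>x. (Jmat *v x) \<bullet> sgrad \<phi> (grad (brenier \<Omega> (push (P t))) x) t \<partial>\<mu>) = spacetime T (physical_integrand \<phi>) P"
    unfolding spacetime_def
  proof (rule integral_cong)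
    fix t assume t: "t \<in> {0..T}"
    show "(\<integral>x. (Jmat *v x) \<bullet> sgrad \<phi> (grad (brenier \<Omega> (push (P t))) x) t \<partial>\<mu>) = (\<integral>x. physical_integrand \<phi> (x, grad (P t) x, t) \<partial>\<mu>)"
      by (rule Bochner_Integration.integral_cong) (auto simp: physical_integrand_def grad_brenier_push[OF potpathD[OF P t]])
  qed
  have "(\<lambda>z. \<phi> (z, T)) \<in> borel_measurable borel"
    by (intro borel_measurable_continuous_onI continuous_on_compose2[OF smooth_compactD(3)[OF \<phi>]] continuous_intros) auto
  from integral_push[OF potpathD[OF P] this] T
  have 3: "(\<integral>z. \<phi> (z, T) \<partial>push (P T)) = (\<integral>x. \<phi> (grad (P T) x, T) \<partial>\<mu>)" by simp
  show "integral {0..T} (\<lambda>t. \<integral>z. tderiv \<phi> z t + (Jmat *v z) \<bullet> sgrad \<phi> z t \<partial>push (P t)) -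
      integral {0..T} (\<lambda>t. \<integral>x. (Jmat *v x) \<bullet> sgrad \<phi> (grad (brenier \<Omega> (push (P t))) x) t \<partial>\<mu>) =
      (\<integral>z. \<phi> (z, T) \<partial>push (P T)) - (\<integral>z. \<phi> (z, 0) \<partial>\<alpha>0)"
    unfolding 1 2 3 by (rule weak[OF \<phi>])
qed

definition energy_density :: "(real^3) \<times> (real^3) \<times> real \<Rightarrow> real" where
  "energy_density = (\<lambda>(x, y, t). (1/2) * ((y $ 1 - x $ 1)\<^sup>2 + (y $ 2 - x $ 2)\<^sup>2) - x $ 3 * y $ 3)"

lemma continuous_energy_density: "continuous_on UNIV energy_density"
  unfolding energy_density_def case_prod_unfold by (intro continuous_intros)

lemma energy_push: "pot R \<psi> \<Longrightarrow> energy \<Omega> (push \<psi>) = (\<integral>x. energy_density (x, grad \<psi> x, 0) \<partial>\<mu>)"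
  unfolding energy_def energy_density_def by (rule Bochner_Integration.integral_cong) (auto simp: grad_brenier_push)

text \<open>What the limit needs from one approximation. The weak equation is kept a second time in
  terms of potentials, the form in which the limit is taken, and the last clause is equicontinuity
  in time in the form that \<open>pot_modulus\<close> accepts.\<close>

definition particle_path :: "real \<Rightarrow> real \<Rightarrow> (real \<Rightarrow> real^3 \<Rightarrow> real) \<Rightarrow> bool" where
  "particle_path R T P \<longleftrightarrow> potpath R T P \<and> discrete_geostrophic_solution \<Omega> T (push (P 0)) (\<lambda>t. push (P t)) \<and>
    (\<forall>\<phi>. smooth_compact \<phi> \<longrightarrow> spacetime T (dual_integrand \<phi>) P - spacetime T (physical_integrand \<phi>) P
      = (\<integral>x. \<phi> (grad (P T) x, T) \<partial>\<mu>) - (\<integral>z. \<phi> (z, 0) \<partial>push (P 0))) \<and>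
    (\<forall>t\<in>{0..T}. energy \<Omega> (push (P t)) = energy \<Omega> (push (P 0))) \<and>
    (\<forall>s\<in>{0..T}. \<forall>t\<in>{0..T}. \<forall>f :: real^3 \<Rightarrow> real. 1-lipschitz_on UNIV f \<longrightarrow>
      \<bar>(\<integral>x. f (grad (P s) x) \<partial>\<mu>) - (\<integral>x. f (grad (P t) x) \<partial>\<mu>)\<bar> \<le> R * \<bar>s - t\<bar>)"

text \<open>The flow bound gives \<open>norm (Z i t) + r \<le> R\<close>, which controls positions
  and, because barycentres have norm at most \<open>r\<close>, also speeds. The second clause
  records the initial measure through its moments.\<close>

theorem discrete_solution_exists:
  fixes y :: "nat \<Rightarrow> real^3"
  assumes T: "T > 0" and m: "masses N m" and \<zeta>: "inj_on (\<lambda>i. y i $ 3) {..<N}"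
    and B: "\<And>i. i < N \<Longrightarrow> norm (y i) \<le> B"
  defines "R \<equiv> (B + r) * exp T"
  shows "\<exists>P. particle_path R T P \<and>
    (\<forall>f :: real^3 \<Rightarrow> real. continuous_on UNIV f \<longrightarrow> (\<integral>x. f (grad (P 0) x) \<partial>\<mu>) = (\<Sum>i<N. m i * f (y i)))"
proof -
  obtain Z where Z0: "\<forall>i<N. Z i 0 = y i"
    "\<forall>i<N. \<forall>t\<in>{0..T}. Z i t $ 3 = y i $ 3"
    "\<forall>i<N. \<forall>t\<in>{0..T}. norm (Z i t) + r \<le> (B + r) * exp T"
    "\<forall>i<N. \<forall>t\<in>{0..T}. (Z i has_vector_derivative Jmat *v (Z i t - (1 / m i) *\<^sub>R bary N m (\<lambda>j. Z j t) i)) (at t within {0..T})"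
    using particle_flow_exists[OF T m \<zeta> B] by blast
  define z where "z t = (\<lambda>j. Z j t)" for t
  define b where "b i t = bary N m (z t) i" for i t
  define Z' where "Z' i t = Jmat *v (Z i t - (1 / m i) *\<^sub>R b i t)" for i t
  have init: "Z i 0 = y i" if "i < N" for i using Z0(1) that by blast
  have third: "Z i t $ 3 = y i $ 3" if "i < N" "t \<in> {0..T}" for i t using Z0(2) that by blast
  have Zr: "norm (Z i t) + r \<le> R" if "i < N" "t \<in> {0..T}" for i t using Z0(3) that unfolding R_def by blast
  have der: "(Z i has_vector_derivative Z' i t) (at t within {0..T})" if "i < N" "t \<in> {0..T}" for i t
    using Z0(4) that unfolding Z'_def b_def z_def by blast
  have ZR: "norm (Z i t) \<le> R" if "i < N" "t \<in> {0..T}" for i t using Zr[OF that] r_nonneg by linarith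
  have mpos: "m i > 0" if "i < N" for i using m that by (simp add: masses_def)
  have inj: "inj_on (z t) {..<N}" if t: "t \<in> {0..T}" for t
    using \<zeta> third[OF _ t] unfolding inj_on_def z_def by (metis lessThan_iff)
  have Zc: "continuous_on {0..T} (Z i)" if "i < N" for i
    using der[OF that] by (intro continuous_on_vector_derivative)
  have bc: "continuous_on {0..T} (b i)" if i: "i < N" for i
    unfolding continuous_on_sequentially comp_def b_def
  proof (intro allI ballI impI, elim conjE)
    fix s t assume t: "t \<in> {0..T}" and s: "\<forall>k. s k \<in> {0..T}" and lim: "s \<longlonglongrightarrow> t"
    show "(\<lambda>k. bary N m (z (s k)) i) \<longlonglongrightarrow> bary N m (z t) i"
    proof (rule bary_tendsto[OF m \<zeta> _ _ _ i])
      fix j assume j: "j < N"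
      show "(\<lambda>k. z (s k) j) \<longlonglongrightarrow> z t j" unfolding z_def
        by (rule continuous_on_tendsto_compose[OF Zc[OF j] lim t]) (use s in simp)
    qed (use third s t in \<open>auto simp: z_def\<close>)
  qed
  have Z'c: "continuous_on {0..T} (Z' i)" if i: "i < N" for i
    unfolding Z'_def
    by (intro bounded_linear.continuous_on[OF matrix_vector_mul_bounded_linear] continuous_intros Zc bc i)
  have Z'R: "norm (Z' i t) \<le> R" if i: "i < N" and t: "t \<in> {0..T}" for i t
  proof -
    have "norm (Z' i t) \<le> norm (Z i t - (1 / m i) *\<^sub>R b i t)" unfolding Z'_def by (rule norm_Jmat_le)
    also have "\<dots> \<le> norm (Z i t) + norm ((1 / m i) *\<^sub>R b i t)" by (rule norm_triangle_ineq4)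
    also have "norm ((1 / m i) *\<^sub>R b i t) \<le> r"
      using norm_bary[OF m inj[OF t] i] mpos[OF i] by (simp add: b_def field_simps)
    finally show ?thesis using Zr[OF i t] by linarith
  qed
  have lip: "norm (Z i s - Z i t) \<le> R * \<bar>s - t\<bar>" if i: "i < N" and st: "s \<in> {0..T}" "t \<in> {0..T}" for i s t
  proof -
    have "norm (Z i s - Z i t) \<le> R * norm (s - t)"
    proof (rule differentiable_bound[of "{0..T}" "Z i" "\<lambda>u k. k *\<^sub>R Z' i u"])
      show "(Z i has_derivative (\<lambda>k. k *\<^sub>R Z' i u)) (at u within {0..T})" if "u \<in> {0..T}" for u
        using der[OF i that] by (simp add: has_vector_derivative_def)
      show "onorm (\<lambda>k. k *\<^sub>R Z' i u) \<le> R" if "u \<in> {0..T}" for u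
        by (rule onorm_le) (use mult_right_mono[OF Z'R[OF i that] abs_ge_zero] in \<open>simp add: mult.commute\<close>)
    qed (use st in auto)
    then show ?thesis by simp
  qed
  define P where "P t = sdp N m (z t)" for t
  have p: "pot R (P t)" if t: "t \<in> {0..T}" for t
    unfolding P_def by (rule sd_pot[OF m inj[OF t]]) (use ZR t in \<open>simp add: z_def\<close>)
  have PP: "potpath R T P"
    unfolding potpath_def
  proof (intro conjI ballI)
    show "pot R (P t)" if "t \<in> {0..T}" for t by (rule p[OF that])
    fix x assume x: "x \<in> closure \<Omega>"
    show "continuous_on {0..T} (\<lambda>t. P t x)"
      unfolding continuous_on_sequentially comp_def
    proof (intro allI ballI impI, elim conjE)
      fix s t assume t: "t \<in> {0..T}" and s: "\<forall>k. s k \<in> {0..T}" and lim: "s \<longlonglongrightarrow> t"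
      have "(\<lambda>k. z (s k) j) \<longlonglongrightarrow> z t j" if j: "j < N" for j unfolding z_def
        by (rule continuous_on_tendsto_compose[OF Zc[OF j] lim t]) (use s in simp)
      then show "(\<lambda>k. P (s k) x) \<longlonglongrightarrow> P t x"
        unfolding P_def
        by (rule sdp_tendsto[of N m "\<lambda>k. z (s k)" "z t", rotated 3]) (use m inj s t x in auto)
    qed
  qed
  have t0: "0 \<in> {0..T}" and tT: "T \<in> {0..T}" using T by auto
  have int: "(\<integral>x. f (grad (P t) x) \<partial>\<mu>) = (\<Sum>i<N. m i * f (Z i t))" if "continuous_on UNIV f" "t \<in> {0..T}" for f :: "real^3 \<Rightarrow> real" and t
    using integral_grad_sdp[OF m inj[OF that(2)] that(1)] by (simp add: P_def z_def)
  have moments: "\<bar>(\<integral>x. f (grad (P s) x) \<partial>\<mu>) - (\<integral>x. f (grad (P t) x) \<partial>\<mu>)\<bar> \<le> R * \<bar>s - t\<bar>"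
    if st: "s \<in> {0..T}" "t \<in> {0..T}" and f: "1-lipschitz_on UNIV f" for s t and f :: "real^3 \<Rightarrow> real"
  proof -
    have "\<bar>(\<integral>x. f (grad (P s) x) \<partial>\<mu>) - (\<integral>x. f (grad (P t) x) \<partial>\<mu>)\<bar> \<le> (\<Sum>i<N. m i * norm (Z i s - Z i t))"
      using moment_diff[OF m inj[OF st(1)] inj[OF st(2)] f] by (simp add: P_def z_def)
    also have "\<dots> \<le> (\<Sum>i<N. m i * (R * \<bar>s - t\<bar>))"
      by (intro sum_mono mult_left_mono lip st) (use mpos less_imp_le in auto)
    also have "\<dots> = R * \<bar>s - t\<bar>" using m by (simp add: masses_def sum_distrib_right[symmetric])
    finally show ?thesis .
  qed
  \<comment> \<open>Fundamental theorem of calculus for the sum of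
    \<open>m i * \<phi> (Z i t, t)\<close>. In \<open>m i *\<^sub>R Z' i t\<close> the part from the
    particle gives the dual integral; the part from the barycentre gives the physical one, since the
    gradient is constant on a cell and \<open>b i t\<close> is the integral of \<open>x\<close> over
    it.\<close>
  have weak: "spacetime T (dual_integrand \<phi>) P - spacetime T (physical_integrand \<phi>) P
      = (\<integral>x. \<phi> (grad (P T) x, T) \<partial>\<mu>) - (\<integral>z. \<phi> (z, 0) \<partial>push (P 0))" if \<phi>: "smooth_compact \<phi>" for \<phi>
  proof -
    let ?f = "\<lambda>t. \<Sum>i<N. m i * \<phi> (Z i t, t)"
    let ?A = "\<lambda>t. \<integral>x. dual_integrand \<phi> (x, grad (P t) x, t) \<partial>\<mu>"
    let ?B = "\<lambda>t. \<integral>x. physical_integrand \<phi> (x, grad (P t) x, t) \<partial>\<mu>"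
    have A: "?A t = (\<Sum>i<N. m i * (tderiv \<phi> (Z i t) t + (Jmat *v Z i t) \<bullet> sgrad \<phi> (Z i t) t))" if t: "t \<in> {0..T}" for t
    proof -
      have "continuous_on UNIV (\<lambda>y. tderiv \<phi> y t + (Jmat *v y) \<bullet> sgrad \<phi> y t)"
        by (intro continuous_intros continuous_tderiv[OF \<phi>] continuous_sgrad[OF \<phi>]
          bounded_linear.continuous_on[OF matrix_vector_mul_bounded_linear])
      from int[OF this t] show ?thesis by (simp add: dual_integrand_def)
    qed
    have Bt: "?B t = (\<Sum>i<N. (Jmat *v b i t) \<bullet> sgrad \<phi> (Z i t) t)" if t: "t \<in> {0..T}" for t
    proof -
      have "?B t = (\<Sum>i<N. \<integral>x. indicator (cell N m (z t) i) x *\<^sub>R physical_integrand \<phi> (x, z t i, t) \<partial>\<mu>)"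
        unfolding P_def by (rule integral_cells[OF m inj[OF t] continuous_integrands(2)[OF \<phi>]])
      also have "\<dots> = (\<Sum>i<N. (Jmat *v b i t) \<bullet> sgrad \<phi> (Z i t) t)"
      proof (rule sum.cong[OF refl])
        fix i
        have "(\<integral>x. indicator (cell N m (z t) i) x *\<^sub>R physical_integrand \<phi> (x, z t i, t) \<partial>\<mu>) =
            - (\<integral>x. indicator (cell N m (z t) i) x * (x \<bullet> (Jmat *v sgrad \<phi> (Z i t) t)) \<partial>\<mu>)"
          by (simp add: physical_integrand_def z_def inner_Jmat_left)
        also have "\<dots> = (Jmat *v b i t) \<bullet> sgrad \<phi> (Z i t) t"
          unfolding bary_inner(1)[OF m, symmetric] b_def inner_Jmat_left ..
        finally show "(\<integral>x. indicator (cell N m (z t) i) x *\<^sub>R physical_integrand \<phi> (x, z t i, t) \<partial>\<mu>) = (Jmat *v b i t) \<bullet> sgrad \<phi> (Z i t) t" .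
      qed
      finally show ?thesis .
    qed
    have d: "(?f has_vector_derivative ?A t - ?B t) (at t within {0..T})" if t: "t \<in> {0..T}" for t
    proof -
      have di: "((\<lambda>t. \<phi> (Z i t, t)) has_vector_derivative sgrad \<phi> (Z i t) t \<bullet> Z' i t + tderiv \<phi> (Z i t) t) (at t within {0..T})" if i: "i < N" for i
      proof -
        have "((\<lambda>t. (Z i t, t)) has_vector_derivative (Z' i t, 1)) (at t within {0..T})"
          by (intro has_vector_derivative_Pair der[OF i t] has_vector_derivative_id)
        moreover have "(\<phi> has_derivative frechet_derivative \<phi> (at (Z i t, t))) (at (Z i t, t) within (\<lambda>t. (Z i t, t)) ` {0..T})"
          using smooth_compactD(1)[OF \<phi>, of "(Z i t, t)"] frechet_derivative_works has_derivative_at_withinI by blast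
        ultimately have "(\<phi> \<circ> (\<lambda>t. (Z i t, t)) has_vector_derivative frechet_derivative \<phi> (at (Z i t, t)) (Z' i t, 1)) (at t within {0..T})"
          using vector_derivative_diff_chain_within by blast
        then show ?thesis by (simp add: comp_def frechet_derivative_split[OF \<phi>])
      qed
      have "(?f has_vector_derivative (\<Sum>i<N. m i * (sgrad \<phi> (Z i t) t \<bullet> Z' i t + tderiv \<phi> (Z i t) t))) (at t within {0..T})"
        by (intro has_vector_derivative_sum has_vector_derivative_mult_right di) auto
      moreover have "(\<Sum>i<N. m i * (sgrad \<phi> (Z i t) t \<bullet> Z' i t + tderiv \<phi> (Z i t) t)) = ?A t - ?B t"
        unfolding A[OF t] Bt[OF t] sum_subtractf[symmetric]
      proof (rule sum.cong[OF refl])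
        fix i assume "i \<in> {..<N}"
        then have "m i \<noteq> 0" using mpos[of i] by simp
        then have "m i *\<^sub>R Z' i t = m i *\<^sub>R (Jmat *v Z i t) - Jmat *v b i t"
          by (simp add: Z'_def matrix_vector_mult_diff_distrib matrix_vector_mult_scaleR scaleR_diff_right)
        then have "m i * (sgrad \<phi> (Z i t) t \<bullet> Z' i t) = m i * ((Jmat *v Z i t) \<bullet> sgrad \<phi> (Z i t) t) - (Jmat *v b i t) \<bullet> sgrad \<phi> (Z i t) t"
          by (metis inner_commute inner_diff_left inner_scaleR_left)
        then show "m i * (sgrad \<phi> (Z i t) t \<bullet> Z' i t + tderiv \<phi> (Z i t) t) =
          m i * (tderiv \<phi> (Z i t) t + (Jmat *v Z i t) \<bullet> sgrad \<phi> (Z i t) t) - (Jmat *v b i t) \<bullet> sgrad \<phi> (Z i t) t"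
          by (simp add: distrib_left)
      qed
      ultimately show ?thesis by simp
    qed
    have hi: "((\<lambda>t. ?A t - ?B t) has_integral ?f T - ?f 0) {0..T}"
      using T by (intro fundamental_theorem_of_calculus d) auto
    have "?A integrable_on {0..T}" "?B integrable_on {0..T}"
      by (intro integrable_continuous_interval potpath_integral_continuous[OF PP] continuous_integrands[OF \<phi>])+
    from Henstock_Kurzweil_Integration.integral_diff[OF this] integral_unique[OF hi]
    have "integral {0..T} ?A - integral {0..T} ?B = ?f T - ?f 0" by simp
    moreover have c\<phi>: "continuous_on UNIV (\<lambda>z. \<phi> (z, t))" for t
      by (intro continuous_on_compose2[OF smooth_compactD(3)[OF \<phi>]] continuous_intros) auto
    moreover have "(\<integral>z. \<phi> (z, 0) \<partial>push (P 0)) = (\<integral>x. \<phi> (grad (P 0) x, 0) \<partial>\<mu>)"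
      by (rule integral_push[OF p[OF t0] borel_measurable_continuous_onI[OF c\<phi>]])
    ultimately show ?thesis
      using int[OF c\<phi> tT] int[OF c\<phi> t0] by (simp add: spacetime_def)
  qed
  have sol: "geostrophic_solution \<Omega> T (push (P 0)) (\<lambda>t. push (P t))"
    by (rule geostrophic_solutionI[OF PP T weak])
  have C1: "discrete_C1 T (\<lambda>t. push (P t))"
    unfolding discrete_C1_def
  proof (rule exI[of _ N], rule exI[of _ m], rule exI[of _ Z], rule exI[of _ Z'], intro conjI allI impI ballI)
    show "Z i t \<noteq> Z j t" if "t \<in> {0..T}" "i < N" "j < N" "i \<noteq> j" for t i j
      using inj[OF that(1)] that by (auto simp: inj_on_def z_def)
    show "emeasure (push (P t)) A = (\<Sum>i<N. ennreal (m i) * indicator A (Z i t))" if "t \<in> {0..T}" "A \<in> sets borel" for t A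
      unfolding P_def using emeasure_push_sdp[OF m inj[OF that(1)] that(2)] by (simp add: z_def)
  qed (use m der Z'c in \<open>auto simp: masses_def\<close>)
  \<comment> \<open>Expanding the squares leaves \<open>y \<bullet> y / 2 - x \<bullet> y\<close>,
    minus half the square of the conserved third coordinate, plus a term in \<open>x\<close> alone.
    The vertical term \<open>- x $ 3 * y $ 3\<close> of the energy completes the inner
    product.\<close>
  have E: "energy \<Omega> (push (P t)) = (\<Sum>i<N. m i / 2 * (Z i t \<bullet> Z i t)) - (\<Sum>i<N. b i t \<bullet> Z i t)
      - (\<Sum>i<N. m i * (y i $ 3)\<^sup>2 / 2) + (\<integral>x. ((x $ 1)\<^sup>2 + (x $ 2)\<^sup>2) / 2 \<partial>\<mu>)" if t: "t \<in> {0..T}" for t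
  proof -
    let ?k = "\<lambda>y::real^3. y \<bullet> y / 2 - (y $ 3)\<^sup>2 / 2"
    have ck: "continuous_on UNIV ?k" by (intro continuous_intros) auto
    have cI: "continuous_on UNIV (\<lambda>q::(real^3)\<times>(real^3)\<times>real. fst q \<bullet> fst (snd q))"
      by (intro continuous_intros)
    have ck': "continuous_on UNIV (\<lambda>q::(real^3)\<times>(real^3)\<times>real. ?k (fst (snd q)))" by (intro continuous_intros) auto
    have energy_density: "energy_density (x, y, 0) = ?k y - x \<bullet> y + ((x $ 1)\<^sup>2 + (x $ 2)\<^sup>2) / 2" for x y
      by (simp add: energy_density_def inner_vec_def sum_3 power2_eq_square algebra_simps add_divide_distrib)
    have i1: "integrable \<mu> (\<lambda>x. ?k (grad (P t) x))" using continuous_grad_integrable[OF ck' p[OF t], of 0] by simp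
    have i2: "integrable \<mu> (\<lambda>x. x \<bullet> grad (P t) x)" by (rule integrable_inner_grad[OF p[OF t]])
    have i3: "integrable \<mu> (\<lambda>x. ((x $ 1)\<^sup>2 + (x $ 2)\<^sup>2) / 2 :: real)"
      by (intro integrable_mu_continuous continuous_intros) auto
    have "energy \<Omega> (push (P t)) = (\<integral>x. ?k (grad (P t) x) \<partial>\<mu>) - (\<integral>x. x \<bullet> grad (P t) x \<partial>\<mu>) + (\<integral>x. ((x $ 1)\<^sup>2 + (x $ 2)\<^sup>2) / 2 \<partial>\<mu>)"
      unfolding energy_push[OF p[OF t]] energy_density
      by (subst Bochner_Integration.integral_add[OF Bochner_Integration.integrable_diff[OF i1 i2] i3],
          subst Bochner_Integration.integral_diff[OF i1 i2]) simp
    also have "(\<integral>x. ?k (grad (P t) x) \<partial>\<mu>) = (\<Sum>i<N. m i * ?k (Z i t))" by (rule int[OF ck t])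
    also have "\<dots> = (\<Sum>i<N. m i / 2 * (Z i t \<bullet> Z i t)) - (\<Sum>i<N. m i * (y i $ 3)\<^sup>2 / 2)"
      unfolding sum_subtractf[symmetric] using third[OF _ t] by (intro sum.cong) (auto simp: algebra_simps)
    also have "(\<integral>x. x \<bullet> grad (P t) x \<partial>\<mu>) = (\<Sum>i<N. b i t \<bullet> Z i t)"
      using integral_cells[OF m inj[OF t] cI, of 0] bary_inner(1)[OF m] by (simp add: P_def b_def z_def)
    finally show ?thesis by simp
  qed
  have "\<exists>c. \<forall>t\<in>{0..T}. (\<Sum>i<N. m i / 2 * (Z i t \<bullet> Z i t)) - (\<Sum>i<N. b i t \<bullet> Z i t) = c"
  proof (rule constant_if_optimal[OF der lip bc])
    show "(\<Sum>i<N. b i t \<bullet> Z i s) \<le> (\<Sum>i<N. b i s \<bullet> Z i s)" if "s \<in> {0..T}" "t \<in> {0..T}" for s t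
      using bary_optimal[OF m inj[OF that(2)] inj[OF that(1)]] by (simp add: b_def z_def)
    show "(m i *\<^sub>R Z i t - b i t) \<bullet> Z' i t = 0" if "i < N" "t \<in> {0..T}" for i t
    proof -
      have "m i *\<^sub>R Z i t - b i t = m i *\<^sub>R (Z i t - (1 / m i) *\<^sub>R b i t)"
        using mpos[OF that(1)] by (simp add: scaleR_diff_right)
      then show ?thesis by (simp add: Z'_def inner_Jmat)
    qed
  qed
  then obtain c where c: "\<forall>t\<in>{0..T}. (\<Sum>i<N. m i / 2 * (Z i t \<bullet> Z i t)) - (\<Sum>i<N. b i t \<bullet> Z i t) = c" ..
  have "energy \<Omega> (push (P t)) = energy \<Omega> (push (P 0))" if t: "t \<in> {0..T}" for t
    unfolding E[OF t] E[OF t0] bspec[OF c t] bspec[OF c t0] ..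
  moreover have "(\<integral>x. f (grad (P 0) x) \<partial>\<mu>) = (\<Sum>i<N. m i * f (y i))" if "continuous_on UNIV f" for f :: "real^3 \<Rightarrow> real"
    using int[OF that t0] init by simp
  ultimately show ?thesis
    using PP sol C1 moments weak unfolding discrete_geostrophic_solution_def particle_path_def by (intro exI[of _ P]) blast
qed

end

section \<open>Discretisation and passage to the limit\<close>

text \<open>Raise the \<open>i\<close>-th point by \<open>s * i\<close>. Each pair of indices rules
  out only one slope \<open>s\<close>, so some small \<open>s\<close> avoids all of these finitely
  many values.\<close>

lemma distinct_third_coordinates:
  fixes p :: "nat \<Rightarrow> real^3"
  assumes e: "e > 0"
  obtains y where "inj_on (\<lambda>i. y i $ 3) {..<N}" "\<forall>i<N. norm (y i - p i) \<le> e"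
proof -
  define F where "F = (\<lambda>(i, j). (p j $ 3 - p i $ 3) / (real i - real j)) ` ({..<N} \<times> {..<N})"
  have "finite F" by (simp add: F_def)
  moreover have "infinite {0<..<e / real (Suc N)}" using e by (intro infinite_Ioo) simp
  ultimately obtain s where s: "s \<in> {0<..<e / real (Suc N)}" "s \<notin> F"
    by (meson finite_subset subsetI)
  define y where "y i = p i + (s * real i) *\<^sub>R axis 3 1" for i
  show ?thesis
  proof (rule that[of y])
    show "inj_on (\<lambda>i. y i $ 3) {..<N}"
    proof (rule inj_onI, rule ccontr)
      fix i j assume ij: "i \<in> {..<N}" "j \<in> {..<N}" "y i $ 3 = y j $ 3" "i \<noteq> j"
      then have "s * (real i - real j) = p j $ 3 - p i $ 3"
        by (simp add: y_def axis_def algebra_simps)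
      then have "s = (p j $ 3 - p i $ 3) / (real i - real j)"
        using ij(4) by (simp add: field_simps)
      then have "s \<in> F" using ij unfolding F_def by (intro image_eqI[of _ _ "(i, j)"]) auto
      with s(2) show False ..
    qed
    show "\<forall>i<N. norm (y i - p i) \<le> e"
    proof (intro allI impI)
      fix i assume i: "i < N"
      have "norm (y i - p i) = s * real i" using s by (simp add: y_def norm_axis_1)
      also have "\<dots> \<le> (e / real (Suc N)) * real (Suc N)"
        using s i e by (intro mult_mono) auto
      also have "\<dots> = e" by simp
      finally show "norm (y i - p i) \<le> e" .
    qed
  qed
qed

text \<open>Each particle stands for a piece of the ball of radius \<open>e/2\<close>, and half of
  \<open>e\<close> is left for separating the heights. The error for a test function is then its
  oscillation at scale \<open>e\<close>, which is why \<eta> is any bound for that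
  oscillation.\<close>

lemma discretise_measure:
  fixes \<alpha> :: "(real^3) measure"
  assumes pr: "prob_space \<alpha>" and sets: "sets \<alpha> = sets borel" and B: "emeasure \<alpha> (cball 0 B) = 1"
    and e: "0 < e" "e \<le> 1"
  shows "\<exists>N m y. masses N m \<and> inj_on (\<lambda>i. y i $ 3) {..<N} \<and> (\<forall>i<N. norm (y i) \<le> B + 1) \<and>
    (\<forall>(f :: real^3 \<Rightarrow> real) \<eta>. continuous_on UNIV f \<longrightarrow>
      (\<forall>u v. norm u \<le> B + 1 \<longrightarrow> norm v \<le> B + 1 \<longrightarrow> norm (u - v) \<le> e \<longrightarrow> \<bar>f u - f v\<bar> \<le> \<eta>) \<longrightarrow>
      \<bar>(\<integral>u. f u \<partial>\<alpha>) - (\<Sum>i<N. m i * f (y i))\<bar> \<le> \<eta>)"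
proof -
  interpret A: prob_space \<alpha> by fact
  have space: "space \<alpha> = UNIV" using sets_eq_imp_space_eq[OF sets] by simp
  obtain C where C: "finite C" "C \<subseteq> cball (0::real^3) B" "cball 0 B \<subseteq> (\<Union>c\<in>C. ball c (e/2))"
    using compactE_image[OF compact_cball, of "cball (0::real^3) B" "\<lambda>c. ball c (e/2)" 0 B] e
    by (metis (no_types, lifting) UN_iff centre_in_ball half_gt_zero open_ball subsetI)
  obtain c where c: "bij_betw c {..<card C} C" using C(1) ex_bij_betw_nat_finite[of C] by (auto simp: lessThan_atLeast0)
  define M where "M = card C"
  \<comment> \<open>Every point is assigned to the first ball of the enumeration that contains it,
    which makes the cover disjoint.\<close>
  define A where "A k = {u \<in> cball 0 B. u \<in> ball (c k) (e/2) \<and> (\<forall>j<k. u \<notin> ball (c j) (e/2))}" for k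
  have A_eq: "A k = cball 0 B \<inter> ball (c k) (e/2) - (\<Union>j<k. ball (c j) (e/2))" for k by (auto simp: A_def)
  have A_sets: "A k \<in> sets \<alpha>" for k unfolding sets A_eq by (intro sets.Diff sets.Int sets.finite_UN) auto
  have uniq: "k = l" if "u \<in> A k" "u \<in> A l" for u k l
    using that unfolding A_def by (metis (no_types, lifting) mem_Collect_eq linorder_neqE_nat)
  have cov: "\<exists>k<M. u \<in> A k" if u: "u \<in> cball 0 B" for u
  proof -
    obtain x where x: "x \<in> C" "u \<in> ball x (e/2)" using C(3) u by blast
    obtain k0 where k0: "k0 < M" "x = c k0" using c x(1) by (auto simp: bij_betw_def M_def)
    define k where "k = (LEAST k. u \<in> ball (c k) (e/2))"
    have "u \<in> ball (c k) (e/2)" unfolding k_def by (rule LeastI[of _ k0]) (use x k0 in simp)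
    moreover have "\<forall>j<k. u \<notin> ball (c j) (e/2)" unfolding k_def using not_less_Least by blast
    moreover have "k \<le> k0" unfolding k_def by (rule Least_le) (use x k0 in simp)
    ultimately show ?thesis using u k0(1) by (auto simp: A_def intro!: exI[of _ k])
  qed
  \<comment> \<open>Masses have to be positive, so pieces of measure zero are dropped at the price
    of a null set.\<close>
  define I where "I = {k. k < M \<and> measure \<alpha> (A k) > 0}"
  define N where "N = card I"
  have "finite I" by (simp add: I_def)
  then obtain h where h: "bij_betw h {..<N} I" using ex_bij_betw_nat_finite[of I] by (auto simp: lessThan_atLeast0 N_def)
  have hI: "h i < M" "measure \<alpha> (A (h i)) > 0" if "i < N" for i
    using h that by (auto simp: bij_betw_def I_def)
  have h_inj: "h i = h j \<Longrightarrow> i = j" if "i < N" "j < N" for i j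
    using h that by (auto simp: bij_betw_def inj_on_def)
  define m where "m i = measure \<alpha> (A (h i))" for i
  have "AE u in \<alpha>. u \<in> cball 0 B" using A.AE_in_set_eq_1[of "cball 0 B"] B sets by (simp add: A.emeasure_eq_measure)
  moreover have "AE u in \<alpha>. \<forall>k\<in>{k. k < M \<and> k \<notin> I}. u \<notin> A k"
  proof (rule AE_finite_allI)
    fix k assume k: "k \<in> {k. k < M \<and> k \<notin> I}"
    then have "measure \<alpha> (A k) = 0" by (auto simp: I_def less_le)
    then have "A k \<in> null_sets \<alpha>" using A_sets by (auto simp: null_sets_def A.emeasure_eq_measure)
    then show "AE u in \<alpha>. u \<notin> A k" by (rule AE_not_in)
  qed simp
  ultimately have ae: "AE u in \<alpha>. norm u \<le> B \<and> (\<exists>i<N. \<forall>j<N. u \<in> A (h j) \<longleftrightarrow> j = i)"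
  proof eventually_elim
    case (elim u)
    obtain k where k: "k < M" "u \<in> A k" using cov elim(1) by blast
    then have "k \<in> I" using elim(2) by blast
    then obtain i where i: "i < N" "h i = k" using h by (auto simp: bij_betw_def)
    have "u \<in> A (h j) \<longleftrightarrow> j = i" if "j < N" for j
    proof
      assume "u \<in> A (h j)"
      then have "h i = h j" using uniq[OF k(2)] i(2) by simp
      then show "j = i" using h_inj[OF i(1) that] by simp
    qed (use k(2) i(2) in simp)
    then show ?case using elim(1) i(1) by auto
  qed
  note sel = sum_indicator_select[of _ N _ "\<lambda>j. A (h j)", where 'b=real, unfolded real_scaleR_def]
  have ii: "integrable \<alpha> (\<lambda>u. indicator (A (h j)) u * F j)" for F :: "nat \<Rightarrow> real" and j
    using A_sets by (intro integrable_mult_left integrable_real_indicator) (auto simp: A.emeasure_eq_measure)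
  have int_sum: "(\<integral>u. (\<Sum>j<N. indicator (A (h j)) u * F j) \<partial>\<alpha>) = (\<Sum>j<N. m j * F j)"
      "integrable \<alpha> (\<lambda>u. \<Sum>j<N. indicator (A (h j)) u * F j)" for F :: "nat \<Rightarrow> real"
  proof -
    show "integrable \<alpha> (\<lambda>u. \<Sum>j<N. indicator (A (h j)) u * F j)" by (intro Bochner_Integration.integrable_sum ii)
    have "(\<integral>u. (\<Sum>j<N. indicator (A (h j)) u * F j) \<partial>\<alpha>) = (\<Sum>j<N. \<integral>u. indicator (A (h j)) u * F j \<partial>\<alpha>)"
      by (rule Bochner_Integration.integral_sum) (rule ii)
    also have "\<dots> = (\<Sum>j<N. m j * F j)"
      by (intro sum.cong refl) (simp add: m_def space)
    finally show "(\<integral>u. (\<Sum>j<N. indicator (A (h j)) u * F j) \<partial>\<alpha>) = (\<Sum>j<N. m j * F j)" .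
  qed
  have "(\<Sum>j<N. m j * 1) = (\<integral>u. (\<Sum>j<N. indicator (A (h j)) u * 1) \<partial>\<alpha>)" by (rule int_sum(1)[symmetric])
  also have "\<dots> = (\<integral>u. 1 \<partial>\<alpha>)"
  proof (rule integral_cong_AE)
    show "AE u in \<alpha>. (\<Sum>j<N. indicator (A (h j)) u * 1) = (1::real)"
      using ae
    proof eventually_elim
      case (elim u)
      then obtain i where "i < N" "\<forall>j<N. u \<in> A (h j) \<longleftrightarrow> j = i" by blast
      from sel[OF this, of "\<lambda>_. 1"] show ?case .
    qed
    show "(\<lambda>u. \<Sum>j<N. indicator (A (h j)) u * 1 :: real) \<in> borel_measurable \<alpha>"
      using int_sum(2)[of "\<lambda>_. 1"] by (rule borel_measurable_integrable)
  qed simp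
  finally have m1: "(\<Sum>j<N. m j) = 1" using A.prob_space by simp
  have m: "masses N m" using m1 hI(2) by (simp add: masses_def m_def)
  obtain y where y: "inj_on (\<lambda>i. y i $ 3) {..<N}" "\<forall>i<N. norm (y i - c (h i)) \<le> e/2"
    using distinct_third_coordinates[of "e/2" N "\<lambda>i. c (h i)"] e by auto
  have cB: "norm (c k) \<le> B" if "k < M" for k
    using c C(2) that by (auto simp: bij_betw_def M_def subset_iff)
  have yB: "norm (y i) \<le> B + 1" if i: "i < N" for i
    using norm_triangle_sub[of "y i" "c (h i)"] y(2)[rule_format, OF i] cB[OF hI(1)[OF i]] e by linarith
  have approx: "\<bar>(\<integral>u. f u \<partial>\<alpha>) - (\<Sum>i<N. m i * f (y i))\<bar> \<le> \<eta>"
    if f: "continuous_on UNIV f"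
      and osc: "\<forall>u v. norm u \<le> B + 1 \<longrightarrow> norm v \<le> B + 1 \<longrightarrow> norm (u - v) \<le> e \<longrightarrow> \<bar>f u - f v\<bar> \<le> \<eta>" for f :: "real^3 \<Rightarrow> real" and \<eta>
  proof -
    have fm: "f \<in> borel_measurable \<alpha>"
      using borel_measurable_continuous_onI[OF f] measurable_cong_sets[OF sets refl] by blast
    have "compact (f ` cball 0 B)" by (rule compact_continuous_image[OF continuous_on_subset[OF f] compact_cball]) simp
    then have "bounded (f ` cball 0 B)" by (rule compact_imp_bounded)
    then obtain b where b: "\<forall>v\<in>f ` cball 0 B. norm v \<le> b" by (auto simp: bounded_iff)
    have "AE u in \<alpha>. norm (f u) \<le> b" using ae by eventually_elim (use b in auto)
    then have fi: "integrable \<alpha> f" by (rule A.integrable_const_bound[OF _ fm])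
    let ?g = "\<lambda>u. \<Sum>j<N. indicator (A (h j)) u * f (y j)"
    have "(\<integral>u. f u \<partial>\<alpha>) - (\<Sum>i<N. m i * f (y i)) = (\<integral>u. f u - ?g u \<partial>\<alpha>)"
      using Bochner_Integration.integral_diff[OF fi int_sum(2)[of "\<lambda>j. f (y j)"]] int_sum(1)[of "\<lambda>j. f (y j)"] by simp
    also have "\<bar>\<dots>\<bar> \<le> (\<integral>u. \<bar>f u - ?g u\<bar> \<partial>\<alpha>)" by (rule integral_abs_bound)
    also have "\<dots> \<le> (\<integral>u. \<eta> \<partial>\<alpha>)"
    proof (rule integral_mono_AE)
      show "integrable \<alpha> (\<lambda>u. \<bar>f u - ?g u\<bar>)"
        by (intro integrable_abs Bochner_Integration.integrable_diff fi int_sum(2))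
      show "AE u in \<alpha>. \<bar>f u - ?g u\<bar> \<le> \<eta>"
        using ae
      proof eventually_elim
        case (elim u)
        then obtain i where i: "i < N" "\<forall>j<N. u \<in> A (h j) \<longleftrightarrow> j = i" by blast
        then have "u \<in> A (h i)" by blast
        then have "norm (u - c (h i)) < e/2" by (simp add: A_def dist_norm norm_minus_commute)
        then have "norm (u - y i) \<le> e"
          using norm_triangle_ineq[of "u - c (h i)" "c (h i) - y i"] y(2)[rule_format, OF i(1)] by (simp add: norm_minus_commute)
        then show ?case unfolding sel[OF i] using osc yB[OF i(1)] elim by auto
      qed
    qed simp
    also have "\<dots> = \<eta>" using A.prob_space by simp
    finally show ?thesis .
  qed
  show ?thesis
    by (rule exI[of _ N], rule exI[of _ m], rule exI[of _ y]) (use m y(1) yB approx in blast)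
qed

section \<open>Extraction of a limit curve and convergence of the approximations\<close>

context unit_domain
begin

text \<open>No explicit modulus in time is available: the Lipschitz bound on the moments passes
  through \<open>pot_modulus\<close>, whose \<open>d\<close> is the same for all \<open>n\<close>.
  With the Lipschitz bound in space this is joint equicontinuity.\<close>

lemma potpath_subsequence:
  assumes P: "\<And>n. potpath R T (P n)"
    and moments: "\<And>n s t f. s \<in> {0..T} \<Longrightarrow> t \<in> {0..T} \<Longrightarrow> 1-lipschitz_on UNIV (f :: real^3 \<Rightarrow> real) \<Longrightarrow>
      \<bar>(\<integral>x. f (grad (P n s) x) \<partial>\<mu>) - (\<integral>x. f (grad (P n t) x) \<partial>\<mu>)\<bar> \<le> R * \<bar>s - t\<bar>"
    and T: "T > 0"
  shows "\<exists>k Q. strict_mono (k :: nat \<Rightarrow> nat) \<and> potpath R T Q \<and>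
    (\<forall>e>0. \<exists>M. \<forall>n\<ge>M. \<forall>t\<in>{0..T}. \<forall>x\<in>closure \<Omega>. \<bar>P (k n) t x - Q t x\<bar> < e)"
proof -
  have R: "R \<ge> 0" using pot_nonneg[OF potpathD[OF P, of 0]] T by simp
  let ?S = "{0..T} \<times> closure \<Omega>"
  let ?F = "\<lambda>n (p :: real \<times> (real^3)). P n (fst p) (snd p)"
  have "\<exists>g k. continuous_on ?S g \<and> strict_mono (k :: nat \<Rightarrow> nat) \<and>
    (\<forall>e>0. \<exists>M. \<forall>n x. n \<ge> M \<and> x \<in> ?S \<longrightarrow> norm (?F (k n) x - g x) < e)"
  proof (rule Arzela_Ascoli[of ?S ?F "2 * r * R"])
    show "compact ?S" by (rule compact_Times[OF compact_Icc compact_closure_dom])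
    show "norm (?F n p) \<le> 2 * r * R" if "p \<in> ?S" for n p
      using that pot_bound[OF potpathD[OF P]] by auto
    show "\<exists>d>0. \<forall>n q. q \<in> ?S \<and> norm (p - q) < d \<longrightarrow> norm (?F n p - ?F n q) < e" if p: "p \<in> ?S" and e: "e > 0" for p e
    proof -
      obtain t x where tx: "p = (t, x)" "t \<in> {0..T}" "x \<in> closure \<Omega>" using p by auto
      obtain d where d: "d > 0" "\<And>\<psi> \<xi> x. pot R \<psi> \<Longrightarrow> pot R \<xi> \<Longrightarrow>
        (\<And>f :: real^3 \<Rightarrow> real. 1-lipschitz_on UNIV f \<Longrightarrow> \<bar>(\<integral>x. f (grad \<psi> x) \<partial>\<mu>) - (\<integral>x. f (grad \<xi> x) \<partial>\<mu>)\<bar> \<le> d) \<Longrightarrow>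
        x \<in> closure \<Omega> \<Longrightarrow> \<bar>\<psi> x - \<xi> x\<bar> < e/2" using pot_modulus[of "e/2"] e by (metis half_gt_zero)
      \<comment> \<open>Ensures both \<open>R * \<bar>t - s\<bar> < d\<close>, which costs
        \<open>e/2\<close> in time, and \<open>R * norm (x - y) < e/2\<close> in space.
        \<open>R + 1\<close> avoids division by zero.\<close>
      let ?d = "min d (e/2) / (R + 1)"
      show ?thesis
      proof (intro exI[of _ ?d] conjI allI impI)
        show "?d > 0" using d(1) e R by simp
        fix n q assume q: "q \<in> ?S \<and> norm (p - q) < ?d"
        then obtain s y where sy: "q = (s, y)" "s \<in> {0..T}" "y \<in> closure \<Omega>" by auto
        have n1: "\<bar>t - s\<bar> \<le> norm (p - q)" "norm (x - y) \<le> norm (p - q)"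
          using norm_fst_le[of "t - s" "x - y"] norm_snd_le[of "x - y" "t - s"] tx sy by auto
        have n2: "(R + 1) * norm (p - q) < min d (e/2)" using q R by (simp add: pos_less_divide_eq mult.commute)
        have a1: "R * \<bar>t - s\<bar> \<le> (R + 1) * norm (p - q)" using n1(1) R by (intro mult_mono) auto
        have a2: "R * norm (x - y) \<le> (R + 1) * norm (p - q)" using n1(2) R by (intro mult_mono) auto
        have "\<bar>P n t x - P n s x\<bar> < e/2"
        proof (rule d(2)[OF potpathD[OF P tx(2)] potpathD[OF P sy(2)] _ tx(3)])
          fix f :: "real^3 \<Rightarrow> real" assume "1-lipschitz_on UNIV f"
          from moments[OF tx(2) sy(2) this, of n]
          show "\<bar>(\<integral>x. f (grad (P n t) x) \<partial>\<mu>) - (\<integral>x. f (grad (P n s) x) \<partial>\<mu>)\<bar> \<le> d" using a1 n2 by linarith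
        qed
        moreover have "\<bar>P n s x - P n s y\<bar> \<le> R * norm (x - y)"
          by (rule pot_lipschitz[OF potpathD[OF P sy(2)] tx(3) sy(3)])
        ultimately have "\<bar>P n t x - P n s y\<bar> < e" using a2 n2 by linarith
        then show "norm (?F n p - ?F n q) < e" using tx(1) sy(1) by simp
      qed
    qed
  qed blast
  then obtain g k where g: "continuous_on ?S g" and k: "strict_mono (k :: nat \<Rightarrow> nat)"
    and unif: "\<forall>e>0. \<exists>M. \<forall>n x. n \<ge> M \<and> x \<in> ?S \<longrightarrow> norm (?F (k n) x - g x) < e" by blast
  define Q where "Q t x = g (t, x)" for t x
  have unif': "\<forall>e>0. \<exists>M. \<forall>n\<ge>M. \<forall>t\<in>{0..T}. \<forall>x\<in>closure \<Omega>. \<bar>P (k n) t x - Q t x\<bar> < e"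
  proof (intro allI impI)
    fix e :: real assume "e > 0"
    with unif obtain M where M: "\<forall>n x. n \<ge> M \<and> x \<in> ?S \<longrightarrow> norm (?F (k n) x - g x) < e" by blast
    have "\<bar>P (k n) t x - Q t x\<bar> < e" if "n \<ge> M" "t \<in> {0..T}" "x \<in> closure \<Omega>" for n t x
      using M[rule_format, of n "(t, x)"] that by (simp add: Q_def)
    then show "\<exists>M. \<forall>n\<ge>M. \<forall>t\<in>{0..T}. \<forall>x\<in>closure \<Omega>. \<bar>P (k n) t x - Q t x\<bar> < e" by blast
  qed
  have conv: "(\<lambda>n. P (k n) t x) \<longlonglongrightarrow> Q t x" if "t \<in> {0..T}" "x \<in> closure \<Omega>" for t x
    unfolding LIMSEQ_def dist_real_def using unif' that by meson
  have "potpath R T Q"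
    unfolding potpath_def
  proof (intro conjI ballI)
    show "pot R (Q t)" if t: "t \<in> {0..T}" for t
      by (rule pot_limit[of R "\<lambda>n. P (k n) t", OF potpathD[OF P t] conv[OF t]])
    show "continuous_on {0..T} (\<lambda>t. Q t x)" if x: "x \<in> closure \<Omega>" for x
      unfolding Q_def by (rule continuous_on_compose2[OF g]) (use x in \<open>auto intro!: continuous_intros\<close>)
  qed
  with k unif' show ?thesis by blast
qed

text \<open>If uniformity failed, there would be bad times accumulating at some \<open>t0\<close>.
  Along them both potentials converge to \<open>Q t0\<close>, so the gradients approach each other
  in the mean square, which dominates \<open>W2\<close>.\<close>

lemma uniform_W2_convergence:
  assumes F: "\<And>n. potpath R T (F n)" and Q: "potpath R T Q" and T: "T > 0"
    and unif: "\<forall>e>0. \<exists>M. \<forall>n\<ge>M. \<forall>t\<in>{0..T}. \<forall>x\<in>closure \<Omega>. \<bar>F n t x - Q t x\<bar> < e"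
  shows "(\<lambda>n. SUP t\<in>{0..T}. W2 (push (F n t)) (push (Q t))) \<longlonglongrightarrow> 0"
proof -
  have *: "\<exists>M. \<forall>n\<ge>M. \<forall>t\<in>{0..T}. W2 (push (F n t)) (push (Q t)) \<le> e" if e: "e > 0" for e
  proof (rule ccontr)
    assume "\<not> ?thesis"
    then have "\<forall>M. \<exists>n t. n \<ge> M \<and> t \<in> {0..T} \<and> e < W2 (push (F n t)) (push (Q t))" by (meson not_le)
    then obtain n t where n: "\<And>M::nat. n M \<ge> M" and t: "\<And>M. t M \<in> {0..T}"
      and W: "\<And>M. e < W2 (push (F (n M) (t M))) (push (Q (t M)))" by metis
    obtain t0 q where t0: "t0 \<in> {0..T}" and q: "strict_mono (q :: nat \<Rightarrow> nat)" and lim: "(t \<circ> q) \<longlonglongrightarrow> t0"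
      using compact_Icc[of 0 T] t unfolding compact_def by metis
    let ?s = "\<lambda>j. t (q j)" and ?n = "\<lambda>j. n (q j)"
    have lim': "?s \<longlonglongrightarrow> t0" using lim by (simp add: comp_def)
    have G: "(\<lambda>j. Q (?s j) x) \<longlonglongrightarrow> Q t0 x" if "x \<in> \<Omega>" for x
      by (rule potpath_tendsto[OF Q t t0 lim' that])
    have Fc: "(\<lambda>j. F (?n j) (?s j) x) \<longlonglongrightarrow> Q t0 x" if x: "x \<in> \<Omega>" for x
    proof -
      have "(\<lambda>j. F (?n j) (?s j) x - Q (?s j) x) \<longlonglongrightarrow> 0"
        unfolding LIMSEQ_def dist_real_def
      proof (intro allI impI)
        fix d :: real assume "d > 0"
        with unif obtain M where M: "\<forall>n\<ge>M. \<forall>t\<in>{0..T}. \<forall>x\<in>closure \<Omega>. \<bar>F n t x - Q t x\<bar> < d" by blast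
        have "?n j \<ge> M" if "j \<ge> M" for j
          using n[of "q j"] seq_suble[OF q, of j] that by linarith
        then show "\<exists>M. \<forall>j\<ge>M. \<bar>F (?n j) (?s j) x - Q (?s j) x - 0\<bar> < d"
          using M t subsetD[OF closure_subset x] by (intro exI[of _ M]) (metis diff_zero)
      qed
      from tendsto_add[OF this G[OF x]] show ?thesis by simp
    qed
    have "(\<lambda>j. sqrt (\<integral>x. (norm (grad (F (?n j) (?s j)) x - grad (Q (?s j)) x))\<^sup>2 \<partial>\<mu>)) \<longlonglongrightarrow> sqrt 0"
      by (intro tendsto_real_sqrt grad_L2_tendsto[OF potpathD[OF F t] potpathD[OF Q t] potpathD[OF Q t0]] Fc G)
    moreover have "e \<le> sqrt (\<integral>x. (norm (grad (F (?n j) (?s j)) x - grad (Q (?s j)) x))\<^sup>2 \<partial>\<mu>)" for j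
      using W[of "q j"] W2_push_le[OF potpathD[OF F t] potpathD[OF Q t], of "?n j" "q j" "q j"] by linarith
    ultimately have "e \<le> sqrt 0" using LIMSEQ_le_const by blast
    then show False using e by simp
  qed
  show ?thesis
    unfolding LIMSEQ_def
  proof (intro allI impI)
    fix e :: real assume e: "e > 0"
    obtain M where M: "\<forall>n\<ge>M. \<forall>t\<in>{0..T}. W2 (push (F n t)) (push (Q t)) \<le> e/2" using *[of "e/2"] e by auto
    \<comment> \<open>A real supremum needs a bounded set, which the uniform estimate provides; its
      sign comes from the value at time 0.\<close>
    have "dist (SUP t\<in>{0..T}. W2 (push (F n t)) (push (Q t))) 0 < e" if n: "n \<ge> M" for n
    proof -
      have le: "(SUP t\<in>{0..T}. W2 (push (F n t)) (push (Q t))) \<le> e/2"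
        using M n T by (intro cSUP_least) auto
      have "bdd_above ((\<lambda>t. W2 (push (F n t)) (push (Q t))) ` {0..T})"
        by (rule bdd_aboveI2[of _ _ "e/2"]) (use M n in auto)
      then have "W2 (push (F n 0)) (push (Q 0)) \<le> (SUP t\<in>{0..T}. W2 (push (F n t)) (push (Q t)))"
        using T by (intro cSUP_upper) auto
      then have "0 \<le> (SUP t\<in>{0..T}. W2 (push (F n t)) (push (Q t)))" using W2_nonneg order_trans by blast
      with le show ?thesis using e by (simp add: dist_real_def)
    qed
    then show "\<exists>M. \<forall>n\<ge>M. dist (SUP t\<in>{0..T}. W2 (push (F n t)) (push (Q t))) 0 < e" by blast
  qed
qed

theorem geostrophic_limit:
  fixes \<alpha>0 :: "(real^3) measure"
  assumes T: "T > 0" and \<alpha>0: "\<alpha>0 \<in> Pc"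
  shows "\<exists>\<alpha> \<alpha>N. geostrophic_solution \<Omega> T \<alpha>0 \<alpha> \<and> energy_conserving \<Omega> T \<alpha> \<and>
           (\<forall>N::nat. discrete_geostrophic_solution \<Omega> T (\<alpha>N N 0) (\<alpha>N N)) \<and>
           (\<lambda>N. SUP t\<in>{0..T}. W2 (\<alpha>N N t) (\<alpha> t)) \<longlonglongrightarrow> 0"
proof -
  have pr: "prob_space \<alpha>0" and sets: "sets \<alpha>0 = sets borel" using \<alpha>0 by (auto simp: Pc_def)
  interpret A: prob_space \<alpha>0 by (rule pr)
  obtain K where K: "compact K" "emeasure \<alpha>0 K = 1" using \<alpha>0 by (auto simp: Pc_def)
  obtain B where "\<forall>x\<in>K. norm x \<le> B" using compact_imp_bounded[OF K(1)] unfolding bounded_iff by blast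
  then have B: "K \<subseteq> cball 0 B" by auto
  have "emeasure \<alpha>0 K \<le> emeasure \<alpha>0 (cball 0 B)" by (rule emeasure_mono[OF B]) (simp add: sets)
  then have B1: "emeasure \<alpha>0 (cball 0 B) = 1"
    using K(2) A.emeasure_le_1[of "cball 0 B"] by simp
  define R where "R = (B + 1 + r) * exp T"
  \<comment> \<open>\<eta> bounds the oscillation of \<open>f\<close> at the mesh size of the
    \<open>n\<close>-th discretisation.\<close>
  let ?osc = "\<lambda>n (f :: real^3 \<Rightarrow> real) \<eta>. \<forall>u v. norm u \<le> B + 1 \<longrightarrow> norm v \<le> B + 1 \<longrightarrow> norm (u - v) \<le> 1 / real (Suc n) \<longrightarrow> \<bar>f u - f v\<bar> \<le> \<eta>"
  have "\<forall>n. \<exists>P. particle_path R T P \<and>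
    (\<forall>f \<eta>. continuous_on UNIV f \<longrightarrow> ?osc n f \<eta> \<longrightarrow> \<bar>(\<integral>u. f u \<partial>\<alpha>0) - (\<integral>x. f (grad (P 0) x) \<partial>\<mu>)\<bar> \<le> \<eta>)"
  proof
    fix n
    obtain N m y where y: "masses N m" "inj_on (\<lambda>i. y i $ 3) {..<N}" "\<forall>i<N. norm (y i) \<le> B + 1"
      "\<forall>f \<eta>. continuous_on UNIV f \<longrightarrow> ?osc n f \<eta> \<longrightarrow> \<bar>(\<integral>u. f u \<partial>\<alpha>0) - (\<Sum>i<N. m i * f (y i))\<bar> \<le> \<eta>"
      using discretise_measure[OF pr sets B1, of "1 / real (Suc n)"] by auto
    obtain P where P: "particle_path R T P"
      "\<forall>f :: real^3 \<Rightarrow> real. continuous_on UNIV f \<longrightarrow> (\<integral>x. f (grad (P 0) x) \<partial>\<mu>) = (\<Sum>i<N. m i * f (y i))"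
      using discrete_solution_exists[OF T y(1,2) y(3)[rule_format]] unfolding R_def by blast
    have "\<forall>f \<eta>. continuous_on UNIV f \<longrightarrow> ?osc n f \<eta> \<longrightarrow> \<bar>(\<integral>u. f u \<partial>\<alpha>0) - (\<integral>x. f (grad (P 0) x) \<partial>\<mu>)\<bar> \<le> \<eta>"
      using y(4) P(2) by simp
    with P(1) show "\<exists>P. particle_path R T P \<and>
      (\<forall>f \<eta>. continuous_on UNIV f \<longrightarrow> ?osc n f \<eta> \<longrightarrow> \<bar>(\<integral>u. f u \<partial>\<alpha>0) - (\<integral>x. f (grad (P 0) x) \<partial>\<mu>)\<bar> \<le> \<eta>)" by blast
  qed
  from choice[OF this] obtain P where P': "\<forall>n. particle_path R T (P n) \<and>
    (\<forall>f \<eta>. continuous_on UNIV f \<longrightarrow> ?osc n f \<eta> \<longrightarrow> \<bar>(\<integral>u. f u \<partial>\<alpha>0) - (\<integral>x. f (grad (P n 0) x) \<partial>\<mu>)\<bar> \<le> \<eta>)" by blast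
  then have "particle_path R T (P n)" for n by blast
  note P = this[unfolded particle_path_def]
  have PP: "potpath R T (P n)" for n using P by blast
  have disc: "discrete_geostrophic_solution \<Omega> T (push (P n 0)) (\<lambda>t. push (P n t))" for n using P by blast
  have weak: "spacetime T (dual_integrand \<phi>) (P n) - spacetime T (physical_integrand \<phi>) (P n)
      = (\<integral>x. \<phi> (grad (P n T) x, T) \<partial>\<mu>) - (\<integral>z. \<phi> (z, 0) \<partial>push (P n 0))" if "smooth_compact \<phi>" for n \<phi> using P that by blast
  have en: "energy \<Omega> (push (P n t)) = energy \<Omega> (push (P n 0))" if "t \<in> {0..T}" for n t using P that by blast
  have mom: "\<bar>(\<integral>x. f (grad (P n s) x) \<partial>\<mu>) - (\<integral>x. f (grad (P n t) x) \<partial>\<mu>)\<bar> \<le> R * \<bar>s - t\<bar>"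
    if "s \<in> {0..T}" "t \<in> {0..T}" "1-lipschitz_on UNIV f" for n s t and f :: "real^3 \<Rightarrow> real" using P that by blast
  have init: "\<bar>(\<integral>u. f u \<partial>\<alpha>0) - (\<integral>x. f (grad (P n 0) x) \<partial>\<mu>)\<bar> \<le> \<eta>" if "continuous_on UNIV f" "?osc n f \<eta>" for n f \<eta>
    using P' that by blast
  obtain k Q where k: "strict_mono (k :: nat \<Rightarrow> nat)" and Q: "potpath R T Q"
    and unif: "\<forall>e>0. \<exists>M. \<forall>n\<ge>M. \<forall>t\<in>{0..T}. \<forall>x\<in>closure \<Omega>. \<bar>P (k n) t x - Q t x\<bar> < e"
    using potpath_subsequence[of R T P, OF PP mom T] by blast
  have t0: "0 \<in> {0..T}" and tT: "T \<in> {0..T}" using T by auto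
  have conv: "(\<lambda>n. P (k n) t x) \<longlonglongrightarrow> Q t x" if "t \<in> {0..T}" "x \<in> \<Omega>" for t x
  proof -
    have "x \<in> closure \<Omega>" using that(2) closure_subset by blast
    then show ?thesis unfolding LIMSEQ_def dist_real_def using unif that(1) by meson
  qed
  \<comment> \<open>The initial measure enters the weak formulation only as the integral of
    \<open>\<phi> (z, 0)\<close>, so convergence against continuous functions suffices. It follows
    from uniform continuity on the ball of radius \<open>B + 1\<close>, which contains all initial
    particles.\<close>
  have init_lim: "(\<lambda>n. \<integral>x. f (grad (P (k n) 0) x) \<partial>\<mu>) \<longlonglongrightarrow> (\<integral>u. f u \<partial>\<alpha>0)" if f: "continuous_on UNIV f" for f :: "real^3 \<Rightarrow> real"
    unfolding LIMSEQ_def dist_real_def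
  proof (intro allI impI)
    fix e :: real assume e: "e > 0"
    have "uniformly_continuous_on (cball 0 (B + 1)) f"
      by (rule compact_uniformly_continuous[OF continuous_on_subset[OF f] compact_cball]) simp
    then obtain d where d: "d > 0" "\<And>u v. u \<in> cball 0 (B + 1) \<Longrightarrow> v \<in> cball 0 (B + 1) \<Longrightarrow> dist v u < d \<Longrightarrow> dist (f v) (f u) < e/2"
      unfolding uniformly_continuous_on_def using e by (metis half_gt_zero)
    obtain M where M: "1 / real (Suc M) < d" using d(1) nat_approx_posE by blast
    have "\<bar>(\<integral>x. f (grad (P (k n) 0) x) \<partial>\<mu>) - (\<integral>u. f u \<partial>\<alpha>0)\<bar> < e" if n: "n \<ge> M" for n
    proof -
      have "1 / real (Suc (k n)) \<le> 1 / real (Suc M)"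
        using n seq_suble[OF k, of n] by (intro divide_left_mono) auto
      then have "?osc (k n) f (e/2)"
        using d(2) M by (auto simp: dist_norm intro!: less_imp_le)
      from init[OF f this] show ?thesis using e by linarith
    qed
    then show "\<exists>M. \<forall>n\<ge>M. \<bar>(\<integral>x. f (grad (P (k n) 0) x) \<partial>\<mu>) - (\<integral>u. f u \<partial>\<alpha>0)\<bar> < e" by blast
  qed
  have sol: "geostrophic_solution \<Omega> T \<alpha>0 (\<lambda>t. push (Q t))"
  proof (rule geostrophic_solutionI[OF Q T])
    fix \<phi> :: "(real^3) \<times> real \<Rightarrow> real" assume \<phi>: "smooth_compact \<phi>"
    have c\<phi>: "continuous_on UNIV (\<lambda>z. \<phi> (z, t))" for t
      by (intro continuous_on_compose2[OF smooth_compactD(3)[OF \<phi>]] continuous_intros) auto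
    have cT: "continuous_on UNIV (\<lambda>q::(real^3)\<times>(real^3)\<times>real. \<phi> (fst (snd q), T))"
      by (intro continuous_on_compose2[OF smooth_compactD(3)[OF \<phi>]] continuous_intros) auto
    have "(\<lambda>n. spacetime T (dual_integrand \<phi>) (P (k n)) - spacetime T (physical_integrand \<phi>) (P (k n)))
        \<longlonglongrightarrow> spacetime T (dual_integrand \<phi>) Q - spacetime T (physical_integrand \<phi>) Q"
      by (intro tendsto_diff spacetime_tendsto[OF PP Q] continuous_integrands[OF \<phi>] conv)
    moreover have "(\<lambda>n. (\<integral>x. \<phi> (grad (P (k n) T) x, T) \<partial>\<mu>) - (\<integral>x. \<phi> (grad (P (k n) 0) x, 0) \<partial>\<mu>))
        \<longlonglongrightarrow> (\<integral>x. \<phi> (grad (Q T) x, T) \<partial>\<mu>) - (\<integral>z. \<phi> (z, 0) \<partial>\<alpha>0)"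
      using integral_grad_tendsto[OF cT potpathD[OF PP tT] potpathD[OF Q tT] conv[OF tT] tendsto_const[of 0]]
      by (intro tendsto_diff init_lim[OF c\<phi>]) simp
    moreover have "(\<integral>z. \<phi> (z, 0) \<partial>push (P n 0)) = (\<integral>x. \<phi> (grad (P n 0) x, 0) \<partial>\<mu>)" for n
      by (rule integral_push[OF potpathD[OF PP t0] borel_measurable_continuous_onI[OF c\<phi>]])
    ultimately show "spacetime T (dual_integrand \<phi>) Q - spacetime T (physical_integrand \<phi>) Q
        = (\<integral>x. \<phi> (grad (Q T) x, T) \<partial>\<mu>) - (\<integral>z. \<phi> (z, 0) \<partial>\<alpha>0)"
      using weak[OF \<phi>] LIMSEQ_unique by simp
  qed
  have E: "(\<lambda>n. energy \<Omega> (push (P (k n) t))) \<longlonglongrightarrow> energy \<Omega> (push (Q t))" if t: "t \<in> {0..T}" for t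
    unfolding energy_push[OF potpathD[OF PP t]] energy_push[OF potpathD[OF Q t]]
    by (rule integral_grad_tendsto[OF continuous_energy_density potpathD[OF PP t] potpathD[OF Q t] conv[OF t] tendsto_const])
  have "energy_conserving \<Omega> T (\<lambda>t. push (Q t))"
    unfolding energy_conserving_def
  proof
    fix t assume t: "t \<in> {0..T}"
    show "energy \<Omega> (push (Q t)) = energy \<Omega> (push (Q 0))"
      using E[OF t] E[OF t0] unfolding en[OF t] by (rule LIMSEQ_unique)
  qed
  moreover have "(\<lambda>n. SUP t\<in>{0..T}. W2 (push (P (k n) t)) (push (Q t))) \<longlonglongrightarrow> 0"
    by (rule uniform_W2_convergence[OF PP Q T unif])
  \<comment> \<open>The extracted subsequence, renumbered, is the approximating sequence; each
    member is a solution for its own initial measure.\<close>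
  ultimately show ?thesis
    using sol disc by (intro exI[of _ "\<lambda>t. push (Q t)"] exI[of _ "\<lambda>n t. push (P (k n) t)"]) simp
qed

end

theorem theorem3p6:
  fixes \<Omega> :: "(real^3) set" and T :: real and \<alpha>0 :: "(real^3) measure"
  assumes "open \<Omega>" and "bounded \<Omega>" and "convex \<Omega>" and "emeasure lebesgue \<Omega> = 1"
    and "T > 0" and "\<alpha>0 \<in> Pc"
  shows "\<exists>\<alpha> \<alpha>N. geostrophic_solution \<Omega> T \<alpha>0 \<alpha> \<and> energy_conserving \<Omega> T \<alpha> \<and>
           (\<forall>N::nat. discrete_geostrophic_solution \<Omega> T (\<alpha>N N 0) (\<alpha>N N)) \<and>
           (\<lambda>N. SUP t\<in>{0..T}. W2 (\<alpha>N N t) (\<alpha> t)) \<longlonglongrightarrow> 0"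
proof -
  obtain r where "\<forall>x\<in>\<Omega>. norm x \<le> r" using assms(2) unfolding bounded_iff by blast
  then have "\<Omega> \<subseteq> cball 0 r" by auto
  then interpret unit_domain \<Omega> r using assms by unfold_locales auto
  show ?thesis by (rule geostrophic_limit[OF assms(5,6)])
qed

end
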